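(* Let $(\tau_n)_n$ be a sequence of conjugation-invariant random permutations, where $\tau_n$ has size $n$ and (random) cycle type $t^{(n)}$. Suppose that $t_1^{(n)}=np_1+o_{\mathbf{P}}(\sqrt n)$ and $2t_2^{(n)}=np_2+o_{\mathbf{P}}(n)$ as $n\to\infty$, for some $p_1,p_2\in[0,1]$. Then for any integer $r\ge1$, we have the following (joint) convergence in distribution: $$\left(\frac{X_\pi(\tau_n)-\binom nr\mu_\pi^{p_1}}{n^{r-1/2}}\right)_{\pi\in\mathfrak{S}_r}\underset{n\to\infty}{\longrightarrow}\mathcal{N}(0,\Sigma^{p_1,p_2}),$$ where for any $\pi,\rho\in\mathfrak{S}_r$, if $U,V,W$ are i.i.d. uniform random variables on $[0,1]$: $$\begin{aligned}((r-1)!)^2\,\Sigma^{p_1,p_2}_{\pi,\rho}={}&p_1\,\mathrm{Cov}[\psi_\pi^{p_1}(U,U),\psi_\rho^{p_1}(U,U)]+(1-p_1)\,\mathrm{Cov}[\psi_\pi^{p_1}(U,V),\psi_\rho^{p_1}(U,V)]\\&+p_2\,\mathrm{Cov}[\psi_\pi^{p_1}(U,V),\psi_\rho^{p_1}(V,U)]+2(1-p_1-p_2)\,\mathrm{Cov}[\psi_\pi^{p_1}(U,V),\psi_\rho^{p_1}(V,W)].\end{aligned}$$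
   Context: $[n]=\{1,\dots,n\}$ and $\mathfrak{S}_r$ is the set of permutations of $[r]$. A random permutation $\tau$ of $[n]$ is conjugation-invariant if for every fixed permutation $\rho$ of $[n]$, $\rho\circ\tau\circ\rho^{-1}$ has the same law as $\tau$. The cycle type of a permutation of $[n]$ is $t=(t_1,\dots,t_n)$, where $t_p$ is its number of cycles of length $p$. $X_n=o_{\mathbf{P}}(a_n)$ means $X_n/a_n\to0$ in probability. For $\tau\in\mathfrak{S}_n$ and $\pi\in\mathfrak{S}_r$, $X_\pi(\tau)$ is the number of subsets $\{i_1<\dots<i_r\}$ of $[n]$ such that for all $j,k\in[r]$, $\pi(j)>\pi(k)\iff\tau(i_j)>\tau(i_k)$. For a set of $r$ points in the plane with pairwise distinct x-coordinates and pairwise distinct y-coordinates, $\mathrm{Perm}$ of this set is the permutation $\tau\in\mathfrak{S}_r$ such that $\tau(i)=j$ when the $i$-th point from the left is the $j$-th point from the bottom. Fix $r\ge1$ and $p_1\in[0,1]$, and let $\hat Z_1,\dots,\hat Z_r$ be i.i.d. with law $p_1\mathrm{Leb}_\Delta+(1-p_1)\mathrm{Leb}_{[0,1]^2}$, where $\mathrm{Leb}_\Delta$ is the uniform probability measure on the diagonal of $[0,1]^2$ (the law of $(U,U)$ for $U$ uniform on $[0,1]$) and $\mathrm{Leb}_{[0,1]^2}$ is Lebesgue measure on $[0,1]^2$. For $z\in[0,1]^2$ set $\psi_\pi^{p_1}(z):=\mathbf{P}(\mathrm{Perm}(\{\hat Z_1,\dots,\hat Z_{r-1},z\})=\pi)$,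 and $\mu_\pi^{p_1}:=\mathbf{P}(\mathrm{Perm}(\{\hat Z_1,\dots,\hat Z_r\})=\pi)=\mathbb{E}[\psi_\pi^{p_1}(\hat Z_r)]$.
   Formalization: The matrix Σ as printed need not be symmetric (its last term is not, e.g. r=4, π=2314, ρ=2134, p_2=0, p_1 near 1), so N(0,Σ) is read as the Gaussian law whose linear forms t have variance t^TΣt, i.e. its covariance matrix is the symmetric part of Σ. *)

theory Defs
  imports "HOL-Probability.Probability" "HOL-Combinatorics.Combinatorics"
begin

section \<open>Permutations, patterns and cycle counts\<close>

definition perms :: "nat \<Rightarrow> (nat \<Rightarrow> nat) set" where
  "perms r = {\<pi>. \<pi> permutes {1..r}}"

definition pattern_count :: "nat \<Rightarrow> nat \<Rightarrow> (nat \<Rightarrow> nat) \<Rightarrow> (nat \<Rightarrow> nat) \<Rightarrow> nat" where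
  \<comment> \<open>The list \<open>sorted_list_of_set I\<close> is 0-based, so its entry \<open>j - 1\<close> is the \<open>j\<close>-th smallest element of \<open>I\<close>.\<close>
  "pattern_count n r \<pi> \<tau> =
     card {I. I \<subseteq> {1..n} \<and> card I = r \<and>
       (\<forall>j\<in>{1..r}. \<forall>k\<in>{1..r}.
          \<pi> j > \<pi> k \<longleftrightarrow>
          \<tau> (sorted_list_of_set I ! (j - 1)) > \<tau> (sorted_list_of_set I ! (k - 1)))}"

definition cycle_count :: "nat \<Rightarrow> (nat \<Rightarrow> nat) \<Rightarrow> nat \<Rightarrow> nat" where
  "cycle_count n \<tau> p = card {C \<in> orbit \<tau> ` {1..n}. card C = p}"

section \<open>Random permutations and stochastic order symbols\<close>

definition random_permutation :: "nat \<Rightarrow> 'a measure \<Rightarrow> ('a \<Rightarrow> nat \<Rightarrow> nat) \<Rightarrow> bool" where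
  "random_permutation n M \<tau> \<longleftrightarrow>
     prob_space M \<and> \<tau> \<in> measurable M (count_space (perms n))"

definition conjugation_invariant :: "nat \<Rightarrow> 'a measure \<Rightarrow> ('a \<Rightarrow> nat \<Rightarrow> nat) \<Rightarrow> bool" where
  "conjugation_invariant n M \<tau> \<longleftrightarrow>
     (\<forall>\<rho>\<in>perms n.
        distr M (count_space (perms n)) (\<lambda>\<omega>. \<rho> \<circ> \<tau> \<omega> \<circ> inv \<rho>)
        = distr M (count_space (perms n)) \<tau>)"

definition small_o_prob ::
  "(nat \<Rightarrow> 'a measure) \<Rightarrow> (nat \<Rightarrow> 'a \<Rightarrow> real) \<Rightarrow> (nat \<Rightarrow> real) \<Rightarrow> bool" where
  "small_o_prob M X a \<longleftrightarrow>
     (\<forall>\<epsilon>>0. (\<lambda>n. measure (M n) {\<omega> \<in> space (M n). \<bar>X n \<omega> / a n\<bar> > \<epsilon>}) \<longlonglongrightarrow> 0)"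

section \<open>The permutation of a planar point set, and the limiting densities\<close>

text \<open>
  \<open>is_Perm r A \<pi>\<close> says that \<open>A\<close> consists of \<open>r\<close> points with distinct abscissas and distinct
  ordinates and that \<open>Perm A = \<pi>\<close>. The two cardinalities are the positions of \<open>z\<close> counted
  from the left and from the bottom.
\<close>

definition is_Perm :: "nat \<Rightarrow> (real \<times> real) set \<Rightarrow> (nat \<Rightarrow> nat) \<Rightarrow> bool" where
  "is_Perm r A \<pi> \<longleftrightarrow>
     finite A \<and> card A = r \<and> inj_on fst A \<and> inj_on snd A \<and> \<pi> \<in> perms r \<and>
     (\<forall>z\<in>A. \<pi> (card {w \<in> A. fst w \<le> fst z}) = card {w \<in> A. snd w \<le> snd z})"

definition unif :: "real measure" where
  "unif = uniform_measure lborel {0..1}"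

definition Leb_diag :: "(real \<times> real) measure" where
  "Leb_diag = distr unif borel (\<lambda>u. (u, u))"

definition Leb_square :: "(real \<times> real) measure" where
  "Leb_square = uniform_measure lborel ({0..1} \<times> {0..1})"

definition mixture :: "real \<Rightarrow> (real \<times> real) measure" where
  "mixture p = measure_of UNIV (sets borel)
     (\<lambda>A. ennreal p * emeasure Leb_diag A + ennreal (1 - p) * emeasure Leb_square A)"

definition psi :: "nat \<Rightarrow> real \<Rightarrow> (nat \<Rightarrow> nat) \<Rightarrow> real \<times> real \<Rightarrow> real" where
  "psi r p \<pi> z =
     (let Q = PiM {1..<r} (\<lambda>_. mixture p)
      in measure Q {Z \<in> space Q. is_Perm r (insert z (Z ` {1..<r})) \<pi>})"

definition mu :: "nat \<Rightarrow> real \<Rightarrow> (nat \<Rightarrow> nat) \<Rightarrow> real" where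
  "mu r p \<pi> =
     (let Q = PiM {1..r} (\<lambda>_. mixture p)
      in measure Q {Z \<in> space Q. is_Perm r (Z ` {1..r}) \<pi>})"

section \<open>The limiting covariance\<close>

definition Cov :: "'a measure \<Rightarrow> ('a \<Rightarrow> real) \<Rightarrow> ('a \<Rightarrow> real) \<Rightarrow> real" where
  "Cov M X Y = (\<integral>\<omega>. (X \<omega> - (\<integral>\<omega>'. X \<omega>' \<partial>M)) * (Y \<omega> - (\<integral>\<omega>'. Y \<omega>' \<partial>M)) \<partial>M)"

definition UVW :: "(real \<times> real \<times> real) measure" where
  "UVW = unif \<Otimes>\<^sub>M (unif \<Otimes>\<^sub>M unif)"

definition Sigma_lim :: "nat \<Rightarrow> real \<Rightarrow> real \<Rightarrow> (nat \<Rightarrow> nat) \<Rightarrow> (nat \<Rightarrow> nat) \<Rightarrow> real" where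
  "Sigma_lim r p1 p2 \<pi> \<rho> =
     (p1 * Cov UVW (\<lambda>(u, v, w). psi r p1 \<pi> (u, u)) (\<lambda>(u, v, w). psi r p1 \<rho> (u, u))
      + (1 - p1) * Cov UVW (\<lambda>(u, v, w). psi r p1 \<pi> (u, v)) (\<lambda>(u, v, w). psi r p1 \<rho> (u, v))
      + p2 * Cov UVW (\<lambda>(u, v, w). psi r p1 \<pi> (u, v)) (\<lambda>(u, v, w). psi r p1 \<rho> (v, u))
      + 2 * (1 - p1 - p2) *
          Cov UVW (\<lambda>(u, v, w). psi r p1 \<pi> (u, v)) (\<lambda>(u, v, w). psi r p1 \<rho> (v, w)))
     / (fact (r - 1))\<^sup>2"

section \<open>Gaussian vectors and convergence in distribution\<close>

text \<open>
  A random vector indexed by a finite set \<open>I\<close> has its law on \<open>PiM I (\<lambda>_. borel)\<close>, the Borel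
  \<open>\<sigma>\<close>-algebra of the product topology on extensional functions.
\<close>

definition centered_normal :: "real \<Rightarrow> real measure \<Rightarrow> bool" where
  "centered_normal v L \<longleftrightarrow>
     v = 0 \<and> L = return borel 0 \<or>
     v > 0 \<and> L = density lborel (\<lambda>x. ennreal (normal_density 0 (sqrt v) x))"

text \<open>
  \<open>L\<close> is the (possibly degenerate) law \<open>N(0, S)\<close>: each linear form \<open>t\<close> is centered normal with
  variance \<open>t\<^sup>T S t\<close>. By the Cramer-Wold theorem at most one \<open>L\<close> qualifies, and an \<open>L\<close> exists
  iff the quadratic form of \<open>S\<close> is nonnegative. As in the characteristic function
  \<open>exp (- t\<^sup>T S t / 2)\<close>, \<open>S\<close> enters only through its quadratic form, so the covariance matrix
  of \<open>L\<close> is the symmetric part of \<open>S\<close>. This matters for \<open>Sigma_lim\<close>: its last term need not be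
  symmetric in \<open>\<pi>\<close> and \<open>\<rho>\<close>.
\<close>

definition centered_gaussian :: "'i set \<Rightarrow> ('i \<Rightarrow> 'i \<Rightarrow> real) \<Rightarrow> ('i \<Rightarrow> real) measure \<Rightarrow> bool" where
  "centered_gaussian I S L \<longleftrightarrow>
     prob_space L \<and> sets L = sets (PiM I (\<lambda>_. borel)) \<and>
     (\<forall>t. centered_normal (\<Sum>i\<in>I. \<Sum>j\<in>I. t i * t j * S i j)
            (distr L borel (\<lambda>x. \<Sum>i\<in>I. t i * x i)))"

definition converges_in_distribution ::
  "'i set \<Rightarrow> (nat \<Rightarrow> 'a measure) \<Rightarrow> (nat \<Rightarrow> 'a \<Rightarrow> 'i \<Rightarrow> real) \<Rightarrow> ('i \<Rightarrow> real) measure \<Rightarrow> bool" where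
  "converges_in_distribution I M Y L \<longleftrightarrow>
     (\<forall>f. continuous_map (product_topology (\<lambda>_. euclideanreal) I) euclideanreal f \<and>
          bounded (f ` (I \<rightarrow>\<^sub>E UNIV)) \<longrightarrow>
        (\<lambda>n. \<integral>x. f x \<partial>distr (M n) (PiM I (\<lambda>_. borel)) (Y n)) \<longlonglongrightarrow> (\<integral>x. f x \<partial>L))"

end

theory Submission
  imports Defs "HOL-Real_Asymp.Real_Asymp"
begin

text \<open>
  Conjugating \<open>\<tau>\<^sub>n\<close> by the ranks of i.i.d. uniform labels \<open>U\<^sub>1, \<dots>, U\<^sub>n\<close> preserves its law and turns
  \<open>X\<^sub>\<pi>\<close>, for a fixed permutation \<open>\<sigma>\<close>, into the pattern count of the points \<open>(U\<^sub>i, U\<^bsub>\<sigma> i\<^esub>)\<close>.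
  These points are independent unless they share a label, so each depends on at most two others.
  In the Hoeffding decomposition of the count, the remainders of two \<open>r\<close>-tuples of points are
  uncorrelated unless labels are shared twice, so all remainders together are negligible in \<open>L\<^sup>2\<close>.
  Replacing the laws of the points by the mixture costs \<open>\<bar>t\<^sub>1 - n p\<^sub>1\<bar> n\<^bsup>r-1\<^esup>\<close>, and what is left is
  the sum of \<open>\<psi>\<close> over the points, to which a central limit theorem for locally dependent variables applies.
  Its variance depends only on \<open>t\<^sub>1\<close> and \<open>t\<^sub>2\<close>. All bounds are explicit in \<open>\<sigma>\<close>, so they can be averaged
  over \<open>\<tau>\<^sub>n\<close>.
\<close>

text \<open>The hypotheses come at two scales because the cycle counts act at two levels. Fixed
  points shift the mean of the count, by at most the order of
  \<open>\<bar>t1 - n p1\<bar> n^(r-1)\<close>, and this is weighed against the normalisation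
  \<open>n^(r-1/2)\<close>. In the variance, cycles of length one and two matter only through the
  proportions of indices that they contain.

  The limit law has to be constructed, and the quadratic form of \<open>Sigma_lim\<close> is not
  visibly nonnegative. Nonnegativity is extracted from the approximation itself: the form is close
  to a genuine variance for every permutation whose cycle counts are nearly as prescribed, and the
  hypotheses force such permutations to occur.

  The obstacle in the Hoeffding step is that points with common labels are dependent. Instead of
  discarding such tuples, the sum runs over all maps from slots to indices, repetitions included,
  and each tuple is centred by the product of the marginal laws of its points. Slots that share no
  label are then centred exactly, and the pairs of tuples where this does not help are rare enough
  for a crude bound.\<close>

section \<open>Gaussian vectors\<close>

lemma sum_sum_insert:
  fixes f :: "'i \<Rightarrow> 'i \<Rightarrow> real"
  assumes "finite J" "x \<notin> J"
  shows "(\<Sum>i\<in>insert x J. \<Sum>j\<in>insert x J. f i j)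
    = f x x + (\<Sum>j\<in>J. f x j + f j x) + (\<Sum>i\<in>J. \<Sum>j\<in>J. f i j)"
  using assms by (simp add: sum.distrib add.assoc)

text \<open>Lagrange's reduction: complete the square in one variable at a time. As \<open>S\<close>
  need not be symmetric, cross terms enter as \<open>S x j + S j x\<close>, and \<open>a\<close> is
  a square root, in the sense of \<open>a a^T\<close>, of the symmetric part of
  \<open>S\<close>.\<close>

lemma psd_sum_of_squares:
  fixes S :: "'i \<Rightarrow> 'i \<Rightarrow> real"
  assumes "finite I" "\<And>t. (\<Sum>i\<in>I. \<Sum>j\<in>I. t i * t j * S i j) \<ge> 0"
  shows "\<exists>a. \<forall>t. (\<Sum>i\<in>I. \<Sum>j\<in>I. t i * t j * S i j) = (\<Sum>k\<in>I. (\<Sum>i\<in>I. t i * a i k)\<^sup>2)"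
  using assms
proof (induction I arbitrary: S rule: finite_induct)
  case empty
  then show ?case by simp
next
  case (insert x J)
  define s where "s = S x x"
  define b where "b j = S x j + S j x" for j
  have Q: "(\<Sum>i\<in>insert x J. \<Sum>j\<in>insert x J. t i * t j * S i j)
    = s * (t x)\<^sup>2 + t x * (\<Sum>j\<in>J. t j * b j) + (\<Sum>i\<in>J. \<Sum>j\<in>J. t i * t j * S i j)" for t
    unfolding sum_sum_insert[OF insert.hyps]
    by (simp add: s_def b_def sum_distrib_left algebra_simps power2_eq_square)
  have upd: "(\<Sum>j\<in>J. (t(x := c)) j * d j) = (\<Sum>j\<in>J. t j * d j)" for t d and c :: real
    using insert.hyps by (intro sum.cong) auto
  have upd2: "(\<Sum>i\<in>J. \<Sum>j\<in>J. (t(x := c)) i * (t(x := c)) j * S i j) = (\<Sum>i\<in>J. \<Sum>j\<in>J. t i * t j * S i j)"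
    for t and c :: real
    using insert.hyps by (intro sum.cong) auto
  have ge: "s * c\<^sup>2 + c * (\<Sum>j\<in>J. t j * b j) + (\<Sum>i\<in>J. \<Sum>j\<in>J. t i * t j * S i j) \<ge> 0" for t c
    using insert.prems[of "t(x := c)"] unfolding Q upd upd2 by simp
  have s0: "s \<ge> 0" using ge[of 1 "\<lambda>_. 0"] by simp
  show ?case
  proof (cases "s = 0")
    case True
    have lin: "(\<Sum>j\<in>J. t j * b j) = 0" for t
    proof (rule ccontr)
      assume neq: "(\<Sum>j\<in>J. t j * b j) \<noteq> 0"
      define B where "B = (\<Sum>j\<in>J. t j * b j)"
      define C where "C = (\<Sum>i\<in>J. \<Sum>j\<in>J. t i * t j * S i j)"
      \<comment> \<open>For this \<open>c\<close> the affine function \<open>c * B + C\<close> takes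
        the value \<open>C - \<bar>C\<bar> - 1\<close>, which is negative.\<close>
      show False
        using ge[of "- (\<bar>C\<bar> + 1) / B" t] neq True unfolding B_def[symmetric] C_def[symmetric] by auto
    qed
    have "(\<Sum>i\<in>J. \<Sum>j\<in>J. t i * t j * S i j) \<ge> 0" for t using ge[of 0] by simp
    then obtain a where a: "\<forall>t. (\<Sum>i\<in>J. \<Sum>j\<in>J. t i * t j * S i j) = (\<Sum>k\<in>J. (\<Sum>i\<in>J. t i * a i k)\<^sup>2)"
      using insert.IH[of S] by blast
    define a' where "a' i k = (if i = x \<or> k = x then 0 else a i k)" for i k
    have 1: "(\<Sum>i\<in>insert x J. t i * a' i x) = 0" for t
      by (auto simp: a'_def)
    have 2: "(\<Sum>i\<in>insert x J. t i * a' i k) = (\<Sum>i\<in>J. t i * a i k)" if "k \<in> J" for t k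
    proof -
      have "(\<Sum>i\<in>insert x J. t i * a' i k) = (\<Sum>i\<in>J. t i * a' i k)"
        using insert.hyps by (simp add: a'_def)
      also have "\<dots> = (\<Sum>i\<in>J. t i * a i k)"
        using insert.hyps that by (intro sum.cong) (auto simp: a'_def)
      finally show ?thesis .
    qed
    define F where "F t k = (\<Sum>i\<in>insert x J. t i * a' i k)" for t k
    have "(\<Sum>k\<in>insert x J. (F t k)\<^sup>2) = (\<Sum>k\<in>J. (\<Sum>i\<in>J. t i * a i k)\<^sup>2)" for t
      using insert.hyps 1[folded F_def] 2[folded F_def] by simp
    then show ?thesis
      unfolding F_def Q lin True a[rule_format] by (intro exI[of _ a']) simp
  next
    case False
    with s0 have s: "s > 0" by simp
    \<comment> \<open>The Schur complement: what is left of the form once the square in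
      \<open>t x\<close> is split off. It is the minimum of the form over \<open>t x\<close>,
      attained at the value inserted into \<open>ge\<close> below, and hence nonnegative.\<close>
    define S' where "S' i j = S i j - b i * b j / (4 * s)" for i j
    have S': "(\<Sum>i\<in>J. \<Sum>j\<in>J. t i * t j * S' i j)
      = (\<Sum>i\<in>J. \<Sum>j\<in>J. t i * t j * S i j) - (\<Sum>j\<in>J. t j * b j)\<^sup>2 / (4 * s)" for t
      unfolding power2_eq_square sum_product
      by (simp add: S'_def sum_subtractf sum_divide_distrib algebra_simps)
    have "(\<Sum>i\<in>J. \<Sum>j\<in>J. t i * t j * S' i j) \<ge> 0" for t
      using ge[of "- (\<Sum>j\<in>J. t j * b j) / (2 * s)" t] s unfolding S'
      by (simp add: power2_eq_square field_simps)
    then obtain a where a: "\<forall>t. (\<Sum>i\<in>J. \<Sum>j\<in>J. t i * t j * S' i j) = (\<Sum>k\<in>J. (\<Sum>i\<in>J. t i * a i k)\<^sup>2)"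
      using insert.IH[of S'] by blast
    define a' where "a' i k = (if k = x then (if i = x then sqrt s else b i / (2 * sqrt s))
       else if i = x then 0 else a i k)" for i k
    have 1: "(\<Sum>i\<in>insert x J. t i * a' i x) = t x * sqrt s + (\<Sum>j\<in>J. t j * b j) / (2 * sqrt s)" for t
    proof -
      have "(\<Sum>i\<in>insert x J. t i * a' i x) = t x * sqrt s + (\<Sum>i\<in>J. t i * a' i x)"
        using insert.hyps by (simp add: a'_def)
      also have "(\<Sum>i\<in>J. t i * a' i x) = (\<Sum>i\<in>J. t i * (b i / (2 * sqrt s)))"
        using insert.hyps by (intro sum.cong) (auto simp: a'_def)
      finally show ?thesis by (simp add: sum_divide_distrib)
    qed
    have 2: "(\<Sum>i\<in>insert x J. t i * a' i k) = (\<Sum>i\<in>J. t i * a i k)" if "k \<in> J" for t k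
    proof -
      have "(\<Sum>i\<in>insert x J. t i * a' i k) = (\<Sum>i\<in>J. t i * a' i k)"
        using insert.hyps that by (auto simp add: a'_def)
      also have "\<dots> = (\<Sum>i\<in>J. t i * a i k)"
        using insert.hyps that by (intro sum.cong) (auto simp: a'_def)
      finally show ?thesis .
    qed
    have sq: "(t x * sqrt s + B / (2 * sqrt s))\<^sup>2 = s * (t x)\<^sup>2 + t x * B + B\<^sup>2 / (4 * s)" for t B
      using s by (simp add: power2_sum power_mult_distrib power_divide field_simps)
    define F where "F t k = (\<Sum>i\<in>insert x J. t i * a' i k)" for t k
    have "(\<Sum>k\<in>insert x J. (F t k)\<^sup>2)
       = (t x * sqrt s + (\<Sum>j\<in>J. t j * b j) / (2 * sqrt s))\<^sup>2 + (\<Sum>k\<in>J. (\<Sum>i\<in>J. t i * a i k)\<^sup>2)" for t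
      using insert.hyps 1[folded F_def] 2[folded F_def] by simp
    then show ?thesis
      unfolding F_def Q a[rule_format, symmetric] S' sq by (intro exI[of _ a']) simp
  qed
qed

lemma char_normal:
  assumes "\<sigma> > 0"
  shows "char (density lborel (normal_density 0 \<sigma>)) u = exp (- of_real (u\<^sup>2 * \<sigma>\<^sup>2 / 2))"
proof -
  interpret real_distribution std_normal_distribution by (rule real_dist_normal_dist)
  have "distributed std_normal_distribution lborel (\<lambda>x. x) std_normal_density"
    using distr_id2[of lborel std_normal_distribution] by (simp add: distributed_def)
  from normal_density_affine[OF this, of \<sigma> 0] assms
  have "distributed std_normal_distribution lborel (\<lambda>x. \<sigma> * x) (normal_density 0 \<sigma>)" by simp
  then have eq: "density lborel (normal_density 0 \<sigma>) = distr std_normal_distribution lborel (\<lambda>x. \<sigma> * x)"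
    by (simp add: distributed_def)
  have "char (density lborel (normal_density 0 \<sigma>)) u = char std_normal_distribution (u * \<sigma>)"
    unfolding eq char_def by (subst integral_distr) (auto simp: ac_simps)
  then show ?thesis
    unfolding char_std_normal_distribution by (simp add: power_mult_distrib flip: exp_of_real)
qed

lemma centered_normalI:
  assumes M: "real_distribution M" and v: "v \<ge> 0"
    and ch: "\<And>u. char M u = exp (- of_real (u\<^sup>2 * v / 2))"
  shows "centered_normal v M"
proof (cases "v = 0")
  case True
  have "M = return borel 0"
  proof (rule Levy_uniqueness[OF M])
    show "real_distribution (return borel (0::real))"
      by (simp add: real_distribution_def real_distribution_axioms_def prob_space_return)
    show "char M = char (return borel 0)"
      using ch True by (auto simp: fun_eq_iff char_def integral_return)
  qed
  with True show ?thesis by (simp add: centered_normal_def)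
next
  case False
  with v have v: "v > 0" by simp
  have "M = density lborel (normal_density 0 (sqrt v))"
  proof (rule Levy_uniqueness[OF M])
    show "real_distribution (density lborel (normal_density 0 (sqrt v)))"
      using v by (simp add: real_distribution_def real_distribution_axioms_def prob_space_normal_density)
    show "char M = char (density lborel (normal_density 0 (sqrt v)))"
      using ch v by (auto simp: fun_eq_iff char_normal)
  qed
  with v show ?thesis by (simp add: centered_normal_def)
qed

text \<open>A linear image of independent standard normals, with the matrix provided by
  \<open>psd_sum_of_squares\<close>. The joint characteristic function is exported as well because
  it is the limit required by \<open>multivariate_levy_continuity\<close>.\<close>

lemma centered_gaussian_exists:
  fixes S :: "'i \<Rightarrow> 'i \<Rightarrow> real"
  assumes fin: "finite I" and psd: "\<And>t. (\<Sum>i\<in>I. \<Sum>j\<in>I. t i * t j * S i j) \<ge> 0"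
  obtains L where "centered_gaussian I S L"
    "\<And>t. (\<integral>x. iexp (\<Sum>i\<in>I. t i * x i) \<partial>L)
       = exp (- of_real ((\<Sum>i\<in>I. \<Sum>j\<in>I. t i * t j * S i j) / 2))"
proof -
  obtain a where a: "\<And>t. (\<Sum>i\<in>I. \<Sum>j\<in>I. t i * t j * S i j) = (\<Sum>k\<in>I. (\<Sum>i\<in>I. t i * a i k)\<^sup>2)"
    using psd_sum_of_squares[OF fin psd] by blast
  define G where "G = PiM I (\<lambda>_::'i. std_normal_distribution)"
  interpret N: real_distribution std_normal_distribution by (rule real_dist_normal_dist)
  interpret G: prob_space G unfolding G_def by (intro prob_space_PiM N.prob_space_axioms)
  interpret GP: product_prob_space "\<lambda>_::'i. std_normal_distribution" ..
  have G_sets[measurable_cong]: "sets G = sets (PiM I (\<lambda>_. borel))"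
    unfolding G_def by (intro sets_PiM_cong) auto
  define T where "T x = (\<lambda>i\<in>I. \<Sum>k\<in>I. a i k * x k)" for x :: "'i \<Rightarrow> real"
  have T[measurable]: "T \<in> measurable G (PiM I (\<lambda>_. borel))"
    unfolding T_def by measurable
  define L where "L = distr G (PiM I (\<lambda>_. borel)) T"
  interpret L: prob_space L unfolding L_def by (rule G.prob_space_distr) fact
  have L_sets[measurable_cong]: "sets L = sets (PiM I (\<lambda>_. borel))" by (simp add: L_def)
  have lin: "(\<Sum>i\<in>I. t i * T x i) = (\<Sum>k\<in>I. (\<Sum>i\<in>I. t i * a i k) * x k)" for t x
  proof -
    have "(\<Sum>i\<in>I. t i * T x i) = (\<Sum>i\<in>I. \<Sum>k\<in>I. t i * a i k * x k)"
      by (simp add: T_def sum_distrib_left ac_simps)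
    also have "\<dots> = (\<Sum>k\<in>I. (\<Sum>i\<in>I. t i * a i k) * x k)"
      by (subst sum.swap) (simp add: sum_distrib_right)
    finally show ?thesis .
  qed
  have ci: "(\<integral>x. iexp (\<Sum>i\<in>I. t i * x i) \<partial>L) = exp (- of_real ((\<Sum>i\<in>I. \<Sum>j\<in>I. t i * t j * S i j) / 2))" for t
  proof -
    define c where "c k = (\<Sum>i\<in>I. t i * a i k)" for k
    have "(\<integral>x. iexp (\<Sum>i\<in>I. t i * x i) \<partial>L) = (\<integral>x. iexp (\<Sum>k\<in>I. c k * x k) \<partial>G)"
      unfolding L_def by (subst integral_distr) (auto simp: lin c_def)
    also have "\<dots> = (\<integral>x. (\<Prod>k\<in>I. iexp (c k * x k)) \<partial>G)"
      by (simp add: exp_sum[OF fin] sum_distrib_left)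
    also have "\<dots> = (\<Prod>k\<in>I. \<integral>x. iexp (c k * x) \<partial>std_normal_distribution)"
      unfolding G_def by (intro GP.product_integral_prod fin N.integrable_iexp) auto
    also have "\<dots> = (\<Prod>k\<in>I. exp (- of_real ((c k)\<^sup>2 / 2)))"
      using char_std_normal_distribution by (intro prod.cong refl) (simp add: char_def fun_eq_iff flip: exp_of_real)
    also have "\<dots> = exp (- of_real ((\<Sum>k\<in>I. (c k)\<^sup>2) / 2))"
      by (simp add: exp_sum[OF fin, symmetric] sum_negf sum_divide_distrib)
    finally show ?thesis unfolding a c_def .
  qed
  have "centered_normal (\<Sum>i\<in>I. \<Sum>j\<in>I. t i * t j * S i j) (distr L borel (\<lambda>x. \<Sum>i\<in>I. t i * x i))" for t
  proof (rule centered_normalI)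
    show "real_distribution (distr L borel (\<lambda>x. \<Sum>i\<in>I. t i * x i))"
      by (intro L.real_distribution_distr) measurable
    show "0 \<le> (\<Sum>i\<in>I. \<Sum>j\<in>I. t i * t j * S i j)" by (rule psd)
    fix u
    have "char (distr L borel (\<lambda>x. \<Sum>i\<in>I. t i * x i)) u = (\<integral>x. iexp (\<Sum>i\<in>I. (u * t i) * x i) \<partial>L)"
      unfolding char_def by (subst integral_distr) (auto simp: sum_distrib_left ac_simps)
    also have "\<dots> = exp (- of_real (u\<^sup>2 * (\<Sum>i\<in>I. \<Sum>j\<in>I. t i * t j * S i j) / 2))"
      unfolding ci by (simp add: sum_distrib_left power2_eq_square ac_simps)
    finally show "char (distr L borel (\<lambda>x. \<Sum>i\<in>I. t i * x i)) u = \<dots>" .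
  qed
  then have "centered_gaussian I S L"
    using L.prob_space_axioms by (simp add: centered_gaussian_def L_sets)
  then show ?thesis using ci that by blast
qed

section \<open>The multivariate continuity theorem\<close>

text \<open>Real trigonometric polynomials. The phase yields the sines, and the product-to-sum
  formula makes the span an algebra, while all expectations remain determined by the joint
  characteristic function.\<close>

inductive_set trig :: "'i set \<Rightarrow> (('i \<Rightarrow> real) \<Rightarrow> real) set" for I where
  cosine: "(\<lambda>x. cos ((\<Sum>i\<in>I. t i * x i) + \<phi>)) \<in> trig I"
| scale: "f \<in> trig I \<Longrightarrow> (\<lambda>x. c * f x) \<in> trig I"
| add: "f \<in> trig I \<Longrightarrow> g \<in> trig I \<Longrightarrow> (\<lambda>x. f x + g x) \<in> trig I"

lemma trig_const: "(\<lambda>x. c) \<in> trig I"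
  using trig.scale[OF trig.cosine[of "\<lambda>_. 0" I 0], of c] by simp

lemma trig_sin:
  assumes "finite I" "k \<in> I"
  shows "(\<lambda>x. sin (c * x k)) \<in> trig I"
proof -
  have "cos ((\<Sum>i\<in>I. (if i = k then c else 0) * x i) + - (pi / 2)) = sin (c * x k)" for x :: "'a \<Rightarrow> real"
    using assms by (simp add: if_distrib[of "\<lambda>y. y * _"] cong: if_cong) (simp add: cos_diff)
  then show ?thesis
    using trig.cosine[where t="\<lambda>i. if i = k then c else 0" and I=I and \<phi>="- (pi / 2)"] by simp
qed

lemma trig_mult:
  assumes "f \<in> trig I" "g \<in> trig I"
  shows "(\<lambda>x. f x * g x) \<in> trig I"
  using assms(1)
proof induction
  case (cosine t \<phi>)
  show ?case using assms(2)
  proof induction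
    case (cosine s \<theta>)
    have eq: "cos ((\<Sum>i\<in>I. t i * x i) + \<phi>) * cos ((\<Sum>i\<in>I. s i * x i) + \<theta>)
      = 1/2 * cos ((\<Sum>i\<in>I. (t i - s i) * x i) + (\<phi> - \<theta>))
      + 1/2 * cos ((\<Sum>i\<in>I. (t i + s i) * x i) + (\<phi> + \<theta>))" for x
      by (simp add: cos_times_cos algebra_simps sum.distrib sum_subtractf add_divide_distrib)
    show ?case
      unfolding eq by (intro trig.add trig.scale trig.cosine)
  next
    case (scale f c)
    from trig.scale[OF this(2), of c] show ?case by (simp add: ac_simps)
  next
    case (add f g)
    from trig.add[OF this(3,4)] show ?case by (simp add: algebra_simps)
  qed
next
  case (scale f c)
  from trig.scale[OF this(2), of c] show ?case by (simp add: ac_simps)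
next
  case (add f g)
  from trig.add[OF this(3,4)] show ?case by (simp add: algebra_simps)
qed

lemma trig_measurable: "f \<in> trig I \<Longrightarrow> f \<in> borel_measurable (PiM I (\<lambda>_. borel))"
  by (induction rule: trig.induct) auto

lemma trig_bounded: "f \<in> trig I \<Longrightarrow> \<exists>B. \<forall>x. \<bar>f x\<bar> \<le> B"
proof (induction rule: trig.induct)
  case (cosine t \<phi>)
  show ?case by (intro exI[of _ 1]) auto
next
  case (scale f c)
  then obtain B where "\<And>x. \<bar>f x\<bar> \<le> B" by auto
  then show ?case by (intro exI[of _ "\<bar>c\<bar> * B"]) (auto simp: abs_mult mult_left_mono)
next
  case (add f g)
  then obtain B C where "\<And>x. \<bar>f x\<bar> \<le> B" "\<And>x. \<bar>g x\<bar> \<le> C" by auto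
  then show ?case by (intro exI[of _ "B + C"]) (auto intro: abs_triangle_ineq[THEN order_trans] add_mono)
qed

text \<open>Transfers \<open>f\<close> from \<open>product_topology\<close>, whose points are
  extensional functions on \<open>I\<close>, to the topological type of real sequences.\<close>

lemma continuous_map_comp_coords:
  fixes f :: "('i \<Rightarrow> real) \<Rightarrow> real" and p :: "'i \<Rightarrow> (nat \<Rightarrow> real) \<Rightarrow> real"
  assumes f: "continuous_map (product_topology (\<lambda>_. euclideanreal) I) euclideanreal f"
    and p: "\<And>i. i \<in> I \<Longrightarrow> continuous_on UNIV (p i)"
  shows "continuous_on UNIV (\<lambda>y. f (\<lambda>i\<in>I. p i y))"
proof -
  have "continuous_map euclidean (product_topology (\<lambda>_. euclideanreal) I) (\<lambda>y. \<lambda>i\<in>I. p i y)"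
    using p by (intro continuous_map_coordinatewise_then_product) auto
  from continuous_map_compose[OF this f] show ?thesis by (simp add: o_def)
qed

text \<open>Enumerating \<open>I\<close> exhibits \<open>f\<close> as a continuous function of
  finitely many terms of a sequence, and for sequences the Borel sets coincide with the product
  sigma-algebra.\<close>

lemma continuous_map_measurable_PiM:
  fixes f :: "('i \<Rightarrow> real) \<Rightarrow> real"
  assumes f: "continuous_map (product_topology (\<lambda>_. euclideanreal) I) euclideanreal f"
    and fin: "finite I"
  shows "f \<in> borel_measurable (PiM I (\<lambda>_. borel))"
proof -
  obtain e :: "nat \<Rightarrow> 'i" where e: "bij_betw e {0..<card I} I"
    using ex_bij_betw_nat_finite[OF fin] by blast
  define e' where "e' = the_inv_into {0..<card I} e"
  have e': "e' i \<in> {0..<card I}" "e (e' i) = i" if "i \<in> I" for i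
    using bij_betwE[OF bij_betw_the_inv_into[OF e]] that f_the_inv_into_f_bij_betw[OF e] unfolding e'_def by auto
  define F where "F y = f (\<lambda>i\<in>I. y (e' i))" for y :: "nat \<Rightarrow> real"
  have "continuous_on UNIV F"
    unfolding F_def by (intro continuous_map_comp_coords[OF f]) simp
  then have "F \<in> borel_measurable borel" by (rule borel_measurable_continuous_onI)
  then have F[measurable]: "F \<in> borel_measurable (PiM UNIV (\<lambda>_. borel))"
    by (simp add: measurable_cong_sets[OF sets_PiM_equal_borel refl])
  have "(\<lambda>x. \<lambda>j. if j \<in> {0..<card I} then x (e j) else 0) \<in> measurable (PiM I (\<lambda>_. borel)) (PiM UNIV (\<lambda>_. borel :: real measure))"
  proof (rule measurable_PiM_single')
    fix j :: nat
    show "(\<lambda>x. if j \<in> {0..<card I} then x (e j) else 0) \<in> borel_measurable (PiM I (\<lambda>_. borel))"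
      using e by (cases "j \<in> {0..<card I}") (auto simp: bij_betw_def intro!: measurable_component_singleton)
  qed auto
  from measurable_compose[OF this F]
  have "(\<lambda>x. F (\<lambda>j. if j \<in> {0..<card I} then x (e j) else 0)) \<in> borel_measurable (PiM I (\<lambda>_. borel))" .
  moreover have "F (\<lambda>j. if j \<in> {0..<card I} then x (e j) else 0) = f x"
    if "x \<in> space (PiM I (\<lambda>_. borel))" for x
    using that e' unfolding F_def
    by (intro arg_cong[where f=f]) (auto simp: space_PiM PiE_def extensional_def fun_eq_iff)
  ultimately show ?thesis by (simp cong: measurable_cong)
qed

text \<open>
  With \<open>y\<^sub>i = sin (c x\<^sub>i)\<close>, Weierstrass approximation on a cube yields trigonometric polynomials. As sines
  never leave the cube, the approximant is bounded everywhere.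
\<close>

lemma trig_approximation:
  fixes f :: "('i \<Rightarrow> real) \<Rightarrow> real"
  assumes f: "continuous_map (product_topology (\<lambda>_. euclideanreal) I) euclideanreal f"
    and fin: "finite I" and B: "\<And>x. x \<in> I \<rightarrow>\<^sub>E UNIV \<Longrightarrow> \<bar>f x\<bar> \<le> B" and K: "K > 0" and \<epsilon>: "\<epsilon> > 0"
  shows "\<exists>g\<in>trig I. \<forall>x\<in>I \<rightarrow>\<^sub>E UNIV.
    ((\<forall>i\<in>I. \<bar>x i\<bar> \<le> K) \<longrightarrow> \<bar>f x - g x\<bar> \<le> \<epsilon>) \<and> \<bar>g x\<bar> \<le> B + \<epsilon>"
proof -
  obtain e :: "nat \<Rightarrow> 'i" where e: "bij_betw e {0..<card I} I"
    using ex_bij_betw_nat_finite[OF fin] by blast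
  define e' where "e' = the_inv_into {0..<card I} e"
  have e': "e' i < card I" "e (e' i) = i" if "i \<in> I" for i
    using bij_betwE[OF bij_betw_the_inv_into[OF e]] that f_the_inv_into_f_bij_betw[OF e] unfolding e'_def by auto
  \<comment> \<open>Scaling by \<open>c\<close> carries \<open>[-K, K]\<close> onto
    \<open>[-pi/2, pi/2]\<close>, where \<open>arcsin\<close> inverts \<open>sin\<close>. The
    clamping in \<open>p\<close> extends this inverse continuously to all sequences.\<close>
  define c where "c = pi / (2 * K)"
  define p where "p i y = arcsin (max (-1) (min 1 (y (e' i)))) / c" for i and y :: "nat \<Rightarrow> real"
  define F where "F y = f (\<lambda>i\<in>I. p i y)" for y
  define S where "S = (UNIV :: nat set) \<rightarrow>\<^sub>E {-1..1::real}"
  define \<sigma> where "\<sigma> x = (\<lambda>j. if j < card I then sin (c * x (e j)) else 0)" for x :: "'i \<Rightarrow> real"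
  have c: "c > 0" using K by (simp add: c_def)
  have "continuous_on UNIV F"
    unfolding F_def p_def
  proof (intro continuous_map_comp_coords[OF f] continuous_on_divide continuous_on_const)
    fix i
    have "continuous_on UNIV (\<lambda>y. max (-1) (min 1 (y (e' i :: nat) :: real)))"
      by (intro continuous_on_max continuous_on_min continuous_on_const continuous_on_product_coordinates)
    then show "continuous_on UNIV (\<lambda>y. arcsin (max (-1) (min 1 (y (e' i :: nat) :: real))))"
      by (intro continuous_on_arcsin) auto
  qed (use c in auto)
  then have F: "continuous_on S F" by (rule continuous_on_subset) auto
  have S: "compact S"
  proof -
    have "compactin (product_topology (\<lambda>_::nat. euclideanreal) UNIV) S"
      unfolding S_def by (subst compactin_PiE) auto
    then show ?thesis by (simp add: euclidean_product_topology)
  qed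
  \<comment> \<open>Stone-Weierstrass runs on the cube \<open>S\<close>; the algebra consists of the
    functions whose pullback along \<open>\<sigma>\<close> is a trigonometric polynomial.
    Coordinates beyond \<open>card I\<close> pull back to \<open>0\<close> and belong to it too, so
    coordinates separate the points of \<open>S\<close>.\<close>
  define P where "P h \<longleftrightarrow> continuous_on S h \<and> (\<lambda>x. h (\<sigma> x)) \<in> trig I" for h
  have "\<exists>g. P g \<and> (\<forall>y\<in>S. \<bar>F y - g y\<bar> < \<epsilon>)"
  proof (rule Stone_Weierstrass_HOL[OF S])
    show "P (\<lambda>x. c)" for c by (simp add: P_def trig_const)
    show "P h \<Longrightarrow> continuous_on S h" for h by (simp add: P_def)
    show "P f \<and> P g \<Longrightarrow> P (\<lambda>x. f x + g x)" for f g
      by (auto simp: P_def intro!: continuous_on_add trig.add)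
    show "P f \<and> P g \<Longrightarrow> P (\<lambda>x. f x * g x)" for f g
      by (auto simp: P_def intro!: continuous_on_mult trig_mult)
    show "\<exists>f. P f \<and> f x \<noteq> f y" if "x \<in> S \<and> y \<in> S \<and> x \<noteq> y" for x y
    proof -
      from that obtain j where j: "x j \<noteq> y j" by auto
      have "(\<lambda>x. \<sigma> x j) \<in> trig I"
      proof (cases "j < card I")
        case True
        then have "e j \<in> I" using e by (auto dest: bij_betwE)
        with True show ?thesis using trig_sin[OF fin, of "e j" c] by (simp add: \<sigma>_def)
      qed (simp add: \<sigma>_def trig_const)
      then have "P (\<lambda>x. x j)"
        by (auto simp: P_def intro: continuous_on_subset[OF continuous_on_product_coordinates])
      with j show ?thesis by (intro exI[of _ "\<lambda>x. x j"]) simp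
    qed
  qed (use F \<epsilon> in auto)
  then obtain h where h: "P h" "\<And>y. y \<in> S \<Longrightarrow> \<bar>F y - h y\<bar> < \<epsilon>" using \<epsilon> by blast
  have \<sigma>S: "\<sigma> x \<in> S" for x by (auto simp: \<sigma>_def S_def)
  have p\<sigma>: "p i (\<sigma> x) = arcsin (sin (c * x i)) / c" if "i \<in> I" for i x
    using e'[OF that] by (simp add: p_def \<sigma>_def)
  show ?thesis
  proof (intro bexI[of _ "\<lambda>x. h (\<sigma> x)"] ballI conjI impI)
    show "(\<lambda>x. h (\<sigma> x)) \<in> trig I" using h by (simp add: P_def)
    show "\<bar>f x - h (\<sigma> x)\<bar> \<le> \<epsilon>" if x: "x \<in> I \<rightarrow>\<^sub>E UNIV" "\<forall>i\<in>I. \<bar>x i\<bar> \<le> K" for x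
    proof -
      have "p i (\<sigma> x) = x i" if "i \<in> I" for i
      proof -
        have "\<bar>c * x i\<bar> \<le> c * K" using x(2)[rule_format, OF that] c by (simp add: abs_mult)
        also have "c * K = pi / 2" using K by (simp add: c_def)
        finally have "arcsin (sin (c * x i)) = c * x i" by (intro arcsin_sin) auto
        then show ?thesis using p\<sigma>[OF that] c by simp
      qed
      then have "(\<lambda>i\<in>I. p i (\<sigma> x)) = x"
        using x(1) by (auto simp: fun_eq_iff PiE_def extensional_def)
      then show ?thesis using h(2)[OF \<sigma>S[of x]] by (simp add: F_def)
    qed
    show "\<bar>h (\<sigma> x)\<bar> \<le> B + \<epsilon>" for x
      using h(2)[OF \<sigma>S[of x]] B[of "\<lambda>i\<in>I. p i (\<sigma> x)"] by (simp add: F_def)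
  qed
qed

text \<open>Tightness comes from the univariate continuity theorem applied to each coordinate. On a
  large cube \<open>f\<close> is within \<open>\<epsilon>\<close> of a trigonometric polynomial,
  whose integrals converge by hypothesis.\<close>

theorem multivariate_levy_continuity:
  fixes N :: "nat \<Rightarrow> ('i \<Rightarrow> real) measure" and L :: "('i \<Rightarrow> real) measure"
  assumes fin: "finite I"
    and N: "\<And>n. prob_space (N n)" and sN: "\<And>n. sets (N n) = sets (PiM I (\<lambda>_. borel))"
    and L: "prob_space L" and sL: "sets L = sets (PiM I (\<lambda>_. borel))"
    and char: "\<And>t. (\<lambda>n. \<integral>x. iexp (\<Sum>i\<in>I. t i * x i) \<partial>N n) \<longlonglongrightarrow> (\<integral>x. iexp (\<Sum>i\<in>I. t i * x i) \<partial>L)"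
    and f: "continuous_map (product_topology (\<lambda>_. euclideanreal) I) euclideanreal f"
    and bd: "bounded (f ` (I \<rightarrow>\<^sub>E UNIV))"
  shows "(\<lambda>n. \<integral>x. f x \<partial>N n) \<longlonglongrightarrow> (\<integral>x. f x \<partial>L)"
proof -
  interpret N: prob_space "N n" for n by (rule N)
  interpret L: prob_space L by (rule L)
  note sN[measurable_cong] sL[measurable_cong]
  have spN: "space (N n) = I \<rightarrow>\<^sub>E UNIV" for n
    using sets_eq_imp_space_eq[OF sN] by (simp add: space_PiM)
  have spL: "space L = I \<rightarrow>\<^sub>E UNIV"
    using sets_eq_imp_space_eq[OF sL] by (simp add: space_PiM)
  have intN: "integrable (N n) g" if "g \<in> borel_measurable (PiM I (\<lambda>_. borel))" "\<And>x. x \<in> I \<rightarrow>\<^sub>E UNIV \<Longrightarrow> norm (g x) \<le> B"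
    for n B and g :: "_ \<Rightarrow> real"
    using that by (intro N.integrable_const_bound[of _ B] AE_I2)
      (auto simp: spN measurable_cong_sets[OF sN refl])
  have intL: "integrable L g" if "g \<in> borel_measurable (PiM I (\<lambda>_. borel))" "\<And>x. x \<in> I \<rightarrow>\<^sub>E UNIV \<Longrightarrow> norm (g x) \<le> B"
    for B and g :: "_ \<Rightarrow> real"
    using that by (intro L.integrable_const_bound[of _ B] AE_I2)
      (auto simp: spL measurable_cong_sets[OF sL refl])
  have trig_conv: "(\<lambda>n. \<integral>x. g x \<partial>N n) \<longlonglongrightarrow> (\<integral>x. g x \<partial>L)" if "g \<in> trig I" for g
    using that
  proof induction
    case (cosine t \<phi>)
    have eq: "cos (s + \<phi>) = Re (iexp \<phi> * iexp s)" for s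
      by (simp add: exp_add[symmetric] Re_exp distrib_left[symmetric] add.commute)
    have m: "(\<lambda>x. iexp (\<Sum>i\<in>I. t i * x i)) \<in> borel_measurable (PiM I (\<lambda>_. borel))" by simp
    have "(\<integral>x. cos ((\<Sum>i\<in>I. t i * x i) + \<phi>) \<partial>N n) = Re (iexp \<phi> * (\<integral>x. iexp (\<Sum>i\<in>I. t i * x i) \<partial>N n))" for n
      unfolding eq using N.integrable_iexp[of "\<lambda>x. \<Sum>i\<in>I. t i * x i" n]
      by (subst integral_Re) auto
    moreover have "(\<integral>x. cos ((\<Sum>i\<in>I. t i * x i) + \<phi>) \<partial>L) = Re (iexp \<phi> * (\<integral>x. iexp (\<Sum>i\<in>I. t i * x i) \<partial>L))"
      unfolding eq using L.integrable_iexp[of "\<lambda>x. \<Sum>i\<in>I. t i * x i"]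
      by (subst integral_Re) auto
    ultimately show ?case
      by (simp only:) (intro tendsto_intros char)
  next
    case (scale f c)
    then show ?case by (simp add: tendsto_mult_left)
  next
    case (add f g)
    then obtain B C where "\<And>x. \<bar>f x\<bar> \<le> B" "\<And>x. \<bar>g x\<bar> \<le> C" using trig_bounded by metis
    then show ?case
      using add trig_measurable[of f I] trig_measurable[of g I]
      by (subst Bochner_Integration.integral_add[OF intN intN], auto)
         (subst Bochner_Integration.integral_add[OF intL intL], auto intro!: tendsto_add)
  qed
  \<comment> \<open>A continuous ramp from \<open>0\<close> to \<open>1\<close> between
    \<open>K\<close> and \<open>K + 1\<close>. Continuity lets weak convergence of the marginals
    apply, and \<open>T K\<close> is at least \<open>1\<close> outside the cube of half-width
    \<open>K + 1\<close>.\<close>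
  define \<psi> where "\<psi> K y = min 1 (max 0 (\<bar>y\<bar> - K))" for K y :: real
  define T where "T K x = (\<Sum>i\<in>I. \<psi> K (x i))" for K and x :: "'i \<Rightarrow> real"
  have \<psi>m[measurable]: "\<psi> K \<in> borel_measurable borel" for K unfolding \<psi>_def by measurable
  have \<psi>b: "0 \<le> \<psi> K y" "\<psi> K y \<le> 1" for K y by (auto simp: \<psi>_def)
  have Tm[measurable]: "T K \<in> borel_measurable (PiM I (\<lambda>_. borel))" for K unfolding T_def by measurable
  have T0: "T K x \<ge> 0" for K x using \<psi>b by (auto simp: T_def intro: sum_nonneg)
  have Tb: "\<bar>T K x\<bar> \<le> card I" for K x
    using T0[of K x] \<psi>b sum_bounded_above[of I "\<lambda>i. \<psi> K (x i)" 1] by (simp add: T_def)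
  have marg: "(\<lambda>n. \<integral>x. \<psi> K (x i) \<partial>N n) \<longlonglongrightarrow> (\<integral>x. \<psi> K (x i) \<partial>L)" if i: "i \<in> I" for i K
  proof -
    have mi[measurable]: "(\<lambda>x. x i) \<in> measurable (PiM I (\<lambda>_. borel :: real measure)) borel"
      using i by (rule measurable_component_singleton)
    have rN: "real_distribution (distr (N n) borel (\<lambda>x. x i))" for n
      by (intro N.real_distribution_distr) simp
    have rL: "real_distribution (distr L borel (\<lambda>x. x i))"
      by (intro L.real_distribution_distr) simp
    have sing: "(\<Sum>j\<in>I. (if j = i then u else 0) * x j) = u * x i" for u and x :: "'i \<Rightarrow> real"
      using i fin by (simp add: if_distrib[of "\<lambda>y. y * _"] cong: if_cong)
    have "weak_conv_m (\<lambda>n. distr (N n) borel (\<lambda>x. x i)) (distr L borel (\<lambda>x. x i))"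
    proof (rule levy_continuity[OF rN rL])
      fix u
      have "char (distr (N n) borel (\<lambda>x. x i)) u = (\<integral>x. iexp (\<Sum>j\<in>I. (if j = i then u else 0) * x j) \<partial>N n)" for n
        unfolding sing char_def by (subst integral_distr) auto
      moreover have "char (distr L borel (\<lambda>x. x i)) u = (\<integral>x. iexp (\<Sum>j\<in>I. (if j = i then u else 0) * x j) \<partial>L)"
        unfolding sing char_def by (subst integral_distr) auto
      ultimately show "(\<lambda>n. char (distr (N n) borel (\<lambda>x. x i)) u) \<longlonglongrightarrow> char (distr L borel (\<lambda>x. x i)) u"
        using char[of "\<lambda>j. if j = i then u else 0"] by simp
    qed
    moreover have "continuous_on UNIV (\<psi> K)" unfolding \<psi>_def by (intro continuous_intros)
    ultimately have "(\<lambda>n. integral\<^sup>L (distr (N n) borel (\<lambda>x. x i)) (\<psi> K)) \<longlonglongrightarrow> integral\<^sup>L (distr L borel (\<lambda>x. x i)) (\<psi> K)"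
      using \<psi>b by (rule_tac weak_conv_imp_integral_bdd_continuous_conv[OF rN rL])
         (auto simp: continuous_on_eq_continuous_at intro: \<psi>b(2))
    then show ?thesis by (simp add: integral_distr)
  qed
  have T_conv: "(\<lambda>n. \<integral>x. T K x \<partial>N n) \<longlonglongrightarrow> (\<integral>x. T K x \<partial>L)" for K
  proof -
    have "(\<integral>x. T K x \<partial>N n) = (\<Sum>i\<in>I. \<integral>x. \<psi> K (x i) \<partial>N n)" for n
      unfolding T_def using \<psi>b by (intro Bochner_Integration.integral_sum intN[of _ 1]) auto
    moreover have "(\<integral>x. T K x \<partial>L) = (\<Sum>i\<in>I. \<integral>x. \<psi> K (x i) \<partial>L)"
      unfolding T_def using \<psi>b by (intro Bochner_Integration.integral_sum intL[of _ 1]) auto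
    ultimately show ?thesis by (simp only:) (intro tendsto_sum marg)
  qed
  have T_tail: "(\<lambda>k. \<integral>x. T (real k) x \<partial>L) \<longlonglongrightarrow> 0"
  proof -
    have "(\<lambda>k. \<integral>x. T (real k) x \<partial>L) \<longlonglongrightarrow> (\<integral>x. 0 \<partial>L)"
    proof (rule integral_dominated_convergence[where w="\<lambda>_. real (card I)"])
      show "AE x in L. (\<lambda>k. T (real k) x) \<longlonglongrightarrow> 0"
      proof (rule AE_I2)
        fix x :: "'i \<Rightarrow> real"
        have "(\<lambda>k. \<psi> (real k) (x i)) \<longlonglongrightarrow> 0" for i
        proof (rule tendsto_eventually)
          obtain m where "\<bar>x i\<bar> \<le> real m" using real_arch_simple by blast
          then show "\<forall>\<^sub>F k in sequentially. \<psi> (real k) (x i) = 0"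
            by (auto simp: \<psi>_def eventually_sequentially intro!: exI[of _ m])
        qed
        then show "(\<lambda>k. T (real k) x) \<longlonglongrightarrow> 0"
          unfolding T_def by (intro tendsto_null_sum) auto
      qed
    qed (use Tb in auto)
    then show ?thesis by simp
  qed
  obtain B0 where B0: "\<And>x. x \<in> I \<rightarrow>\<^sub>E UNIV \<Longrightarrow> \<bar>f x\<bar> \<le> B0"
    using bd by (auto simp: bounded_iff)
  define B where "B = max B0 1"
  have B: "\<And>x. x \<in> I \<rightarrow>\<^sub>E UNIV \<Longrightarrow> \<bar>f x\<bar> \<le> B" and B1: "B \<ge> 1"
    using B0 by (fastforce simp: B_def)+
  have fm: "f \<in> borel_measurable (PiM I (\<lambda>_. borel))" by (rule continuous_map_measurable_PiM[OF f fin])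
  show ?thesis
  proof (rule LIMSEQ_I)
    fix r :: real assume r: "r > 0"
    \<comment> \<open>The final error is at most \<open>3 * \<epsilon> + 6 * B * \<epsilon>\<close>,
      which is below \<open>20 * B * \<epsilon>\<close> because \<open>B \<ge> 1\<close>.\<close>
    define \<epsilon> where "\<epsilon> = min 1 (r / (20 * B))"
    have e: "\<epsilon> > 0" "\<epsilon> \<le> 1" "20 * B * \<epsilon> \<le> r" using r B1 by (auto simp: \<epsilon>_def min_def field_simps)
    obtain k where k: "(\<integral>x. T (real k) x \<partial>L) < \<epsilon>"
      using order_tendstoD(2)[OF T_tail e(1)] by (auto simp: eventually_sequentially)
    have k1: "0 < real k + 1" by simp
    obtain g where g: "g \<in> trig I" and g': "\<forall>x\<in>I \<rightarrow>\<^sub>E UNIV.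
        ((\<forall>i\<in>I. \<bar>x i\<bar> \<le> real k + 1) \<longrightarrow> \<bar>f x - g x\<bar> \<le> \<epsilon>) \<and> \<bar>g x\<bar> \<le> B + \<epsilon>"
      using trig_approximation[OF f fin _ k1 e(1), of B] B by blast
    have gb: "\<bar>g x\<bar> \<le> B + \<epsilon>" if "x \<in> I \<rightarrow>\<^sub>E UNIV" for x using g' that by simp
    have gm: "g \<in> borel_measurable (PiM I (\<lambda>_. borel))" by (rule trig_measurable[OF g])
    \<comment> \<open>Outside the cube
      \<open>\<bar>f x - g x\<bar> \<le> 2 * B + \<epsilon> \<le> 3 * B\<close>, while
      \<open>T (real k) x \<ge> 1\<close>.\<close>
    have pw: "\<bar>f x - g x\<bar> \<le> \<epsilon> + 3 * B * T (real k) x" if x: "x \<in> I \<rightarrow>\<^sub>E UNIV" for x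
    proof (cases "\<forall>i\<in>I. \<bar>x i\<bar> \<le> real k + 1")
      case True
      then have "\<bar>f x - g x\<bar> \<le> \<epsilon>" using bspec[OF g' x] by auto
      moreover have "3 * B * T (real k) x \<ge> 0" using T0 B1 by simp
      ultimately show ?thesis by linarith
    next
      case False
      then obtain i where i: "i \<in> I" "\<bar>x i\<bar> > real k + 1" by auto
      have "1 = \<psi> (real k) (x i)" using i by (simp add: \<psi>_def)
      also have "\<dots> \<le> T (real k) x"
        unfolding T_def using i fin \<psi>b by (intro member_le_sum) auto
      finally have "3 * B * 1 \<le> 3 * B * T (real k) x" using B1 by (intro mult_left_mono) auto
      then show ?thesis using B[OF x] gb[OF x] e(1) B1 abs_triangle_ineq4[of "f x" "g x"] by linarith
    qed
    have "\<forall>\<^sub>F n in sequentially. (\<integral>x. T (real k) x \<partial>N n) < \<epsilon>"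
      by (rule order_tendstoD(2)[OF T_conv k])
    moreover have "\<forall>\<^sub>F n in sequentially. dist (\<integral>x. g x \<partial>N n) (\<integral>x. g x \<partial>L) < \<epsilon>"
      using tendstoD[OF trig_conv[OF g] e(1)] .
    ultimately have "\<forall>\<^sub>F n in sequentially. norm ((\<integral>x. f x \<partial>N n) - (\<integral>x. f x \<partial>L)) < r"
    proof eventually_elim
      case (elim n)
      have 1: "\<bar>(\<integral>x. f x \<partial>N n) - (\<integral>x. g x \<partial>N n)\<bar> \<le> \<epsilon> + 3 * B * (\<integral>x. T (real k) x \<partial>N n)"
      proof -
        have i: "integrable (N n) f" "integrable (N n) g" "integrable (N n) (T (real k))"
          using intN[OF fm, of B] intN[OF gm, of "B + \<epsilon>"] intN[OF Tm, of "real k" "card I"] B gb Tb by auto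
        have "\<bar>(\<integral>x. f x \<partial>N n) - (\<integral>x. g x \<partial>N n)\<bar> = \<bar>\<integral>x. f x - g x \<partial>N n\<bar>" using i by simp
        also have "\<dots> \<le> (\<integral>x. \<bar>f x - g x\<bar> \<partial>N n)" by (rule integral_abs_bound)
        also have "\<dots> \<le> (\<integral>x. \<epsilon> + 3 * B * T (real k) x \<partial>N n)"
          using i pw by (intro integral_mono) (auto simp: spN)
        also have "\<dots> = \<epsilon> + 3 * B * (\<integral>x. T (real k) x \<partial>N n)" using i by (simp add: N.prob_space)
        finally show ?thesis .
      qed
      have 2: "\<bar>(\<integral>x. f x \<partial>L) - (\<integral>x. g x \<partial>L)\<bar> \<le> \<epsilon> + 3 * B * (\<integral>x. T (real k) x \<partial>L)"
      proof -
        have i: "integrable L f" "integrable L g" "integrable L (T (real k))"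
          using intL[OF fm, of B] intL[OF gm, of "B + \<epsilon>"] intL[OF Tm, of "real k" "card I"] B gb Tb by auto
        have "\<bar>(\<integral>x. f x \<partial>L) - (\<integral>x. g x \<partial>L)\<bar> = \<bar>\<integral>x. f x - g x \<partial>L\<bar>" using i by simp
        also have "\<dots> \<le> (\<integral>x. \<bar>f x - g x\<bar> \<partial>L)" by (rule integral_abs_bound)
        also have "\<dots> \<le> (\<integral>x. \<epsilon> + 3 * B * T (real k) x \<partial>L)"
          using i pw by (intro integral_mono) (auto simp: spL)
        also have "\<dots> = \<epsilon> + 3 * B * (\<integral>x. T (real k) x \<partial>L)" using i by (simp add: L.prob_space)
        finally show ?thesis .
      qed
      have 3: "3 * B * (\<integral>x. T (real k) x \<partial>N n) \<le> 3 * B * \<epsilon>" "3 * B * (\<integral>x. T (real k) x \<partial>L) \<le> 3 * B * \<epsilon>"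
        using elim k B1 by (auto intro!: mult_left_mono)
      have 4: "\<epsilon> \<le> B * \<epsilon>" "B * \<epsilon> > 0" using B1 e by auto
      show ?case using 1 2 3 4 elim(2) e(3) unfolding dist_real_def real_norm_def by linarith
    qed
    then show "\<exists>no. \<forall>n\<ge>no. norm ((\<integral>x. f x \<partial>N n) - (\<integral>x. f x \<partial>L)) < r"
      by (simp add: eventually_sequentially)
  qed
qed

section \<open>Central limit theorem under local dependence\<close>

lemma iexp_lipschitz: "cmod (iexp x - iexp y) \<le> \<bar>x - y\<bar>"
proof -
  have "iexp x - iexp y = iexp y * (iexp (x - y) - 1)"
    by (simp add: algebra_simps flip: exp_add)
  then have "cmod (iexp x - iexp y) = cmod (iexp (x - y) - 1)" by (simp add: norm_mult)
  then show ?thesis using iexp_approx1[of "x - y" 0] by simp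
qed

lemma iexp_taylor1: "cmod (iexp (x + v) - iexp x - \<i> * of_real v * iexp x) \<le> v\<^sup>2 / 2"
proof -
  have "iexp (x + v) - iexp x - \<i> * of_real v * iexp x = iexp x * (iexp v - (1 + \<i> * of_real v))"
    by (simp add: algebra_simps flip: exp_add)
  then have "cmod (iexp (x + v) - iexp x - \<i> * of_real v * iexp x) = cmod (iexp v - (1 + \<i> * of_real v))"
    by (simp add: norm_mult)
  then show ?thesis using iexp_approx1[of v 1] by (simp add: power2_eq_square)
qed

context prob_space begin

lemma bounded_integrable:
  fixes f :: "'a \<Rightarrow> 'b::{banach, second_countable_topology}"
  assumes "f \<in> borel_measurable M" "\<And>\<omega>. \<omega> \<in> space M \<Longrightarrow> norm (f \<omega>) \<le> B"
  shows "integrable M f"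
  using assms by (intro integrable_const_bound[of _ B] AE_I2) auto

lemma norm_expectation_le:
  fixes f :: "'a \<Rightarrow> 'b::{banach, second_countable_topology}"
  assumes "f \<in> borel_measurable M" "\<And>\<omega>. \<omega> \<in> space M \<Longrightarrow> norm (f \<omega>) \<le> B"
  shows "norm (expectation f) \<le> B"
proof -
  have "norm (expectation f) \<le> expectation (\<lambda>\<omega>. norm (f \<omega>))" by (rule integral_norm_bound)
  also have "\<dots> \<le> expectation (\<lambda>\<omega>. B)"
    using assms bounded_integrable[OF assms] by (intro integral_mono) auto
  finally show ?thesis by (simp add: prob_space)
qed

text \<open>Differentiation under the expectation. As \<open>W\<close> is bounded, the second-order
  Taylor estimate controls the difference quotient uniformly on the space.\<close>

lemma expectation_iexp_has_vector_derivative: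
  assumes W[measurable]: "W \<in> borel_measurable M" and K: "\<And>\<omega>. \<omega> \<in> space M \<Longrightarrow> \<bar>W \<omega>\<bar> \<le> K"
  shows "((\<lambda>t. expectation (\<lambda>\<omega>. iexp (t * W \<omega>))) has_vector_derivative
    \<i> * expectation (\<lambda>\<omega>. of_real (W \<omega>) * iexp (t * W \<omega>))) (at t)"
  unfolding has_vector_derivative_def
proof (rule has_derivativeI_sandwich[where e=1 and H="\<lambda>s. \<bar>s - t\<bar> * (K\<^sup>2 / 2)"])
  show "bounded_linear (\<lambda>x. x *\<^sub>R (\<i> * expectation (\<lambda>\<omega>. of_real (W \<omega>) * iexp (t * W \<omega>))))"
    by (rule bounded_linear_scaleR_left)
  have "((\<lambda>s. \<bar>s - t\<bar> * (K\<^sup>2 / 2)) \<longlongrightarrow> \<bar>t - t\<bar> * (K\<^sup>2 / 2)) (at t)"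
    by (intro tendsto_intros)
  then show "((\<lambda>s. \<bar>s - t\<bar> * (K\<^sup>2 / 2)) \<longlongrightarrow> 0) (at t)" by simp
  fix s assume s: "s \<noteq> t"
  have i1: "integrable M (\<lambda>\<omega>. iexp (u * W \<omega>))" for u by (intro integrable_iexp) auto
  have i2: "integrable M (\<lambda>\<omega>. of_real (W \<omega>) * iexp (t * W \<omega>))"
    using K by (intro bounded_integrable[of _ K]) (auto simp: norm_mult)
  have eq: "expectation (\<lambda>\<omega>. iexp (s * W \<omega>)) - expectation (\<lambda>\<omega>. iexp (t * W \<omega>))
      - (s - t) *\<^sub>R (\<i> * expectation (\<lambda>\<omega>. of_real (W \<omega>) * iexp (t * W \<omega>)))
    = expectation (\<lambda>\<omega>. iexp (s * W \<omega>) - iexp (t * W \<omega>) - (s - t) *\<^sub>R (\<i> * (of_real (W \<omega>) * iexp (t * W \<omega>))))"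
    using i1 i2 by (simp del: of_real_mult)
  have "norm (expectation (\<lambda>\<omega>. iexp (s * W \<omega>) - iexp (t * W \<omega>) - (s - t) *\<^sub>R (\<i> * (of_real (W \<omega>) * iexp (t * W \<omega>)))))
      \<le> (s - t)\<^sup>2 * K\<^sup>2 / 2"
  proof (rule norm_expectation_le)
    fix \<omega> assume \<omega>: "\<omega> \<in> space M"
    have "cmod (iexp (s * W \<omega>) - iexp (t * W \<omega>) - (s - t) *\<^sub>R (\<i> * (of_real (W \<omega>) * iexp (t * W \<omega>))))
       \<le> ((s - t) * W \<omega>)\<^sup>2 / 2"
      using iexp_taylor1[of "t * W \<omega>" "(s - t) * W \<omega>"] by (simp add: scaleR_conv_of_real algebra_simps)
    also have "\<dots> \<le> (s - t)\<^sup>2 * K\<^sup>2 / 2"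
      using K[OF \<omega>] power_mono[of "\<bar>W \<omega>\<bar>" K 2] by (simp add: power_mult_distrib mult_left_mono)
    finally show "cmod (iexp (s * W \<omega>) - iexp (t * W \<omega>) - (s - t) *\<^sub>R (\<i> * (of_real (W \<omega>) * iexp (t * W \<omega>))))
      \<le> (s - t)\<^sup>2 * K\<^sup>2 / 2" .
  qed auto
  then show "norm (expectation (\<lambda>\<omega>. iexp (s * W \<omega>)) - expectation (\<lambda>\<omega>. iexp (t * W \<omega>))
      - (s - t) *\<^sub>R (\<i> * expectation (\<lambda>\<omega>. of_real (W \<omega>) * iexp (t * W \<omega>)))) / norm (s - t) \<le> \<bar>s - t\<bar> * (K\<^sup>2 / 2)"
    unfolding eq using s power2_abs[of "s - t", symmetric]
    by (simp add: divide_le_eq power2_eq_square[of "\<bar>s - t\<bar>"] mult_ac del: power2_abs)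
qed simp

text \<open>
  Tikhomirov's form of Stein's method: local dependence makes the characteristic function almost
  solve \<open>\<phi>' = - \<sigma>\<^sup>2 t \<phi>\<close>, the equation of the Gaussian one.
\<close>

theorem local_dependence_clt:
  fixes X :: "'i \<Rightarrow> 'a \<Rightarrow> real" and d :: nat
  assumes fin: "finite I"
    and X[measurable]: "\<And>i. i \<in> I \<Longrightarrow> X i \<in> borel_measurable M"
    and c: "\<And>i \<omega>. i \<in> I \<Longrightarrow> \<omega> \<in> space M \<Longrightarrow> \<bar>X i \<omega>\<bar> \<le> c" and c0: "c \<ge> 0"
    and NI: "\<And>i. i \<in> I \<Longrightarrow> N i \<subseteq> I" and d: "\<And>i. i \<in> I \<Longrightarrow> card (N i) \<le> d"
    and h1: "\<And>i t. i \<in> I \<Longrightarrow> expectation (\<lambda>\<omega>. of_real (X i \<omega>) * iexp (t * (\<Sum>l\<in>I - N i. X l \<omega>))) = 0"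
    and h2: "\<And>i j t. i \<in> I \<Longrightarrow> j \<in> N i \<Longrightarrow>
      expectation (\<lambda>\<omega>. of_real (X i \<omega> * X j \<omega>) * iexp (t * (\<Sum>l\<in>I - (N i \<union> N j). X l \<omega>)))
      = of_real (expectation (\<lambda>\<omega>. X i \<omega> * X j \<omega>)) * expectation (\<lambda>\<omega>. iexp (t * (\<Sum>l\<in>I - (N i \<union> N j). X l \<omega>)))"
    and s: "s = (\<Sum>i\<in>I. \<Sum>j\<in>N i. expectation (\<lambda>\<omega>. X i \<omega> * X j \<omega>))" and s0: "s \<ge> 0"
  shows "cmod (expectation (\<lambda>\<omega>. iexp (\<Sum>i\<in>I. X i \<omega>)) - exp (- of_real (s / 2)))
    \<le> 4 * real (card I) * (real d)\<^sup>2 * c ^ 3"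
proof -
  define S where "S A \<omega> = (\<Sum>l\<in>A. X l \<omega>)" for A \<omega>
  have Sm[measurable]: "S A \<in> borel_measurable M" if "A \<subseteq> I" for A
    unfolding S_def using that by (intro borel_measurable_sum) auto
  have Sb: "\<bar>S A \<omega>\<bar> \<le> real (card A) * c" if "A \<subseteq> I" "\<omega> \<in> space M" for A \<omega>
    unfolding S_def using that c
    by (intro order_trans[OF sum_abs sum_bounded_above]) auto
  have Sd: "S A \<omega> - S B \<omega> = S (A - B) \<omega>" if "B \<subseteq> A" "A \<subseteq> I" for A B \<omega>
    unfolding S_def using that fin by (simp add: sum_diff finite_subset)
  define \<phi> where "\<phi> t = expectation (\<lambda>\<omega>. iexp (t * S I \<omega>))" for t
  define \<phi>' where "\<phi>' t = \<i> * expectation (\<lambda>\<omega>. of_real (S I \<omega>) * iexp (t * S I \<omega>))" for t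
  define R where "R = 4 * real (card I) * (real d)\<^sup>2 * c ^ 3"
  have \<phi>': "(\<phi> has_vector_derivative \<phi>' t) (at t)" for t
    unfolding \<phi>_def \<phi>'_def using Sb[of I]
    by (intro expectation_iexp_has_vector_derivative[of _ "card I * c"]) auto
  have main: "cmod (\<phi>' t + of_real (s * t) * \<phi> t) \<le> R" if t: "0 \<le> t" "t \<le> 1" for t
  proof -
    have t2: "t\<^sup>2 \<le> 1" using t by (simp add: power_le_one)
    have bi: "cmod (expectation (\<lambda>\<omega>. of_real (X i \<omega>) * iexp (t * S I \<omega>))
        - \<i> * of_real t * (\<Sum>j\<in>N i. of_real (expectation (\<lambda>\<omega>. X i \<omega> * X j \<omega>))) * \<phi> t)
      \<le> 4 * (real d)\<^sup>2 * c ^ 3" if i: "i \<in> I" for i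
    proof -
      note Ni = NI[OF i] and Xi[measurable] = X[OF i]
      have finN: "finite (N i)" using Ni fin by (rule finite_subset)
      have dc: "real (card (N j)) * c \<le> real d * c" if "j \<in> I" for j
        using d[OF that] c0 by (intro mult_right_mono) auto
      have sub: "S I \<omega> = S (I - N i) \<omega> + S (N i) \<omega>" for \<omega>
        using Sd[OF Ni, of \<omega>] by simp
      \<comment> \<open>Taylor remainder on splitting off the block \<open>N i\<close>. The
        zeroth-order term has mean zero by \<open>h1\<close>, and the first-order term produces the
        products \<open>T2 j\<close> with \<open>j\<close> in \<open>N i\<close>.\<close>
      define T1 where "T1 \<omega> = of_real (X i \<omega>) * (iexp (t * S I \<omega>) - iexp (t * S (I - N i) \<omega>)
          - \<i> * of_real (t * S (N i) \<omega>) * iexp (t * S (I - N i) \<omega>))" for \<omega>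
      have T1m[measurable]: "T1 \<in> borel_measurable M" unfolding T1_def using Ni by measurable
      have T1b: "cmod (T1 \<omega>) \<le> (real d)\<^sup>2 * c ^ 3 / 2" if \<omega>: "\<omega> \<in> space M" for \<omega>
      proof -
        have "cmod (T1 \<omega>) \<le> c * ((t * S (N i) \<omega>)\<^sup>2 / 2)"
          unfolding T1_def norm_mult using iexp_taylor1[of "t * S (I - N i) \<omega>" "t * S (N i) \<omega>"] c[OF i \<omega>] c0
          by (intro mult_mono) (auto simp: sub algebra_simps)
        also have "\<dots> \<le> c * ((real d * c)\<^sup>2 / 2)"
        proof (intro mult_left_mono divide_right_mono)
          have "\<bar>t * S (N i) \<omega>\<bar> \<le> 1 * (real d * c)"
            unfolding abs_mult using Sb[OF Ni \<omega>] dc[OF i] t by (intro mult_mono) auto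
          then show "(t * S (N i) \<omega>)\<^sup>2 \<le> (real d * c)\<^sup>2"
            using power_mono[of "\<bar>t * S (N i) \<omega>\<bar>" "real d * c" 2] by simp
        qed (use c0 in auto)
        also have "\<dots> = (real d)\<^sup>2 * c ^ 3 / 2"
          by (simp add: power2_eq_square power3_eq_cube)
        finally show ?thesis .
      qed
      have iT1: "integrable M T1" by (rule bounded_integrable[OF T1m T1b])
      define T2 where "T2 j \<omega> = of_real (X i \<omega> * X j \<omega>) * iexp (t * S (I - N i) \<omega>)" for j \<omega>
      have XX: "\<bar>X i \<omega> * X j \<omega>\<bar> \<le> c\<^sup>2" if "j \<in> N i" "\<omega> \<in> space M" for j \<omega>
        unfolding abs_mult power2_eq_square using c[OF i] c[of j] that Ni c0 by (intro mult_mono) auto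
      have T2m: "T2 j \<in> borel_measurable M" if "j \<in> N i" for j
        unfolding T2_def using that Ni X[of j] by (intro borel_measurable_times borel_measurable_of_real) auto
      have iT2: "integrable M (T2 j)" if j: "j \<in> N i" for j
        using XX[OF j] by (intro bounded_integrable[OF T2m[OF j], of "c\<^sup>2"]) (auto simp: T2_def norm_mult abs_mult)
      \<comment> \<open>Dropping \<open>N j\<close> from the exponent as well decouples it from
        \<open>X i * X j\<close>, at cost \<open>c^2 * (d * c)\<close>. Restoring all removed
        summands to reach \<open>\<phi> t\<close> costs twice that, whence the factor
        \<open>3\<close>.\<close>
      have T2b: "cmod (expectation (T2 j) - of_real (expectation (\<lambda>\<omega>. X i \<omega> * X j \<omega>)) * \<phi> t) \<le> 3 * real d * c ^ 3"
        if j: "j \<in> N i" for j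
      proof -
        have jI: "j \<in> I" using j Ni by auto
        note Xj[measurable] = X[OF jI]
        define A where "A = I - (N i \<union> N j)"
        have AI: "A \<subseteq> I" "A \<subseteq> I - N i" by (auto simp: A_def)
        note Sm[OF AI(1), measurable]
        have e1: "cmod (expectation (\<lambda>\<omega>. T2 j \<omega> - of_real (X i \<omega> * X j \<omega>) * iexp (t * S A \<omega>))) \<le> c\<^sup>2 * (real d * c)"
        proof (rule norm_expectation_le)
          fix \<omega> assume \<omega>: "\<omega> \<in> space M"
          have "cmod (T2 j \<omega> - of_real (X i \<omega> * X j \<omega>) * iexp (t * S A \<omega>))
            = \<bar>X i \<omega> * X j \<omega>\<bar> * cmod (iexp (t * S (I - N i) \<omega>) - iexp (t * S A \<omega>))"
            unfolding T2_def by (simp add: abs_mult norm_mult flip: right_diff_distrib)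
          also have "\<dots> \<le> c\<^sup>2 * (real d * c)"
          proof (intro mult_mono XX[OF j \<omega>])
            have "cmod (iexp (t * S (I - N i) \<omega>) - iexp (t * S A \<omega>)) \<le> \<bar>t * (S (I - N i) \<omega> - S A \<omega>)\<bar>"
              using iexp_lipschitz[of "t * S (I - N i) \<omega>" "t * S A \<omega>"] by (simp add: right_diff_distrib)
            also have "\<dots> \<le> 1 * \<bar>S (I - N i) \<omega> - S A \<omega>\<bar>"
              unfolding abs_mult using t by (intro mult_right_mono) auto
            also have "1 * \<bar>S (I - N i) \<omega> - S A \<omega>\<bar> \<le> real (card ((I - N i) - A)) * c"
              using Sd[OF AI(2), of \<omega>] Sb[of "(I - N i) - A", OF _ \<omega>] by auto
            also have "\<dots> \<le> real (card (N j)) * c"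
              using c0 NI[OF jI] fin
              by (intro mult_right_mono of_nat_mono card_mono) (auto simp: A_def intro: finite_subset)
            finally show "cmod (iexp (t * S (I - N i) \<omega>) - iexp (t * S A \<omega>)) \<le> real d * c" using dc[OF jI] by simp
          qed auto
          finally show "cmod (T2 j \<omega> - of_real (X i \<omega> * X j \<omega>) * iexp (t * S A \<omega>)) \<le> c\<^sup>2 * (real d * c)" .
        qed (use T2m[OF j] in auto)
        have e2: "expectation (\<lambda>\<omega>. T2 j \<omega> - of_real (X i \<omega> * X j \<omega>) * iexp (t * S A \<omega>))
          = expectation (T2 j) - of_real (expectation (\<lambda>\<omega>. X i \<omega> * X j \<omega>)) * expectation (\<lambda>\<omega>. iexp (t * S A \<omega>))"
        proof -
          have "integrable M (\<lambda>\<omega>. of_real (X i \<omega> * X j \<omega>) * iexp (t * S A \<omega>))"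
            using XX[OF j] by (intro bounded_integrable[of _ "c\<^sup>2"]) (auto simp: norm_mult abs_mult)
          then show ?thesis
            using iT2[OF j] h2[OF i j, of t, folded S_def] by (simp add: A_def)
        qed
        have e3: "cmod (of_real (expectation (\<lambda>\<omega>. X i \<omega> * X j \<omega>)) * (expectation (\<lambda>\<omega>. iexp (t * S A \<omega>)) - \<phi> t))
           \<le> c\<^sup>2 * (2 * real d * c)"
        proof -
          have "\<bar>expectation (\<lambda>\<omega>. X i \<omega> * X j \<omega>)\<bar> \<le> c\<^sup>2"
            using norm_expectation_le[of "\<lambda>\<omega>. X i \<omega> * X j \<omega>" "c\<^sup>2"] XX[OF j] by simp
          moreover have "cmod (expectation (\<lambda>\<omega>. iexp (t * S A \<omega>) - iexp (t * S I \<omega>))) \<le> 2 * real d * c"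
          proof (rule norm_expectation_le)
            fix \<omega> assume \<omega>: "\<omega> \<in> space M"
            have "cmod (iexp (t * S A \<omega>) - iexp (t * S I \<omega>)) \<le> \<bar>t * (S I \<omega> - S A \<omega>)\<bar>"
              using iexp_lipschitz[of "t * S A \<omega>" "t * S I \<omega>"] by (simp add: right_diff_distrib abs_minus_commute)
            also have "\<dots> \<le> 1 * \<bar>S I \<omega> - S A \<omega>\<bar>"
              unfolding abs_mult using t by (intro mult_right_mono) auto
            also have "1 * \<bar>S I \<omega> - S A \<omega>\<bar> \<le> real (card (I - A)) * c"
              using Sd[OF AI(1), of \<omega>] Sb[of "I - A", OF _ \<omega>] by auto
            also have "\<dots> \<le> real (card (N i) + card (N j)) * c"
            proof (intro mult_right_mono of_nat_mono c0)
              have "I - A = N i \<union> N j" using NI[OF i] NI[OF jI] by (auto simp: A_def)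
              then show "card (I - A) \<le> card (N i) + card (N j)" by (simp add: card_Un_le)
            qed
            also have "\<dots> \<le> 2 * real d * c" using dc[OF i] dc[OF jI] by (simp add: algebra_simps)
            finally show "cmod (iexp (t * S A \<omega>) - iexp (t * S I \<omega>)) \<le> 2 * real d * c" .
          qed auto
          moreover have "expectation (\<lambda>\<omega>. iexp (t * S A \<omega>) - iexp (t * S I \<omega>)) = expectation (\<lambda>\<omega>. iexp (t * S A \<omega>)) - \<phi> t"
            unfolding \<phi>_def by (intro Bochner_Integration.integral_diff integrable_iexp) auto
          ultimately show ?thesis
            unfolding norm_mult using c0 by (intro mult_mono) auto
        qed
        have "cmod (a - m * x) \<le> y + z" if "cmod (a - m * b) \<le> y" "cmod (m * (b - x)) \<le> z"
          for a b m x :: complex and y z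
          using norm_triangle_ineq[of "a - m * b" "m * (b - x)"] that by (simp add: algebra_simps)
        from this[OF e1[unfolded e2] e3]
        show ?thesis by (simp add: power2_eq_square power3_eq_cube mult_ac)
      qed
      have "expectation (\<lambda>\<omega>. of_real (X i \<omega>) * iexp (t * S I \<omega>))
        = expectation (\<lambda>\<omega>. T1 \<omega> + of_real (X i \<omega>) * iexp (t * S (I - N i) \<omega>) + \<i> * of_real t * (\<Sum>j\<in>N i. T2 j \<omega>))"
        by (intro Bochner_Integration.integral_cong refl)
           (simp add: T1_def T2_def S_def sum_distrib_left sum_distrib_right algebra_simps)
      also have "\<dots> = expectation T1 + \<i> * of_real t * (\<Sum>j\<in>N i. expectation (T2 j))"
      proof -
        have "integrable M (\<lambda>\<omega>. of_real (X i \<omega>) * iexp (t * S (I - N i) \<omega>))"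
          using c[OF i] by (intro bounded_integrable[of _ c]) (auto simp: norm_mult)
        then show ?thesis
          using iT1 iT2 h1[OF i, of t, folded S_def] by simp
      qed
      finally have "expectation (\<lambda>\<omega>. of_real (X i \<omega>) * iexp (t * S I \<omega>))
        - \<i> * of_real t * (\<Sum>j\<in>N i. of_real (expectation (\<lambda>\<omega>. X i \<omega> * X j \<omega>))) * \<phi> t
        = expectation T1 + \<i> * of_real t * (\<Sum>j\<in>N i. expectation (T2 j) - of_real (expectation (\<lambda>\<omega>. X i \<omega> * X j \<omega>)) * \<phi> t)"
        by (simp add: sum_subtractf sum_distrib_right right_diff_distrib mult.assoc)
      moreover have "cmod (expectation T1) \<le> (real d)\<^sup>2 * c ^ 3 / 2"
        by (rule norm_expectation_le[OF T1m T1b])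
      moreover have "cmod (\<i> * of_real t * (\<Sum>j\<in>N i. expectation (T2 j) - of_real (expectation (\<lambda>\<omega>. X i \<omega> * X j \<omega>)) * \<phi> t))
         \<le> 1 * (real d * (3 * real d * c ^ 3))"
      proof -
        have "cmod (\<Sum>j\<in>N i. expectation (T2 j) - of_real (expectation (\<lambda>\<omega>. X i \<omega> * X j \<omega>)) * \<phi> t)
          \<le> (\<Sum>j\<in>N i. 3 * real d * c ^ 3)"
          by (rule order_trans[OF norm_sum]) (intro sum_mono T2b)
        also have "\<dots> \<le> real d * (3 * real d * c ^ 3)"
          using d[OF i] c0 by (simp add: mult_right_mono)
        finally show ?thesis
          using t unfolding norm_mult by (intro mult_mono) auto
      qed
      \<comment> \<open>The constant \<open>4\<close> absorbs \<open>1/2\<close> from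
        \<open>T1\<close> and \<open>3\<close> from the terms \<open>T2 j\<close>.\<close>
      moreover have "cmod e \<le> 4 * (real d)\<^sup>2 * c ^ 3"
        if "e = a + b" "cmod a \<le> (real d)\<^sup>2 * c ^ 3 / 2" "cmod b \<le> 1 * (real d * (3 * real d * c ^ 3))" for a b e
      proof -
        have "(real d)\<^sup>2 * c ^ 3 \<ge> 0" using c0 by simp
        then show ?thesis
          using norm_triangle_ineq[of a b] that by (simp add: power2_eq_square)
      qed
      ultimately show ?thesis by blast
    qed
    have "\<phi>' t = \<i> * (\<Sum>i\<in>I. expectation (\<lambda>\<omega>. of_real (X i \<omega>) * iexp (t * S I \<omega>)))"
    proof -
      have "integrable M (\<lambda>\<omega>. of_real (X i \<omega>) * iexp (t * S I \<omega>))" if "i \<in> I" for i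
        using c[OF that] X[OF that] by (intro bounded_integrable[of _ c]) (auto simp: norm_mult)
      then have "expectation (\<lambda>\<omega>. \<Sum>i\<in>I. of_real (X i \<omega>) * iexp (t * S I \<omega>))
        = (\<Sum>i\<in>I. expectation (\<lambda>\<omega>. of_real (X i \<omega>) * iexp (t * S I \<omega>)))"
        by (rule Bochner_Integration.integral_sum)
      moreover have "(\<lambda>\<omega>. of_real (S I \<omega>) * iexp (t * S I \<omega>)) = (\<lambda>\<omega>. \<Sum>i\<in>I. of_real (X i \<omega>) * iexp (t * S I \<omega>))"
        by (subst (1) S_def) (simp add: sum_distrib_right)
      ultimately show ?thesis unfolding \<phi>'_def by simp
    qed
    then have "\<phi>' t + of_real (s * t) * \<phi> t = \<i> * (\<Sum>i\<in>I. expectation (\<lambda>\<omega>. of_real (X i \<omega>) * iexp (t * S I \<omega>))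
        - \<i> * of_real t * (\<Sum>j\<in>N i. of_real (expectation (\<lambda>\<omega>. X i \<omega> * X j \<omega>))) * \<phi> t)"
      by (simp add: s sum_subtractf sum_distrib_left sum_distrib_right sum_negf algebra_simps)
    also have "cmod \<dots> \<le> (\<Sum>i\<in>I. 4 * (real d)\<^sup>2 * c ^ 3)"
      unfolding norm_mult[of \<i>] norm_ii mult_1 by (rule order_trans[OF norm_sum sum_mono[OF bi]])
    also have "\<dots> = R" by (simp add: R_def)
    finally show ?thesis .
  qed
  \<comment> \<open>\<open>exp (s * t^2 / 2)\<close> is the integrating factor of the approximate
    equation. The mean value inequality on \<open>[0, 1]\<close> bounds \<open>g 1 - g 0\<close> by
    \<open>exp (s / 2) * R\<close>, and dividing by the factor at \<open>1\<close> removes the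
    exponential.\<close>
  define g where "g t = of_real (exp (s * t\<^sup>2 / 2)) * \<phi> t" for t
  have dg: "(g has_vector_derivative of_real (exp (s * t\<^sup>2 / 2)) * (\<phi>' t + of_real (s * t) * \<phi> t)) (at t)" for t
  proof -
    have "((\<lambda>t. exp (s * t\<^sup>2 / 2)) has_real_derivative exp (s * t\<^sup>2 / 2) * (s * t)) (at t)"
      by (auto intro!: derivative_eq_intros)
    from has_vector_derivative_mult[OF has_vector_derivative_of_real[OF this] \<phi>']
    show ?thesis unfolding g_def by (simp add: algebra_simps)
  qed
  have "\<exists>x\<in>{0<..<1}. norm (g 1 - g 0) \<le> norm ((1 - 0) *\<^sub>R (of_real (exp (s * x\<^sup>2 / 2)) * (\<phi>' x + of_real (s * x) * \<phi> x)))"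
    using dg unfolding has_vector_derivative_def
    by (intro mvt_general) (auto intro!: continuous_at_imp_continuous_on has_derivative_continuous)
  then obtain x where x: "0 < x" "x < 1"
    "norm (g 1 - g 0) \<le> exp (s * x\<^sup>2 / 2) * cmod (\<phi>' x + of_real (s * x) * \<phi> x)"
    by (auto simp: norm_mult)
  have R0: "R \<ge> 0" using c0 by (simp add: R_def)
  have "exp (s * x\<^sup>2 / 2) * cmod (\<phi>' x + of_real (s * x) * \<phi> x) \<le> exp (s / 2) * R"
    using x main[of x] s0 by (intro mult_mono) (auto simp: mult_left_le power_le_one)
  with x have le: "cmod (g 1 - g 0) \<le> exp (s / 2) * R" by linarith
  have "cmod (\<phi> 1 - exp (- of_real (s / 2))) = exp (- (s / 2)) * cmod (g 1 - g 0)"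
  proof -
    have "\<phi> 1 - exp (- of_real (s / 2)) = of_real (exp (- (s / 2))) * (g 1 - g 0)"
      by (simp add: g_def \<phi>_def prob_space exp_minus right_diff_distrib flip: exp_of_real)
    then show ?thesis by (simp add: norm_mult)
  qed
  also have "\<dots> \<le> exp (- (s / 2)) * (exp (s / 2) * R)" by (intro mult_left_mono le) auto
  also have "\<dots> = R" by (simp add: exp_minus)
  finally show ?thesis by (simp add: \<phi>_def S_def R_def)
qed

end

section \<open>Points sampled along a permutation\<close>

lemma prob_space_unif: "prob_space unif"
  unfolding unif_def by (rule prob_space_uniform_measure) auto

lemma sets_unif[measurable_cong, simp]: "sets unif = sets borel"
  by (simp add: unif_def)

lemma space_unif[simp]: "space unif = UNIV"
  by (simp add: unif_def)

definition pt :: "(nat \<Rightarrow> nat) \<Rightarrow> (nat \<Rightarrow> real) \<Rightarrow> nat \<Rightarrow> real \<times> real" where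
  "pt \<sigma> U i = (U i, U (\<sigma> i))"

locale sample =
  fixes n :: nat and \<sigma> :: "nat \<Rightarrow> nat"
  assumes n1: "n \<ge> 1" and perm: "\<sigma> permutes {1..n}"
begin

definition P :: "(nat \<Rightarrow> real) measure" where "P = PiM {1..n} (\<lambda>_. unif)"

text \<open>Labels are the vertices and points the edges of the cycle graph of
  \<open>\<sigma>\<close>, with a loop at each fixed point. A point reads only the labels on its
  edge, so points with disjoint edges are independent.\<close>

definition edge :: "nat \<Rightarrow> nat set" where "edge i = {i, \<sigma> i}"

definition law :: "nat \<Rightarrow> (real \<times> real) measure" where
  "law i = distr P borel (\<lambda>U. pt \<sigma> U i)"

sublocale P: prob_space P
  unfolding P_def by (intro prob_space_PiM prob_space_unif)

lemma sets_P[measurable_cong, simp]: "sets P = sets (PiM {1..n} (\<lambda>_. borel))"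
  unfolding P_def using sets_PiM_cong[of "{1..n}" "{1..n}" "\<lambda>_. unif" "\<lambda>_. borel :: real measure"] by simp

lemma space_P: "space P = {1..n} \<rightarrow>\<^sub>E UNIV"
  by (simp add: P_def space_PiM)

lemma edge_sub: "i \<in> {1..n} \<Longrightarrow> edge i \<subseteq> {1..n}"
  using permutes_in_image[OF perm, of i] by (auto simp: edge_def)

lemma measurable_pt: "edge i \<subseteq> A \<Longrightarrow> (\<lambda>U. pt \<sigma> U i) \<in> measurable (PiM A (\<lambda>_. borel)) borel"
  unfolding pt_def edge_def
  by (intro borel_measurable_Pair measurable_component_singleton) auto

lemma measurable_pt_P[measurable]: "i \<in> {1..n} \<Longrightarrow> (\<lambda>U. pt \<sigma> U i) \<in> measurable P borel"
  using measurable_pt[OF edge_sub] by (simp cong: measurable_cong_sets)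

lemma pt_restrict: "edge i \<subseteq> A \<Longrightarrow> pt \<sigma> (restrict U A) i = pt \<sigma> U i"
  by (auto simp: pt_def edge_def)

lemma prob_space_law: "i \<in> {1..n} \<Longrightarrow> prob_space (law i)"
  unfolding law_def by (intro P.prob_space_distr) measurable

lemma sets_law[measurable_cong, simp]: "sets (law i) = sets borel"
  by (simp add: law_def)

lemma indep_coords: "P.indep_vars (\<lambda>_. borel) (\<lambda>i U. U i) {1..n}"
proof (subst P.indep_vars_iff_distr_eq_PiM')
  have "distr P (PiM {1..n} (\<lambda>_. borel)) (\<lambda>x. \<lambda>i\<in>{1..n}. x i) = distr P P (\<lambda>x. x)"
    by (intro distr_cong) (auto simp: space_P PiE_def extensional_def fun_eq_iff)
  also have "\<dots> = P" by simp
  also have "\<dots> = PiM {1..n} (\<lambda>i. distr P borel (\<lambda>x. x i))"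
  proof (unfold P_def, intro PiM_cong refl)
    fix i :: nat assume "i \<in> {1..n}"
    then have "distr (PiM {1..n} (\<lambda>_. unif)) unif (\<lambda>x. x i) = unif"
      by (rule distr_PiM_component[OF prob_space_unif])
    then show "unif = distr (PiM {1..n} (\<lambda>_. unif)) borel (\<lambda>x. x i)"
      by (metis distr_cong sets_unif)
  qed
  finally show "distr P (PiM {1..n} (\<lambda>_. borel)) (\<lambda>x. \<lambda>i\<in>{1..n}. x i) = PiM {1..n} (\<lambda>i. distr P borel (\<lambda>x. x i))" .
qed (use n1 in auto)

text \<open>Independence of coordinates over disjoint index sets. \<open>rf\<close> and
  \<open>rg\<close> express that \<open>f\<close> and \<open>g\<close>, though defined on whole
  label vectors, read only the coordinates in \<open>A\<close> and \<open>B\<close>.\<close>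

lemma expectation_mult_disjoint:
  fixes f g :: "(nat \<Rightarrow> real) \<Rightarrow> 'b::{real_normed_field, banach, second_countable_topology}"
  assumes AB: "A \<inter> B = {}" "A \<subseteq> {1..n}" "B \<subseteq> {1..n}"
    and f[measurable]: "f \<in> borel_measurable (PiM A (\<lambda>_. borel))"
    and g[measurable]: "g \<in> borel_measurable (PiM B (\<lambda>_. borel))"
    and bf: "\<And>U. norm (f U) \<le> F" and bg: "\<And>U. norm (g U) \<le> G"
    and rf: "\<And>U. f (restrict U A) = f U" and rg: "\<And>U. g (restrict U B) = g U"
  shows "P.expectation (\<lambda>U. f U * g U) = P.expectation f * P.expectation g"
proof -
  have "P.indep_var (PiM A (\<lambda>_. borel)) (\<lambda>U. restrict U A) (PiM B (\<lambda>_. borel)) (\<lambda>U. restrict U B)"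
    by (rule P.indep_var_restrict[OF indep_coords AB])
  from P.indep_var_compose[OF this f g]
  have ind: "P.indep_var borel f borel g" by (simp add: o_def rf rg)
  have "integrable P f" using P.indep_var_rv1[OF ind] bf by (rule P.bounded_integrable)
  moreover have "integrable P g" using P.indep_var_rv2[OF ind] bg by (rule P.bounded_integrable)
  ultimately show ?thesis by (rule P.indep_var_lebesgue_integral[OF ind])
qed

text \<open>Independence over the disjoint label blocks \<open>Q\<close> and
  \<open>edge (k j)\<close>, pushed through \<open>pt\<close>. It permits integrating out the points
  of the slots in \<open>J\<close> while everything read from \<open>Q\<close> stays fixed.\<close>

lemma distr_pts:
  assumes J: "finite J" "\<And>j. j \<in> J \<Longrightarrow> k j \<in> {1..n}" and Q: "Q \<subseteq> {1..n}"
    and dO: "\<And>j. j \<in> J \<Longrightarrow> edge (k j) \<inter> Q = {}"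
    and dJ: "\<And>j j'. j \<in> J \<Longrightarrow> j' \<in> J \<Longrightarrow> j \<noteq> j' \<Longrightarrow> edge (k j) \<inter> edge (k j') = {}"
  shows "distr P (PiM J (\<lambda>_. borel) \<Otimes>\<^sub>M PiM Q (\<lambda>_. borel)) (\<lambda>U. (\<lambda>j\<in>J. pt \<sigma> U (k j), restrict U Q))
    = PiM J (\<lambda>j. law (k j)) \<Otimes>\<^sub>M distr P (PiM Q (\<lambda>_. borel)) (\<lambda>U. restrict U Q)"
proof -
  define A where "A = (\<Union>j\<in>J. edge (k j))"
  have A: "A \<inter> Q = {}" "A \<subseteq> {1..n}" using dO edge_sub J(2) by (auto simp: A_def)
  have sub: "edge (k j) \<subseteq> A" if "j \<in> J" for j using that by (auto simp: A_def)
  have "P.indep_var (PiM A (\<lambda>_. borel)) (\<lambda>U. restrict U A) (PiM Q (\<lambda>_. borel)) (\<lambda>U. restrict U Q)"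
    by (rule P.indep_var_restrict[OF indep_coords A(1) A(2) Q])
  then have ind: "distr P (PiM A (\<lambda>_. borel)) (\<lambda>U. restrict U A) \<Otimes>\<^sub>M distr P (PiM Q (\<lambda>_. borel)) (\<lambda>U. restrict U Q)
      = distr P (PiM A (\<lambda>_. borel) \<Otimes>\<^sub>M PiM Q (\<lambda>_. borel)) (\<lambda>U. (restrict U A, restrict U Q))"
    and rA[measurable]: "(\<lambda>U. restrict U A) \<in> measurable P (PiM A (\<lambda>_. borel))"
    and rQ[measurable]: "(\<lambda>U. restrict U Q) \<in> measurable P (PiM Q (\<lambda>_. borel))"
    by (auto simp: P.indep_var_distribution_eq)
  have T[measurable]: "(\<lambda>x. \<lambda>j\<in>J. pt \<sigma> x (k j)) \<in> measurable (PiM A (\<lambda>_. borel)) (PiM J (\<lambda>_. borel))"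
    by (intro measurable_restrict measurable_pt sub)
  have T_eq: "(\<lambda>j\<in>J. pt \<sigma> (restrict U A) (k j)) = (\<lambda>j\<in>J. pt \<sigma> U (k j))" for U
    by (auto simp: fun_eq_iff restrict_def pt_restrict[OF sub, unfolded restrict_def])
  have "distr P (PiM J (\<lambda>_. borel)) (\<lambda>U. \<lambda>j\<in>J. pt \<sigma> U (k j)) \<Otimes>\<^sub>M distr P (PiM Q (\<lambda>_. borel)) (\<lambda>U. restrict U Q)
    = distr (distr P (PiM A (\<lambda>_. borel)) (\<lambda>U. restrict U A)) (PiM J (\<lambda>_. borel)) (\<lambda>x. \<lambda>j\<in>J. pt \<sigma> x (k j))
      \<Otimes>\<^sub>M distr (distr P (PiM Q (\<lambda>_. borel)) (\<lambda>U. restrict U Q)) (PiM Q (\<lambda>_. borel)) (\<lambda>x. x)"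
    by (simp add: distr_distr o_def T_eq)
  also have "\<dots> = distr (distr P (PiM A (\<lambda>_. borel)) (\<lambda>U. restrict U A) \<Otimes>\<^sub>M distr P (PiM Q (\<lambda>_. borel)) (\<lambda>U. restrict U Q))
     (PiM J (\<lambda>_. borel) \<Otimes>\<^sub>M PiM Q (\<lambda>_. borel)) (\<lambda>(x, y). (\<lambda>j\<in>J. pt \<sigma> x (k j), y))"
  proof (rule pair_measure_distr)
    interpret prob_space "distr (distr P (PiM Q (\<lambda>_. borel)) (\<lambda>U. restrict U Q)) (PiM Q (\<lambda>_. borel)) (\<lambda>x. x)"
      by (intro prob_space.prob_space_distr P.prob_space_distr) auto
    show "sigma_finite_measure (distr (distr P (PiM Q (\<lambda>_. borel)) (\<lambda>U. restrict U Q)) (PiM Q (\<lambda>_. borel)) (\<lambda>x. x))"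
      by unfold_locales
  qed auto
  also have "\<dots> = distr P (PiM J (\<lambda>_. borel) \<Otimes>\<^sub>M PiM Q (\<lambda>_. borel)) (\<lambda>U. (\<lambda>j\<in>J. pt \<sigma> U (k j), restrict U Q))"
    unfolding ind by (subst distr_distr) (auto simp: o_def T_eq)
  finally have "distr P (PiM J (\<lambda>_. borel) \<Otimes>\<^sub>M PiM Q (\<lambda>_. borel)) (\<lambda>U. (\<lambda>j\<in>J. pt \<sigma> U (k j), restrict U Q))
    = distr P (PiM J (\<lambda>_. borel)) (\<lambda>U. \<lambda>j\<in>J. pt \<sigma> U (k j)) \<Otimes>\<^sub>M distr P (PiM Q (\<lambda>_. borel)) (\<lambda>U. restrict U Q)" ..
  also have "distr P (PiM J (\<lambda>_. borel)) (\<lambda>U. \<lambda>j\<in>J. pt \<sigma> U (k j)) = PiM J (\<lambda>j. law (k j))"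
  proof (cases "J = {}")
    case True
    \<comment> \<open>With no slots both sides are the point mass at the empty function.\<close>
    have eq: "distr P (PiM {} (\<lambda>_. borel)) (\<lambda>U. \<lambda>j\<in>{}. pt \<sigma> U (k j)) = PiM {} (\<lambda>j. law (k j))"
    proof (rule measure_eqI)
      show "sets (distr P (PiM {} (\<lambda>_. borel)) (\<lambda>U. \<lambda>j\<in>{}. pt \<sigma> U (k j))) = sets (PiM {} (\<lambda>j. law (k j)))"
        by (simp add: sets_PiM_empty)
      fix X assume "X \<in> sets (distr P (PiM {} (\<lambda>_. borel)) (\<lambda>U. \<lambda>j\<in>{}. pt \<sigma> U (k j)))"
      then have "X = {} \<or> X = {\<lambda>_. undefined}" by (auto simp: sets_PiM_empty)
      then show "emeasure (distr P (PiM {} (\<lambda>_. borel)) (\<lambda>U. \<lambda>j\<in>{}. pt \<sigma> U (k j))) X = emeasure (PiM {} (\<lambda>j. law (k j))) X"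
        by (auto simp: emeasure_distr sets_PiM_empty restrict_def vimage_def P.emeasure_space_1)
    qed
    then show ?thesis using True by simp
  next
    case False
    have "P.indep_vars (\<lambda>j. PiM (edge (k j)) (\<lambda>_. borel)) (\<lambda>j U. restrict (\<lambda>i. U i) (edge (k j))) J"
      using edge_sub J(2) dJ by (intro P.indep_vars_restrict[OF indep_coords]) (auto simp: disjoint_family_on_def)
    then have "P.indep_vars (\<lambda>_. borel) (\<lambda>j U. pt \<sigma> (restrict U (edge (k j))) (k j)) J"
      by (rule P.indep_vars_compose2) (intro measurable_pt order_refl)
    then have "P.indep_vars (\<lambda>_. borel) (\<lambda>j U. pt \<sigma> U (k j)) J"
      by (simp add: pt_restrict)
    then show ?thesis
      using J(2) by (subst (asm) P.indep_vars_iff_distr_eq_PiM'[OF False]) (auto simp: law_def)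
  qed
  finally show ?thesis .
qed

end

section \<open>Integrals over independent slots\<close>

lemma measurable_slot:
  assumes "a \<in> R"
  shows "(\<lambda>(z, x). x(a := z)) \<in> measurable (borel \<Otimes>\<^sub>M PiM (R - {a}) (\<lambda>_. borel)) (PiM R (\<lambda>_. borel))"
  using assms unfolding case_prod_beta
  by (intro measurable_fun_upd[where J="R - {a}"]) auto

text \<open>A bounded kernel whose slots are filled by independent points with laws that may vary
  from slot to slot. Integrating out all slots but one gives the first Hoeffding projection. The
  locale serves both for the laws of the sampled points and for a common law.\<close>

locale slots =
  fixes R :: "'s set" and Q :: "'s \<Rightarrow> (real \<times> real) measure" and f :: "('s \<Rightarrow> real \<times> real) \<Rightarrow> real" and H :: real
  assumes Q: "\<And>j. j \<in> R \<Longrightarrow> prob_space (Q j)" and sets_Q: "\<And>j. j \<in> R \<Longrightarrow> sets (Q j) = sets borel"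
    and f[measurable]: "f \<in> borel_measurable (PiM R (\<lambda>_. borel))" and fH: "\<And>x. \<bar>f x\<bar> \<le> H"
begin

lemma prob_space_rest: "prob_space (PiM (R - A) Q)"
  using Q by (intro prob_space_PiM) auto

lemma sets_rest: "sets (PiM (R - A) Q) = sets (PiM (R - A) (\<lambda>_. borel))"
  using sets_Q by (intro sets_PiM_cong) auto

lemma slot_measurable:
  assumes a: "a \<in> R"
  shows "(\<lambda>z. \<integral>x. f (x(a := z)) \<partial>PiM (R - {a}) Q) \<in> borel_measurable borel"
proof -
  interpret prob_space "PiM (R - {a}) Q" by (rule prob_space_rest)
  have "(\<lambda>(z, x). f (x(a := z))) \<in> borel_measurable (borel \<Otimes>\<^sub>M PiM (R - {a}) (\<lambda>_. borel))"
    using measurable_compose[OF measurable_slot[OF a] f] by (simp add: case_prod_beta)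
  then have "(\<lambda>(z, x). f (x(a := z))) \<in> borel_measurable (borel \<Otimes>\<^sub>M PiM (R - {a}) Q)"
    by (simp cong: measurable_cong_sets sets_pair_measure_cong add: sets_rest)
  then show ?thesis by (rule borel_measurable_lebesgue_integral)
qed

lemma slot_section_measurable:
  assumes a: "a \<in> R"
  shows "(\<lambda>x. f (x(a := z))) \<in> borel_measurable (PiM (R - {a}) Q)"
proof -
  have "(\<lambda>x. f (x(a := z))) \<in> borel_measurable (PiM (R - {a}) (\<lambda>_. borel))"
    using measurable_compose[OF measurable_Pair1'[of z borel] measurable_compose[OF measurable_slot[OF a] f]]
    by simp
  then show ?thesis by (simp cong: measurable_cong_sets add: sets_rest)
qed

lemma slot_bound:
  assumes a: "a \<in> R"
  shows "\<bar>\<integral>x. f (x(a := z)) \<partial>PiM (R - {a}) Q\<bar> \<le> H"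
proof -
  interpret prob_space "PiM (R - {a}) Q" by (rule prob_space_rest)
  show ?thesis
    using norm_expectation_le[OF slot_section_measurable[OF a], of z H] fH by simp
qed

lemma slot_integral:
  assumes a: "a \<in> R"
  shows "(\<integral>z. (\<integral>x. f (x(a := z)) \<partial>PiM (R - {a}) Q) \<partial>Q a) = (\<integral>x. f x \<partial>PiM R Q)"
proof -
  interpret X: prob_space "PiM (R - {a}) Q" by (rule prob_space_rest)
  interpret Z: prob_space "Q a" by (rule Q[OF a])
  interpret pair_prob_space "Q a" "PiM (R - {a}) Q" ..
  have R: "insert a (R - {a}) = R" using a by auto
  have fR: "f \<in> borel_measurable (PiM R Q)"
    using sets_rest[of "{}"] by (simp cong: measurable_cong_sets)
  have "sets (Q a \<Otimes>\<^sub>M PiM (R - {a}) Q) = sets (borel \<Otimes>\<^sub>M PiM (R - {a}) (\<lambda>_. borel))"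
    by (intro sets_pair_measure_cong sets_rest sets_Q a)
  then have m: "(\<lambda>(z, x). x(a := z)) \<in> measurable (Q a \<Otimes>\<^sub>M PiM (R - {a}) Q) (PiM R Q)"
    using measurable_slot[OF a] sets_rest[of "{}"] by (simp cong: measurable_cong_sets)
  have fm: "(\<lambda>(z, x). f (x(a := z))) \<in> borel_measurable (Q a \<Otimes>\<^sub>M PiM (R - {a}) Q)"
    using measurable_compose[OF m fR] by (simp add: case_prod_beta)
  have "integrable (Q a \<Otimes>\<^sub>M PiM (R - {a}) Q) (\<lambda>(z, x). f (x(a := z)))"
    using fH by (intro bounded_integrable[OF fm, of H]) auto
  from integral_fst[OF this]
  have "(\<integral>z. (\<integral>x. f (x(a := z)) \<partial>PiM (R - {a}) Q) \<partial>Q a) = (\<integral>p. f ((\<lambda>(z, x). x(a := z)) p) \<partial>(Q a \<Otimes>\<^sub>M PiM (R - {a}) Q))"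
    by (simp add: split_def)
  also have "\<dots> = (\<integral>x. f x \<partial>distr (Q a \<Otimes>\<^sub>M PiM (R - {a}) Q) (PiM R Q) (\<lambda>(z, x). x(a := z)))"
    by (rule integral_distr[OF m fR, symmetric])
  also have "distr (Q a \<Otimes>\<^sub>M PiM (R - {a}) Q) (PiM R Q) (\<lambda>(z, x). x(a := z)) = PiM R Q"
    using distr_pair_PiM_eq_PiM[of "R - {a}" Q a] Q a unfolding R by auto
  finally show ?thesis .
qed

end

text \<open>Replace the laws \<open>Q (k j)\<close> of the slots by \<open>\<mu>\<close>, one slot at a time.\<close>

lemma hybrid_integral:
  fixes f :: "('s \<Rightarrow> real \<times> real) \<Rightarrow> real" and Q :: "'i \<Rightarrow> (real \<times> real) measure"
  assumes J: "finite J" and I: "finite I"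
    and Q: "\<And>i. i \<in> I \<Longrightarrow> prob_space (Q i)" "\<And>i. i \<in> I \<Longrightarrow> sets (Q i) = sets borel"
    and \<mu>: "prob_space \<mu>" "sets \<mu> = sets borel"
    and \<delta>: "\<And>G C. G \<in> borel_measurable borel \<Longrightarrow> (\<And>z. \<bar>G z\<bar> \<le> C) \<Longrightarrow>
        \<bar>(\<Sum>i\<in>I. \<integral>z. G z \<partial>Q i) - real (card I) * (\<integral>z. G z \<partial>\<mu>)\<bar> \<le> \<delta> * C"
    and f: "f \<in> borel_measurable (PiM J (\<lambda>_. borel))" and fH: "\<And>x. \<bar>f x\<bar> \<le> H"
  shows "\<bar>(\<Sum>k\<in>J \<rightarrow>\<^sub>E I. \<integral>x. f x \<partial>PiM J (\<lambda>j. Q (k j))) - real (card I) ^ card J * (\<integral>x. f x \<partial>PiM J (\<lambda>_. \<mu>))\<bar>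
    \<le> real (card J) * real (card I) ^ (card J - 1) * \<delta> * H"
  using J f fH
proof (induction J arbitrary: f rule: finite_induct)
  case empty
  have eq: "PiM {} (\<lambda>j. Q (k j)) = PiM {} (\<lambda>_. \<mu>)" for k :: "'s \<Rightarrow> 'i" by (rule PiM_cong) auto
  show ?case by (simp add: eq)
next
  case (insert a J)
  let ?R = "insert a J"
  have R: "?R - {a} = J" using insert by auto
  define N where "N = real (card I)"
  define F where "F k z = (\<integral>x. f (x(a := z)) \<partial>PiM J (\<lambda>j. Q (k j)))" for k z
  define G where "G z = (\<integral>x. f (x(a := z)) \<partial>PiM J (\<lambda>_. \<mu>))" for z
  have slQ: "slots ?R (\<lambda>j. Q (k j)) f H" if "k \<in> ?R \<rightarrow> I" for k
    using that Q insert.prems unfolding slots_def by (auto dest: Pi_mem)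
  have sl\<mu>: "slots ?R (\<lambda>_. \<mu>) f H"
    using \<mu> insert.prems by (auto simp: slots_def)
  have Gm: "G \<in> borel_measurable borel" and Gb: "\<And>z. \<bar>G z\<bar> \<le> H"
    using slots.slot_measurable[OF sl\<mu>, of a] slots.slot_bound[OF sl\<mu>, of a] by (simp_all add: R G_def[abs_def])
  have GI: "(\<integral>z. G z \<partial>\<mu>) = (\<integral>x. f x \<partial>PiM ?R (\<lambda>_. \<mu>))"
    using slots.slot_integral[OF sl\<mu>, of a] by (simp add: R G_def)
  \<comment> \<open>\<open>F k\<close> integrates over the slots in \<open>J\<close> only, so
    changing \<open>k\<close> at \<open>a\<close> is invisible. This supplies the index function on
    all of \<open>?R\<close> that \<open>slots\<close> expects.\<close>
  have Fu: "F (k(a := i)) = F k" for k i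
    unfolding F_def using insert.hyps by (intro ext arg_cong2[where f=lebesgue_integral] PiM_cong) auto
  have Fm: "F k \<in> borel_measurable borel" "\<bar>F k z\<bar> \<le> H" if k: "k \<in> J \<rightarrow>\<^sub>E I" and i: "i \<in> I" for k i z
  proof -
    have "k(a := i) \<in> ?R \<rightarrow> I" using k i by auto
    from slots.slot_measurable[OF slQ[OF this], of a] slots.slot_bound[OF slQ[OF this], of a z]
    show "F k \<in> borel_measurable borel" "\<bar>F k z\<bar> \<le> H"
      unfolding Fu[of k i, symmetric] by (simp_all add: R F_def[abs_def])
  qed
  have FI: "(\<integral>x. f x \<partial>PiM ?R (\<lambda>j. Q ((k(a := i)) j))) = (\<integral>z. F k z \<partial>Q i)" if k: "k \<in> J \<rightarrow>\<^sub>E I" and i: "i \<in> I" for k i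
  proof -
    have "k(a := i) \<in> ?R \<rightarrow> I" using k i by auto
    from slots.slot_integral[OF slQ[OF this], of a] show ?thesis
      unfolding Fu[of k i, symmetric] by (simp add: R F_def)
  qed
  have "(\<Sum>k\<in>?R \<rightarrow>\<^sub>E I. \<integral>x. f x \<partial>PiM ?R (\<lambda>j. Q (k j)))
     = (\<Sum>(i, k)\<in>I \<times> (J \<rightarrow>\<^sub>E I). \<integral>x. f x \<partial>PiM ?R (\<lambda>j. Q ((k(a := i)) j)))"
    unfolding PiE_insert_eq using insert.hyps
    by (subst sum.reindex) (auto simp: case_prod_beta intro: inj_combinator)
  also have "\<dots> = (\<Sum>i\<in>I. \<Sum>k\<in>J \<rightarrow>\<^sub>E I. \<integral>z. F k z \<partial>Q i)"
    by (subst sum.cartesian_product[symmetric]) (intro sum.cong refl FI)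
  also have "\<dots> = (\<Sum>i\<in>I. \<integral>z. (\<Sum>k\<in>J \<rightarrow>\<^sub>E I. F k z) \<partial>Q i)"
  proof (intro sum.cong refl)
    fix i assume i: "i \<in> I"
    interpret prob_space "Q i" by (rule Q(1)[OF i])
    show "(\<Sum>k\<in>J \<rightarrow>\<^sub>E I. \<integral>z. F k z \<partial>Q i) = (\<integral>z. (\<Sum>k\<in>J \<rightarrow>\<^sub>E I. F k z) \<partial>Q i)"
      using Fm i by (intro Bochner_Integration.integral_sum[symmetric] bounded_integrable[of _ H])
        (auto simp: measurable_cong_sets[OF Q(2)[OF i] refl])
  qed
  finally have S: "(\<Sum>k\<in>?R \<rightarrow>\<^sub>E I. \<integral>x. f x \<partial>PiM ?R (\<lambda>j. Q (k j))) = (\<Sum>i\<in>I. \<integral>z. (\<Sum>k\<in>J \<rightarrow>\<^sub>E I. F k z) \<partial>Q i)" .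
  define B where "B = real (card J) * N ^ (card J - 1) * \<delta> * H"
  have FG: "\<bar>(\<Sum>k\<in>J \<rightarrow>\<^sub>E I. F k z) - N ^ card J * G z\<bar> \<le> B" for z
    unfolding F_def G_def B_def N_def
  proof (rule insert.IH)
    have "(\<lambda>x. f (x(a := z))) \<in> borel_measurable (PiM (?R - {a}) (\<lambda>_. \<mu>))"
      by (rule slots.slot_section_measurable[OF sl\<mu>]) simp
    then show "(\<lambda>x. f (x(a := z))) \<in> borel_measurable (PiM J (\<lambda>_. borel))"
      unfolding R using slots.sets_rest[OF sl\<mu>, of "{a}"] R by (simp cong: measurable_cong_sets)
    show "\<bar>f (x(a := z))\<bar> \<le> H" for x by (rule insert.prems)
  qed
  have "\<bar>(\<Sum>i\<in>I. \<integral>z. (\<Sum>k\<in>J \<rightarrow>\<^sub>E I. F k z) \<partial>Q i) - N ^ card J * (\<Sum>i\<in>I. \<integral>z. G z \<partial>Q i)\<bar> \<le> N * B"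
  proof -
    have "\<bar>(\<integral>z. (\<Sum>k\<in>J \<rightarrow>\<^sub>E I. F k z) \<partial>Q i) - N ^ card J * (\<integral>z. G z \<partial>Q i)\<bar> \<le> B" if i: "i \<in> I" for i
    proof -
      interpret prob_space "Q i" by (rule Q(1)[OF i])
      have Gm': "G \<in> borel_measurable (Q i)" using Gm by (simp add: measurable_cong_sets[OF Q(2)[OF i] refl])
      have Fm': "F k \<in> borel_measurable (Q i)" if "k \<in> J \<rightarrow>\<^sub>E I" for k
        using Fm(1)[OF that i] by (simp add: measurable_cong_sets[OF Q(2)[OF i] refl])
      have "integrable (Q i) G" using Gb by (intro bounded_integrable[OF Gm']) auto
      moreover have "integrable (Q i) (\<lambda>z. \<Sum>k\<in>J \<rightarrow>\<^sub>E I. F k z)"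
        using Fm i by (intro Bochner_Integration.integrable_sum bounded_integrable[OF Fm', of _ H]) auto
      ultimately have "(\<integral>z. (\<Sum>k\<in>J \<rightarrow>\<^sub>E I. F k z) \<partial>Q i) - N ^ card J * (\<integral>z. G z \<partial>Q i)
        = (\<integral>z. (\<Sum>k\<in>J \<rightarrow>\<^sub>E I. F k z) - N ^ card J * G z \<partial>Q i)" by simp
      also have "\<bar>\<dots>\<bar> \<le> B"
        using norm_expectation_le[of "\<lambda>z. (\<Sum>k\<in>J \<rightarrow>\<^sub>E I. F k z) - N ^ card J * G z" B] FG Fm' Gm' by auto
      finally show ?thesis .
    qed
    then have "(\<Sum>i\<in>I. \<bar>(\<integral>z. (\<Sum>k\<in>J \<rightarrow>\<^sub>E I. F k z) \<partial>Q i) - N ^ card J * (\<integral>z. G z \<partial>Q i)\<bar>) \<le> N * B"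
      unfolding N_def by (intro sum_bounded_above) auto
    then show ?thesis
      unfolding sum_distrib_left sum_subtractf[symmetric] by (rule order_trans[OF sum_abs])
  qed
  moreover have "\<bar>N ^ card J * (\<Sum>i\<in>I. \<integral>z. G z \<partial>Q i) - N ^ card J * (N * (\<integral>z. G z \<partial>\<mu>))\<bar> \<le> N ^ card J * (\<delta> * H)"
    unfolding right_diff_distrib[symmetric] abs_mult using \<delta>[OF Gm Gb]
    by (auto simp: N_def intro!: mult_left_mono)
  \<comment> \<open>The exponent \<open>card J - 1\<close> is truncated at \<open>0\<close>; for
    empty \<open>J\<close> the factor \<open>card J\<close> makes both sides zero.\<close>
  moreover have "N * B = real (card J) * N ^ card J * \<delta> * H"
    unfolding B_def by (cases "card J") auto
  ultimately show ?case
    unfolding S GI[symmetric] using insert.hyps N_def by (simp add: algebra_simps)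
qed

text \<open>Choose \<open>m\<close> freely off \<open>p\<close> and \<open>p'\<close>, then
  \<open>m p'\<close> among the at most \<open>d\<close> relatives of \<open>m q'\<close>, then
  \<open>m p\<close> among those of \<open>m q\<close>. The order matters: \<open>q\<close> may
  equal \<open>p'\<close>, whereas \<open>q'\<close> differs from both \<open>p\<close> and
  \<open>p'\<close> and so is assigned from the start.\<close>

lemma card_two_edges:
  fixes r :: "'b \<Rightarrow> 'b \<Rightarrow> bool"
  assumes V: "finite V" and B: "finite B" and sym: "\<And>x y. r x y \<Longrightarrow> r y x"
    and d: "\<And>x. x \<in> B \<Longrightarrow> card {y \<in> B. r x y} \<le> d"
    and p: "p \<in> V" "q \<in> V" "p' \<in> V" "q' \<in> V" "p \<noteq> q" "p' \<noteq> q'" "p \<noteq> p'" "p \<noteq> q'"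
  shows "card {m \<in> V \<rightarrow>\<^sub>E B. r (m p) (m q) \<and> r (m p') (m q')} \<le> d * d * card B ^ (card V - 2)"
proof -
  define W where "W = V - {p, p'}"
  define nb where "nb x = {y \<in> B. r x y}" for x
  define S where "S = (SIGMA w : W \<rightarrow>\<^sub>E B. SIGMA y : nb (w q'). nb ((w(p' := y)) q))"
  have W: "finite W" "card W = card V - 2" using V p by (auto simp: W_def card_Diff_subset)
  have fnb: "finite (nb x)" for x using B by (simp add: nb_def)
  have fS: "finite S"
    unfolding S_def using W B fnb by (intro finite_SigmaI finite_PiE) auto
  have "{m \<in> V \<rightarrow>\<^sub>E B. r (m p) (m q) \<and> r (m p') (m q')} \<subseteq> (\<lambda>(w, y, x). (w(p' := y))(p := x)) ` S"
  proof
    fix m assume m: "m \<in> {m \<in> V \<rightarrow>\<^sub>E B. r (m p) (m q) \<and> r (m p') (m q')}"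
    define w where "w = restrict m W"
    have "m = (w(p' := m p'))(p := m p)"
      using m p by (auto simp: w_def W_def fun_eq_iff PiE_def extensional_def)
    moreover have "(w, m p', m p) \<in> S"
      using m p sym by (auto simp: S_def nb_def w_def W_def PiE_def)
    ultimately show "m \<in> (\<lambda>(w, y, x). (w(p' := y))(p := x)) ` S"
      by (intro image_eqI[of _ _ "(w, m p', m p)"]) auto
  qed
  then have "card {m \<in> V \<rightarrow>\<^sub>E B. r (m p) (m q) \<and> r (m p') (m q')} \<le> card S"
    using fS by (meson card_image_le card_mono finite_imageI order_trans)
  also have "card S = (\<Sum>w\<in>W \<rightarrow>\<^sub>E B. \<Sum>y\<in>nb (w q'). card (nb ((w(p' := y)) q)))"
    unfolding S_def using W B fnb by (simp add: finite_PiE card_SigmaI finite_SigmaI)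
  also have "\<dots> \<le> (\<Sum>w\<in>W \<rightarrow>\<^sub>E B. d * d)"
  proof (intro sum_mono)
    fix w assume w: "w \<in> W \<rightarrow>\<^sub>E B"
    have q': "w q' \<in> B" using w p by (intro PiE_mem[OF w]) (auto simp: W_def)
    have "card (nb ((w(p' := y)) q)) \<le> d" if "y \<in> nb (w q')" for y
    proof -
      have "(w(p' := y)) q \<in> B"
        using that p by (auto simp: nb_def W_def intro: PiE_mem[OF w])
      then show ?thesis using d by (simp add: nb_def)
    qed
    then have "(\<Sum>y\<in>nb (w q'). card (nb ((w(p' := y)) q))) \<le> card (nb (w q')) * d"
      using sum_bounded_above[of "nb (w q')" "\<lambda>y. card (nb ((w(p' := y)) q))" d] by simp
    also have "\<dots> \<le> d * d" using d[OF q'] by (intro mult_right_mono) (auto simp: nb_def)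
    finally show "(\<Sum>y\<in>nb (w q'). card (nb ((w(p' := y)) q))) \<le> d * d" .
  qed
  also have "\<dots> = d * d * card B ^ (card V - 2)"
    using W B by (simp add: card_PiE)
  finally show ?thesis .
qed

section \<open>Second moment of the Hoeffding remainder\<close>

locale ustat = sample +
  fixes R :: "'s set" and h :: "('s \<Rightarrow> real \<times> real) \<Rightarrow> real" and H :: real
  assumes finR: "finite R" and Rne: "R \<noteq> {}"
    and h[measurable]: "h \<in> borel_measurable (PiM R (\<lambda>_. borel))" and hH: "\<And>x. \<bar>h x\<bar> \<le> H"
begin

text \<open>
  Hoeffding decomposition of \<open>h\<close> with respect to the law that the tuple \<open>k\<close> of points would have
  if it were independent.
\<close>

definition tuple_mean :: "('s \<Rightarrow> nat) \<Rightarrow> real" where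
  "tuple_mean k = (\<integral>x. h x \<partial>PiM R (\<lambda>j. law (k j)))"

definition tuple_proj :: "('s \<Rightarrow> nat) \<Rightarrow> 's \<Rightarrow> real \<times> real \<Rightarrow> real" where
  "tuple_proj k a z = (\<integral>x. h (x(a := z)) \<partial>PiM (R - {a}) (\<lambda>j. law (k j)))"

definition tuple_rest :: "('s \<Rightarrow> nat) \<Rightarrow> ('s \<Rightarrow> real \<times> real) \<Rightarrow> real" where
  "tuple_rest k x = h x - tuple_mean k - (\<Sum>a\<in>R. tuple_proj k a (x a) - tuple_mean k)"

definition tuple_points :: "('s \<Rightarrow> nat) \<Rightarrow> (nat \<Rightarrow> real) \<Rightarrow> 's \<Rightarrow> real \<times> real" where
  "tuple_points k U = (\<lambda>j\<in>R. pt \<sigma> U (k j))"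

text \<open>\<open>h\<close> and the mean contribute \<open>H\<close> each, every centred projection
  \<open>2 * H\<close>.\<close>

definition rest_bound :: real where "rest_bound = (2 + 2 * real (card R)) * H"

lemma H0: "H \<ge> 0" using hH[of undefined] by linarith

lemma slots_law: "k \<in> R \<rightarrow> {1..n} \<Longrightarrow> slots R (\<lambda>j. law (k j)) h H"
  unfolding slots_def using prob_space_law hH h by (auto dest: Pi_mem)

lemma tuple_proj_measurable: "k \<in> R \<rightarrow> {1..n} \<Longrightarrow> a \<in> R \<Longrightarrow> tuple_proj k a \<in> borel_measurable borel"
  unfolding tuple_proj_def[abs_def] by (rule slots.slot_measurable[OF slots_law])

lemma tuple_proj_bound: "k \<in> R \<rightarrow> {1..n} \<Longrightarrow> a \<in> R \<Longrightarrow> \<bar>tuple_proj k a z\<bar> \<le> H"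
  unfolding tuple_proj_def by (rule slots.slot_bound[OF slots_law])

lemma tuple_proj_integral: "k \<in> R \<rightarrow> {1..n} \<Longrightarrow> a \<in> R \<Longrightarrow> (\<integral>z. tuple_proj k a z \<partial>law (k a)) = tuple_mean k"
  unfolding tuple_proj_def tuple_mean_def by (rule slots.slot_integral[OF slots_law])

lemma tuple_mean_bound: "k \<in> R \<rightarrow> {1..n} \<Longrightarrow> \<bar>tuple_mean k\<bar> \<le> H"
proof -
  assume k: "k \<in> R \<rightarrow> {1..n}"
  obtain a where a: "a \<in> R" using Rne by auto
  then interpret prob_space "law (k a)" using k by (intro prob_space_law) auto
  show ?thesis
    unfolding tuple_proj_integral[OF k a, symmetric]
    using norm_expectation_le[of "tuple_proj k a" H] tuple_proj_measurable[OF k a] tuple_proj_bound[OF k a] by simp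
qed

lemma tuple_rest_measurable: "k \<in> R \<rightarrow> {1..n} \<Longrightarrow> tuple_rest k \<in> borel_measurable (PiM R (\<lambda>_. borel))"
proof -
  assume k: "k \<in> R \<rightarrow> {1..n}"
  have "(\<lambda>x. tuple_proj k a (x a)) \<in> borel_measurable (PiM R (\<lambda>_. borel))" if "a \<in> R" for a
    by (rule measurable_compose[OF measurable_component_singleton[OF that] tuple_proj_measurable[OF k that]])
  then show ?thesis unfolding tuple_rest_def[abs_def] by measurable
qed

lemma rest_bound0: "rest_bound \<ge> 0" using H0 by (simp add: rest_bound_def)

lemma tuple_rest_bound:
  assumes k: "k \<in> R \<rightarrow> {1..n}"
  shows "\<bar>tuple_rest k x\<bar> \<le> rest_bound"
proof -
  have "\<bar>\<Sum>a\<in>R. tuple_proj k a (x a) - tuple_mean k\<bar> \<le> (\<Sum>a\<in>R. 2 * H)"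
  proof (rule order_trans[OF sum_abs sum_mono])
    fix a assume "a \<in> R"
    from tuple_proj_bound[OF k this, of "x a"] tuple_mean_bound[OF k]
    show "\<bar>tuple_proj k a (x a) - tuple_mean k\<bar> \<le> 2 * H" by linarith
  qed
  then have "\<bar>\<Sum>a\<in>R. tuple_proj k a (x a) - tuple_mean k\<bar> \<le> real (card R) * (2 * H)" by simp
  then show ?thesis
    unfolding tuple_rest_def rest_bound_def using hH[of x] tuple_mean_bound[OF k] by (simp add: algebra_simps)
qed

text \<open>With slot \<open>a\<close> frozen at \<open>z\<close>, the kernel integrates to its
  projection at \<open>a\<close>, which the decomposition subtracts. The centred projections at the
  other slots integrate to zero. So the remainder is centred given any single slot.\<close>

lemma tuple_rest_center:
  assumes k: "k \<in> R \<rightarrow> {1..n}" and a: "a \<in> R"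
  shows "(\<integral>x. tuple_rest k (x(a := z)) \<partial>PiM (R - {a}) (\<lambda>j. law (k j))) = 0"
proof -
  interpret S: slots R "\<lambda>j. law (k j)" h H by (rule slots_law[OF k])
  interpret X: prob_space "PiM (R - {a}) (\<lambda>j. law (k j))" by (rule S.prob_space_rest)
  have ih: "integrable (PiM (R - {a}) (\<lambda>j. law (k j))) (\<lambda>x. h (x(a := z)))"
    by (rule X.bounded_integrable[OF S.slot_section_measurable[OF a], of _ H]) (use hH in auto)
  have ib: "integrable (PiM (R - {a}) (\<lambda>j. law (k j))) (\<lambda>x. tuple_proj k b (x b) - tuple_mean k)"
    and eb: "(\<integral>x. tuple_proj k b (x b) - tuple_mean k \<partial>PiM (R - {a}) (\<lambda>j. law (k j))) = 0" if b: "b \<in> R - {a}" for b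
  proof -
    have bR: "b \<in> R" using b by auto
    have m: "(\<lambda>x. x b) \<in> measurable (PiM (R - {a}) (\<lambda>j. law (k j))) (law (k b))"
      using b by (rule measurable_component_singleton)
    have hm: "tuple_proj k b \<in> borel_measurable (law (k b))"
      using tuple_proj_measurable[OF k bR] by simp
    have i: "integrable (PiM (R - {a}) (\<lambda>j. law (k j))) (\<lambda>x. tuple_proj k b (x b))"
      by (rule X.bounded_integrable[OF measurable_compose[OF m hm], of H]) (use tuple_proj_bound[OF k bR] in auto)
    then show "integrable (PiM (R - {a}) (\<lambda>j. law (k j))) (\<lambda>x. tuple_proj k b (x b) - tuple_mean k)" by simp
    have "(\<integral>x. tuple_proj k b (x b) \<partial>PiM (R - {a}) (\<lambda>j. law (k j)))
      = (\<integral>y. tuple_proj k b y \<partial>distr (PiM (R - {a}) (\<lambda>j. law (k j))) (law (k b)) (\<lambda>x. x b))"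
      by (rule integral_distr[OF m hm, symmetric])
    also have "distr (PiM (R - {a}) (\<lambda>j. law (k j))) (law (k b)) (\<lambda>x. x b) = law (k b)"
      using b S.Q by (intro distr_PiM_component) auto
    also have "(\<integral>y. tuple_proj k b y \<partial>law (k b)) = tuple_mean k" by (rule tuple_proj_integral[OF k bR])
    finally show "(\<integral>x. tuple_proj k b (x b) - tuple_mean k \<partial>PiM (R - {a}) (\<lambda>j. law (k j))) = 0"
      using i by (simp add: X.prob_space)
  qed
  have "tuple_rest k (x(a := z)) = h (x(a := z)) - tuple_proj k a z - (\<Sum>b\<in>R - {a}. tuple_proj k b (x b) - tuple_mean k)" for x
  proof -
    have "(\<Sum>b\<in>R - {a}. tuple_proj k b ((x(a := z)) b) - tuple_mean k) = (\<Sum>b\<in>R - {a}. tuple_proj k b (x b) - tuple_mean k)"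
      by (intro sum.cong) auto
    then show ?thesis
      unfolding tuple_rest_def sum.remove[OF finR a] by simp
  qed
  then have "(\<integral>x. tuple_rest k (x(a := z)) \<partial>PiM (R - {a}) (\<lambda>j. law (k j)))
    = (\<integral>x. h (x(a := z)) - tuple_proj k a z - (\<Sum>b\<in>R - {a}. tuple_proj k b (x b) - tuple_mean k) \<partial>PiM (R - {a}) (\<lambda>j. law (k j)))"
    by simp
  also have "\<dots> = (\<integral>x. h (x(a := z)) \<partial>PiM (R - {a}) (\<lambda>j. law (k j))) - tuple_proj k a z
      - (\<Sum>b\<in>R - {a}. \<integral>x. tuple_proj k b (x b) - tuple_mean k \<partial>PiM (R - {a}) (\<lambda>j. law (k j)))"
  proof -
    have isum: "integrable (PiM (R - {a}) (\<lambda>j. law (k j))) (\<lambda>x. \<Sum>b\<in>R - {a}. tuple_proj k b (x b) - tuple_mean k)"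
      by (intro Bochner_Integration.integrable_sum ib)
    show ?thesis
      using ih isum ib by (simp add: X.prob_space Bochner_Integration.integral_sum)
  qed
  also have "\<dots> = 0" using eb by (simp add: tuple_proj_def)
  finally show ?thesis .
qed

lemma tuple_points_measurable: "(\<Union>j\<in>R. edge (k j)) \<subseteq> A \<Longrightarrow> tuple_points k \<in> measurable (PiM A (\<lambda>_. borel)) (PiM R (\<lambda>_. borel))"
  unfolding tuple_points_def[abs_def] by (intro measurable_restrict measurable_pt) auto

text \<open>Given the labels in \<open>Q\<close>, the points of the slots other than
  \<open>a\<close> are still independent with their own laws. Integrating them out first by Fubini
  leaves the integral of \<open>tuple_rest_center\<close>, with \<open>z\<close> the point in slot
  \<open>a\<close>.\<close>

lemma tuple_rest_orthogonal:
  assumes k: "k \<in> R \<rightarrow> {1..n}" and a: "a \<in> R" and Q: "edge (k a) \<subseteq> Q" "Q \<subseteq> {1..n}"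
    and dQ: "\<And>j. j \<in> R - {a} \<Longrightarrow> edge (k j) \<inter> Q = {}"
    and dJ: "\<And>j j'. j \<in> R - {a} \<Longrightarrow> j' \<in> R - {a} \<Longrightarrow> j \<noteq> j' \<Longrightarrow> edge (k j) \<inter> edge (k j') = {}"
    and g[measurable]: "g \<in> borel_measurable (PiM Q (\<lambda>_. borel))" and gB: "\<And>U. \<bar>g U\<bar> \<le> G"
    and gr: "\<And>U. g (restrict U Q) = g U"
  shows "P.expectation (\<lambda>U. tuple_rest k (tuple_points k U) * g U) = 0"
proof -
  define J where "J = R - {a}"
  define M1 where "M1 = PiM J (\<lambda>j. law (k j))"
  define M2 where "M2 = distr P (PiM Q (\<lambda>_. borel)) (\<lambda>U. restrict U Q)"
  define F where "F x y = tuple_rest k (x(a := pt \<sigma> y (k a))) * g y" for x y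
  interpret S: slots R "\<lambda>j. law (k j)" h H by (rule slots_law[OF k])
  interpret X: prob_space M1 unfolding M1_def J_def by (rule S.prob_space_rest)
  have rQ[measurable]: "(\<lambda>U. restrict U Q) \<in> measurable P (PiM Q (\<lambda>_. borel))"
    using Q(2) measurable_restrict_subset[of Q "{1..n}" "\<lambda>_. borel"] by (simp cong: measurable_cong_sets)
  interpret Y: prob_space M2 unfolding M2_def by (rule P.prob_space_distr) fact
  interpret XY: pair_prob_space M1 M2 ..
  have finJ: "finite J" using finR by (simp add: J_def)
  have sets12: "sets (M1 \<Otimes>\<^sub>M M2) = sets (PiM J (\<lambda>_. borel) \<Otimes>\<^sub>M PiM Q (\<lambda>_. borel))"
    unfolding M1_def M2_def J_def by (intro sets_pair_measure_cong S.sets_rest) simp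
  have ptm: "(\<lambda>y. pt \<sigma> y (k a)) \<in> measurable (PiM Q (\<lambda>_. borel)) borel" by (rule measurable_pt[OF Q(1)])
  have Fm': "(\<lambda>(x, y). F x y) \<in> borel_measurable (PiM J (\<lambda>_. borel) \<Otimes>\<^sub>M PiM Q (\<lambda>_. borel))"
  proof -
    have "(\<lambda>p. (fst p)(a := pt \<sigma> (snd p) (k a))) \<in> measurable (PiM J (\<lambda>_. borel) \<Otimes>\<^sub>M PiM Q (\<lambda>_. borel)) (PiM R (\<lambda>_. borel))"
      using a by (intro measurable_fun_upd[where J=J] measurable_fst measurable_compose[OF measurable_snd ptm]) (auto simp: J_def)
    from measurable_compose[OF this tuple_rest_measurable[OF k]] show ?thesis
      unfolding F_def by (simp add: split_def)
  qed
  then have Fm: "(\<lambda>(x, y). F x y) \<in> borel_measurable (M1 \<Otimes>\<^sub>M M2)"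
    by (simp add: measurable_cong_sets[OF sets12 refl])
  have FB: "\<bar>F x y\<bar> \<le> rest_bound * G" for x y
    unfolding F_def abs_mult using tuple_rest_bound[OF k] gB rest_bound0 by (intro mult_mono) auto
  have kJ: "\<And>j. j \<in> J \<Longrightarrow> k j \<in> {1..n}" using k by (auto simp: J_def)
  have dp: "distr P (PiM J (\<lambda>_. borel) \<Otimes>\<^sub>M PiM Q (\<lambda>_. borel)) (\<lambda>U. (\<lambda>j\<in>J. pt \<sigma> U (k j), restrict U Q)) = M1 \<Otimes>\<^sub>M M2"
    unfolding M1_def M2_def using dQ dJ by (intro distr_pts finJ kJ Q(2)) (auto simp: J_def)
  have pm: "(\<lambda>U. (\<lambda>j\<in>J. pt \<sigma> U (k j), restrict U Q)) \<in> measurable P (PiM J (\<lambda>_. borel) \<Otimes>\<^sub>M PiM Q (\<lambda>_. borel))"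
    using kJ by (intro measurable_Pair measurable_restrict rQ measurable_pt_P) auto
  have tuple_points_eq: "(\<lambda>j\<in>J. pt \<sigma> U (k j))(a := pt \<sigma> (restrict U Q) (k a)) = tuple_points k U" for U
    using a Q(1) by (auto simp: tuple_points_def J_def fun_eq_iff pt_restrict)
  have "P.expectation (\<lambda>U. tuple_rest k (tuple_points k U) * g U)
      = P.expectation (\<lambda>U. (\<lambda>(x, y). F x y) (\<lambda>j\<in>J. pt \<sigma> U (k j), restrict U Q))"
    by (simp add: F_def tuple_points_eq gr)
  also have "\<dots> = integral\<^sup>L (M1 \<Otimes>\<^sub>M M2) (\<lambda>(x, y). F x y)"
    unfolding dp[symmetric] by (rule integral_distr[OF pm Fm', symmetric])
  also have "\<dots> = (\<integral>y. (\<integral>x. F x y \<partial>M1) \<partial>M2)"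
    by (rule XY.integral_snd[symmetric]) (use FB in \<open>auto intro!: XY.bounded_integrable[OF Fm, of "rest_bound * G"]\<close>)
  also have "\<dots> = 0"
    using tuple_rest_center[OF k a] by (simp add: F_def M1_def J_def)
  finally show ?thesis .
qed

section \<open>Pairs of tuples and their shared labels\<close>

definition adj :: "nat \<Rightarrow> nat \<Rightarrow> bool" where "adj i j \<longleftrightarrow> edge i \<inter> edge j \<noteq> {}"

definition pos :: "('s + 's) set" where "pos = R <+> R"

text \<open>Merges the two tuples into one index function on all positions, so that adjacencies
  inside a tuple and across the two are counted alike.\<close>

definition comb :: "('s \<Rightarrow> nat) \<times> ('s \<Rightarrow> nat) \<Rightarrow> 's + 's \<Rightarrow> nat" where
  "comb p = (\<lambda>v\<in>pos. case v of Inl j \<Rightarrow> fst p j | Inr j \<Rightarrow> snd p j)"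

text \<open>
  Among the \<open>2r\<close> points of a pair of tuples, adjacency means sharing a label. Without two edges, one of the
  tuples has at most one point adjacent to another one, so its Hoeffding remainder integrates to zero.
\<close>

definition two_edges :: "('s + 's \<Rightarrow> nat) \<Rightarrow> bool" where
  "two_edges m \<longleftrightarrow> (\<exists>p\<in>pos. \<exists>q\<in>pos. \<exists>p'\<in>pos. \<exists>q'\<in>pos.
     p \<noteq> q \<and> p' \<noteq> q' \<and> p \<noteq> p' \<and> p \<noteq> q' \<and> adj (m p) (m q) \<and> adj (m p') (m q'))"

lemma adj_sym: "adj i j \<Longrightarrow> adj j i"
  by (auto simp: adj_def)

text \<open>By injectivity of \<open>\<sigma>\<close>, an edge meets only itself and its successor
  and predecessor along the cycle.\<close>

lemma card_adj: "i \<in> {1..n} \<Longrightarrow> card {j \<in> {1..n}. adj i j} \<le> 3"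
proof -
  have "{j \<in> {1..n}. adj i j} \<subseteq> {i, \<sigma> i, inv \<sigma> i}"
    using permutes_inverses[OF perm] permutes_inj[OF perm]
    by (auto simp: adj_def edge_def inj_eq)
  then have "card {j \<in> {1..n}. adj i j} \<le> card {i, \<sigma> i, inv \<sigma> i}" by (intro card_mono) auto
  also have "\<dots> \<le> 3" by (auto simp: card_insert_if)
  finally show ?thesis .
qed

text \<open>Union bound over at most \<open>(2 * card R) ^ 4\<close> choices of four positions. Each
  leaves \<open>2 * card R - 2\<close> indices free and at most \<open>3 * 3\<close> values for the
  other two.\<close>

lemma card_two_edges_le:
  "card {m \<in> pos \<rightarrow>\<^sub>E {1..n}. two_edges m} \<le> (2 * card R) ^ 4 * 9 * n ^ (2 * card R - 2)"
proof -
  have finpos: "finite pos" and cpos: "card pos = 2 * card R"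
    using finR by (simp_all add: pos_def card_Plus)
  define Idx where "Idx = {(p, q, p', q'). p \<in> pos \<and> q \<in> pos \<and> p' \<in> pos \<and> q' \<in> pos \<and>
    p \<noteq> q \<and> p' \<noteq> q' \<and> p \<noteq> p' \<and> p \<noteq> q'}"
  have sub: "Idx \<subseteq> pos \<times> pos \<times> pos \<times> pos" by (auto simp: Idx_def)
  have finI: "finite Idx" by (rule finite_subset[OF sub]) (use finpos in auto)
  define S where "S = (\<lambda>(p, q, p', q'). {m \<in> pos \<rightarrow>\<^sub>E {1..n}. adj (m p) (m q) \<and> adj (m p') (m q')})"
  have Sc: "card (S t) \<le> 9 * n ^ (2 * card R - 2)" if "t \<in> Idx" for t
  proof -
    obtain p q p' q' where t: "t = (p, q, p', q')" by (cases t) auto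
    from that show ?thesis
      using card_two_edges[of pos "{1..n}" adj 3 p q p' q'] finpos adj_sym card_adj
      unfolding t S_def Idx_def cpos by simp
  qed
  have "{m \<in> pos \<rightarrow>\<^sub>E {1..n}. two_edges m} \<subseteq> (\<Union>t\<in>Idx. S t)"
    unfolding two_edges_def S_def Idx_def by fastforce
  then have "card {m \<in> pos \<rightarrow>\<^sub>E {1..n}. two_edges m} \<le> card (\<Union>t\<in>Idx. S t)"
    using finI finpos by (intro card_mono) (auto simp: S_def intro!: finite_PiE)
  also have "\<dots> \<le> (\<Sum>t\<in>Idx. card (S t))" by (rule card_UN_le[OF finI])
  also have "\<dots> \<le> card Idx * (9 * n ^ (2 * card R - 2))"
    using sum_bounded_above[of Idx "\<lambda>t. card (S t)", OF Sc] by simp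
  also have "\<dots> \<le> (2 * card R) ^ 4 * (9 * n ^ (2 * card R - 2))"
  proof (rule mult_right_mono)
    have "card Idx \<le> card (pos \<times> pos \<times> pos \<times> pos)"
      using sub finpos by (intro card_mono) auto
    also have "\<dots> = (2 * card R) ^ 4" by (simp add: card_cartesian_product cpos power4_eq_xxxx)
    finally show "card Idx \<le> (2 * card R) ^ 4" .
  qed simp
  finally show ?thesis by (simp add: mult.assoc)
qed

text \<open>If both alternatives fail, the left tuple has two non-isolated slots \<open>j\<close>
  and \<open>j'\<close>, and the right tuple has one, \<open>b\<close>. Either \<open>j\<close> and
  \<open>j'\<close> yield different adjacencies, or the two are adjacent to each other, and then the
  adjacency at \<open>b\<close> is a second one because \<open>b\<close> is no endpoint of the
  first.\<close>

lemma two_edges_or_isolated: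
  assumes "\<not> two_edges m"
  shows "(\<exists>a\<in>R. \<forall>j\<in>R - {a}. \<forall>q\<in>pos - {Inl j}. \<not> adj (m (Inl j)) (m q)) \<or>
    (\<exists>a\<in>R. \<forall>j\<in>R - {a}. \<forall>q\<in>pos - {Inr j}. \<not> adj (m (Inr j)) (m q))"
proof (rule ccontr)
  assume "\<not> ?thesis"
  then have L: "\<And>a. a \<in> R \<Longrightarrow> \<exists>j\<in>R - {a}. \<exists>q\<in>pos - {Inl j}. adj (m (Inl j)) (m q)"
    and Rr: "\<And>a. a \<in> R \<Longrightarrow> \<exists>j\<in>R - {a}. \<exists>q\<in>pos - {Inr j}. adj (m (Inr j)) (m q)" by blast+
  obtain a0 where a0: "a0 \<in> R" using Rne by auto
  obtain j q1 where j: "j \<in> R" "q1 \<in> pos" "q1 \<noteq> Inl j" "adj (m (Inl j)) (m q1)" using L[OF a0] by auto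
  obtain j' q2 where j': "j' \<in> R" "j' \<noteq> j" "q2 \<in> pos" "q2 \<noteq> Inl j'" "adj (m (Inl j')) (m q2)" using L[OF j(1)] by auto
  obtain b q3 where b: "b \<in> R" "q3 \<in> pos" "q3 \<noteq> Inr b" "adj (m (Inr b)) (m q3)" using Rr[OF a0] by auto
  have in_pos: "Inl j \<in> pos" "Inl j' \<in> pos" "Inr b \<in> pos" using j j' b by (auto simp: pos_def)
  have mk: False if "p \<in> pos" "q \<in> pos" "p' \<in> pos" "q' \<in> pos"
     "p \<noteq> q" "p' \<noteq> q'" "p \<noteq> p'" "p \<noteq> q'" "adj (m p) (m q)" "adj (m p') (m q')" for p q p' q'
    using assms that unfolding two_edges_def by blast
  show False
  proof (cases "q2 = Inl j")
    case False
    then show ?thesis using mk[of "Inl j" q1 "Inl j'" q2] j j' in_pos by auto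
  next
    case True
    show ?thesis
    proof (cases "q1 = Inl j'")
      case False
      then show ?thesis using mk[of "Inl j'" q2 "Inl j" q1] j j' in_pos by auto
    next
      case True
      then show ?thesis using mk[of "Inr b" q3 "Inl j" q1] j j' b in_pos by auto
    qed
  qed
qed

lemma tuple_rest_uncorrelated:
  assumes k: "k \<in> R \<rightarrow>\<^sub>E {1..n}" and l: "l \<in> R \<rightarrow>\<^sub>E {1..n}" and ne: "\<not> two_edges (comb (k, l))"
  shows "P.expectation (\<lambda>U. tuple_rest k (tuple_points k U) * tuple_rest l (tuple_points l U)) = 0"
proof -
  have one_side: "P.expectation (\<lambda>U. tuple_rest k (tuple_points k U) * tuple_rest l (tuple_points l U)) = 0"
    if k: "k \<in> R \<rightarrow> {1..n}" and l: "l \<in> R \<rightarrow> {1..n}" and a: "a \<in> R"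
      and d1: "\<And>j j'. j \<in> R - {a} \<Longrightarrow> j' \<in> R \<Longrightarrow> j' \<noteq> j \<Longrightarrow> edge (k j) \<inter> edge (k j') = {}"
      and d2: "\<And>j j'. j \<in> R - {a} \<Longrightarrow> j' \<in> R \<Longrightarrow> edge (k j) \<inter> edge (l j') = {}" for k l a
  proof -
    \<comment> \<open>The labels of the one exceptional slot together with all labels of the other
      tuple: everything that the isolated slots avoid.\<close>
    define Q where "Q = edge (k a) \<union> (\<Union>b\<in>R. edge (l b))"
    have sub: "(\<Union>j\<in>R. edge (l j)) \<subseteq> Q" by (auto simp: Q_def)
    have tr: "tuple_points l (restrict U Q) = tuple_points l U" for U
      unfolding tuple_points_def using sub by (intro restrict_ext pt_restrict) auto
    show ?thesis
    proof (rule tuple_rest_orthogonal[OF k a, of Q])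
      show "Q \<subseteq> {1..n}" unfolding Q_def by (intro Un_least UN_least edge_sub) (use k l a in auto)
      show "edge (k j) \<inter> Q = {}" if "j \<in> R - {a}" for j
        using d1[OF that a] d2[OF that] that by (auto simp: Q_def)
      show "(\<lambda>U. tuple_rest l (tuple_points l U)) \<in> borel_measurable (PiM Q (\<lambda>_. borel))"
        by (rule measurable_compose[OF tuple_points_measurable[OF sub] tuple_rest_measurable[OF l]])
      show "\<bar>tuple_rest l (tuple_points l U)\<bar> \<le> rest_bound" for U by (rule tuple_rest_bound[OF l])
    qed (use d1 tr in \<open>auto simp: Q_def\<close>)
  qed
  have kl: "k \<in> R \<rightarrow> {1..n}" "l \<in> R \<rightarrow> {1..n}" using k l by (auto simp: PiE_def)
  have c: "comb (k, l) (Inl j) = k j" "comb (k, l) (Inr j) = l j" "Inl j \<in> pos" "Inr j \<in> pos" if "j \<in> R" for j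
    using that by (auto simp: comb_def pos_def)
  from two_edges_or_isolated[OF ne] show ?thesis
  proof (elim disjE bexE)
    fix a assume a: "a \<in> R" and iso: "\<forall>j\<in>R - {a}. \<forall>q\<in>pos - {Inl j}. \<not> adj (comb (k, l) (Inl j)) (comb (k, l) q)"
    show ?thesis
    proof (rule one_side[OF kl a])
      show "edge (k j) \<inter> edge (k j') = {}" if "j \<in> R - {a}" "j' \<in> R" "j' \<noteq> j" for j j'
        using bspec[OF bspec[OF iso that(1)], of "Inl j'"] that c by (auto simp: adj_def)
      show "edge (k j) \<inter> edge (l j') = {}" if "j \<in> R - {a}" "j' \<in> R" for j j'
        using bspec[OF bspec[OF iso that(1)], of "Inr j'"] that c by (auto simp: adj_def)
    qed
  next
    fix a assume a: "a \<in> R" and iso: "\<forall>j\<in>R - {a}. \<forall>q\<in>pos - {Inr j}. \<not> adj (comb (k, l) (Inr j)) (comb (k, l) q)"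
    have "P.expectation (\<lambda>U. tuple_rest l (tuple_points l U) * tuple_rest k (tuple_points k U)) = 0"
    proof (rule one_side[OF kl(2,1) a])
      show "edge (l j) \<inter> edge (l j') = {}" if "j \<in> R - {a}" "j' \<in> R" "j' \<noteq> j" for j j'
        using bspec[OF bspec[OF iso that(1)], of "Inr j'"] that c by (auto simp: adj_def)
      show "edge (l j) \<inter> edge (k j') = {}" if "j \<in> R - {a}" "j' \<in> R" for j j'
        using bspec[OF bspec[OF iso that(1)], of "Inl j'"] that c by (auto simp: adj_def)
    qed
    then show ?thesis by (simp add: mult.commute)
  qed
qed

lemma tuple_points_measurable_P: "k \<in> R \<rightarrow> {1..n} \<Longrightarrow> tuple_points k \<in> measurable P (PiM R (\<lambda>_. borel))"
  using tuple_points_measurable[of k "{1..n}"] edge_sub by (fastforce simp: measurable_cong_sets[OF sets_P refl])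

text \<open>Only pairs with two adjacencies contribute, and \<open>comb\<close> embeds them into the
  maps counted before. With \<open>r = card R\<close>, the \<open>L^2\<close> norm is of order
  \<open>n^(r-1)\<close>, a factor \<open>sqrt n\<close> below the scale \<open>n^(r-1/2)\<close> of
  the theorem.\<close>

lemma tuple_rest_second_moment:
  "P.expectation (\<lambda>U. (\<Sum>k\<in>R \<rightarrow>\<^sub>E {1..n}. tuple_rest k (tuple_points k U))\<^sup>2)
    \<le> real ((2 * card R) ^ 4 * 9 * n ^ (2 * card R - 2)) * rest_bound\<^sup>2"
proof -
  let ?K = "R \<rightarrow>\<^sub>E {1..n}"
  have finK: "finite ?K" using finR by (intro finite_PiE) auto
  have KR: "k \<in> R \<rightarrow> {1..n}" if "k \<in> ?K" for k using that by (auto simp: PiE_def)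
  have m: "(\<lambda>U. tuple_rest k (tuple_points k U)) \<in> borel_measurable P" if "k \<in> ?K" for k
    using measurable_compose[OF tuple_points_measurable_P tuple_rest_measurable] KR[OF that] by blast
  have b2: "\<bar>tuple_rest k (tuple_points k U) * tuple_rest l (tuple_points l U)\<bar> \<le> rest_bound\<^sup>2" if "k \<in> ?K" "l \<in> ?K" for k l U
    unfolding abs_mult power2_eq_square using tuple_rest_bound[OF KR[OF that(1)], of "tuple_points k U"] tuple_rest_bound[OF KR[OF that(2)], of "tuple_points l U"]
    by (intro mult_mono) auto
  have i: "integrable P (\<lambda>U. tuple_rest k (tuple_points k U) * tuple_rest l (tuple_points l U))" if "k \<in> ?K" "l \<in> ?K" for k l
    using m that b2[OF that] by (intro P.bounded_integrable[of _ "rest_bound\<^sup>2"] borel_measurable_times) auto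
  define E where "E p = P.expectation (\<lambda>U. tuple_rest (fst p) (tuple_points (fst p) U) * tuple_rest (snd p) (tuple_points (snd p) U))" for p
  define Bad where "Bad = {p \<in> ?K \<times> ?K. two_edges (comb p)}"
  have finBad: "finite Bad" using finK by (simp add: Bad_def)
  have "P.expectation (\<lambda>U. (\<Sum>k\<in>?K. tuple_rest k (tuple_points k U))\<^sup>2)
    = P.expectation (\<lambda>U. \<Sum>k\<in>?K. \<Sum>l\<in>?K. tuple_rest k (tuple_points k U) * tuple_rest l (tuple_points l U))"
    unfolding power2_eq_square sum_product ..
  also have "\<dots> = (\<Sum>k\<in>?K. \<Sum>l\<in>?K. E (k, l))"
    using i by (simp add: Bochner_Integration.integral_sum Bochner_Integration.integrable_sum E_def)
  also have "\<dots> = sum E (?K \<times> ?K)" by (simp add: sum.cartesian_product)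
  also have "\<dots> = sum E Bad"
  proof (rule sum.mono_neutral_right)
    show "\<forall>p\<in>?K \<times> ?K - Bad. E p = 0"
    proof
      fix p assume "p \<in> ?K \<times> ?K - Bad"
      then have "fst p \<in> ?K" "snd p \<in> ?K" "\<not> two_edges (comb (fst p, snd p))" by (auto simp: Bad_def)
      then show "E p = 0" unfolding E_def by (rule tuple_rest_uncorrelated)
    qed
  qed (use finK in \<open>auto simp: Bad_def\<close>)
  also have "\<dots> \<le> real (card Bad) * rest_bound\<^sup>2"
  proof (rule sum_bounded_above)
    fix p assume "p \<in> Bad"
    then have p: "fst p \<in> ?K" "snd p \<in> ?K" by (auto simp: Bad_def)
    show "E p \<le> rest_bound\<^sup>2"
      using P.norm_expectation_le[of "\<lambda>U. tuple_rest (fst p) (tuple_points (fst p) U) * tuple_rest (snd p) (tuple_points (snd p) U)" "rest_bound\<^sup>2"] b2[OF p] m[OF p(1)] m[OF p(2)]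
      by (auto simp: E_def abs_le_iff)
  qed
  finally have le: "P.expectation (\<lambda>U. (\<Sum>k\<in>?K. tuple_rest k (tuple_points k U))\<^sup>2) \<le> real (card Bad) * rest_bound\<^sup>2" .
  have "card Bad \<le> (2 * card R) ^ 4 * 9 * n ^ (2 * card R - 2)"
  proof -
    have fst_eq: "fst p = (\<lambda>j\<in>R. comb p (Inl j))" and snd_eq: "snd p = (\<lambda>j\<in>R. comb p (Inr j))" if "p \<in> Bad" for p
      using that by (auto simp: Bad_def comb_def pos_def fun_eq_iff PiE_def extensional_def)
    have "inj_on comb Bad"
      by (rule inj_onI) (metis fst_eq snd_eq prod_eqI)
    moreover have "comb ` Bad \<subseteq> {m \<in> pos \<rightarrow>\<^sub>E {1..n}. two_edges m}"
      by (auto simp: Bad_def comb_def pos_def split: sum.splits)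
    moreover have "finite {m \<in> pos \<rightarrow>\<^sub>E {1..n}. two_edges m}"
    proof (rule finite_subset)
      show "finite (pos \<rightarrow>\<^sub>E {1..n})" using finR by (auto simp: pos_def intro!: finite_PiE)
    qed auto
    ultimately have "card Bad \<le> card {m \<in> pos \<rightarrow>\<^sub>E {1..n}. two_edges m}"
      using card_image[of comb Bad] card_mono[of "{m \<in> pos \<rightarrow>\<^sub>E {1..n}. two_edges m}" "comb ` Bad"] by linarith
    then show ?thesis using card_two_edges_le by linarith
  qed
  then have "real (card Bad) * rest_bound\<^sup>2 \<le> real ((2 * card R) ^ 4 * 9 * n ^ (2 * card R - 2)) * rest_bound\<^sup>2"
    by (intro mult_right_mono of_nat_mono) auto
  with le show ?thesis by (rule order_trans)
qed

end

section \<open>Passing to a common law\<close>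

text \<open>\<open>\<delta>\<close> compares only the sum of the point laws with \<open>n\<close>
  copies of \<open>\<mu>\<close>. In the application each point law is that of the diagonal or of
  the square, neither of which need be near the mixture, so \<open>\<mu>\<close> may be substituted
  only after summing over indices.\<close>

locale ustat_limit = ustat +
  fixes \<mu> :: "(real \<times> real) measure" and \<delta> :: real
  assumes \<mu>: "prob_space \<mu>" and sets_\<mu>: "sets \<mu> = sets borel"
    and discrepancy: "\<And>G C. G \<in> borel_measurable borel \<Longrightarrow> (\<And>z. \<bar>G z\<bar> \<le> C) \<Longrightarrow>
        \<bar>(\<Sum>i\<in>{1..n}. \<integral>z. G z \<partial>law i) - real n * (\<integral>z. G z \<partial>\<mu>)\<bar> \<le> \<delta> * C"
begin

definition proj :: "'a \<Rightarrow> real \<times> real \<Rightarrow> real" where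
  "proj a z = (\<integral>x. h (x(a := z)) \<partial>PiM (R - {a}) (\<lambda>_. \<mu>))"

definition hmean :: real where
  "hmean = (\<integral>x. h x \<partial>PiM R (\<lambda>_. \<mu>))"

lemma slots_\<mu>: "slots R (\<lambda>_. \<mu>) h H"
  unfolding slots_def using \<mu> sets_\<mu> hH h by auto

lemma proj_measurable: "a \<in> R \<Longrightarrow> proj a \<in> borel_measurable borel"
  unfolding proj_def[abs_def] by (rule slots.slot_measurable[OF slots_\<mu>])

lemma proj_bound: "a \<in> R \<Longrightarrow> \<bar>proj a z\<bar> \<le> H"
  unfolding proj_def by (rule slots.slot_bound[OF slots_\<mu>])

lemma \<delta>0: "\<delta> * H \<ge> 0"
proof -
  have "0 \<le> \<delta> * H" using discrepancy[of "\<lambda>_. 0" H] H0 by simp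
  then show ?thesis .
qed

lemma hybrid:
  assumes J: "finite J" and f: "f \<in> borel_measurable (PiM J (\<lambda>_. borel))" and fH: "\<And>x. \<bar>f x\<bar> \<le> H"
  shows "\<bar>(\<Sum>k\<in>J \<rightarrow>\<^sub>E {1..n}. \<integral>x. f x \<partial>PiM J (\<lambda>j. law (k j))) - real n ^ card J * (\<integral>x. f x \<partial>PiM J (\<lambda>_. \<mu>))\<bar>
    \<le> real (card J) * real n ^ (card J - 1) * (\<delta> * H)"
proof -
  have "\<bar>(\<Sum>k\<in>J \<rightarrow>\<^sub>E {1..n}. \<integral>x. f x \<partial>PiM J (\<lambda>j. law (k j))) - real (card {1..n}) ^ card J * (\<integral>x. f x \<partial>PiM J (\<lambda>_. \<mu>))\<bar>
    \<le> real (card J) * real (card {1..n}) ^ (card J - 1) * \<delta> * H"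
    by (rule hybrid_integral[OF J finite_atLeastAtMost prob_space_law sets_law \<mu> sets_\<mu> _ f fH])
       (simp_all only: card_atLeastAtMost diff_Suc_1 Suc_eq_plus1[symmetric] discrepancy)
  then show ?thesis by (simp only: card_atLeastAtMost diff_Suc_1 mult.assoc)
qed

lemma tuple_mean_sum: "\<bar>(\<Sum>k\<in>R \<rightarrow>\<^sub>E {1..n}. tuple_mean k) - real n ^ card R * hmean\<bar> \<le> real (card R) * real n ^ (card R - 1) * (\<delta> * H)"
  unfolding tuple_mean_def hmean_def by (rule hybrid[OF finR h hH])

text \<open>\<open>tuple_proj k a\<close> does not depend on \<open>k a\<close>. Fixing the index of
  slot \<open>a\<close> therefore leaves a sum over the other slots, to which \<open>hybrid\<close>
  applies with one slot fewer, uniformly in the value of the point.\<close>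

lemma tuple_proj_sum:
  assumes a: "a \<in> R"
  shows "\<bar>(\<Sum>k\<in>R \<rightarrow>\<^sub>E {1..n}. tuple_proj k a (pt \<sigma> U (k a))) - real n ^ (card R - 1) * (\<Sum>i\<in>{1..n}. proj a (pt \<sigma> U i))\<bar>
    \<le> real (card R) * real n ^ (card R - 1) * (\<delta> * H)"
proof -
  let ?J = "R - {a}"
  have R: "insert a ?J = R" using a by auto
  have cJ: "card ?J = card R - 1" using a finR by simp
  have hku: "tuple_proj (k(a := i)) a z = tuple_proj k a z" for k i z
    unfolding tuple_proj_def by (intro arg_cong2[where f=lebesgue_integral] PiM_cong) auto
  have "(\<Sum>k\<in>R \<rightarrow>\<^sub>E {1..n}. tuple_proj k a (pt \<sigma> U (k a))) = (\<Sum>k\<in>insert a ?J \<rightarrow>\<^sub>E {1..n}. tuple_proj k a (pt \<sigma> U (k a)))"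
    by (simp only: R)
  also have "\<dots> = (\<Sum>(i, k)\<in>{1..n} \<times> (?J \<rightarrow>\<^sub>E {1..n}). tuple_proj k a (pt \<sigma> U i))"
    unfolding PiE_insert_eq
    by (subst sum.reindex) (auto simp: case_prod_beta hku intro: inj_combinator)
  also have "\<dots> = (\<Sum>i\<in>{1..n}. \<Sum>k\<in>?J \<rightarrow>\<^sub>E {1..n}. tuple_proj k a (pt \<sigma> U i))"
    by (rule sum.cartesian_product[symmetric])
  finally have S: "(\<Sum>k\<in>R \<rightarrow>\<^sub>E {1..n}. tuple_proj k a (pt \<sigma> U (k a))) = (\<Sum>i\<in>{1..n}. \<Sum>k\<in>?J \<rightarrow>\<^sub>E {1..n}. tuple_proj k a (pt \<sigma> U i))" .
  have one: "\<bar>(\<Sum>k\<in>?J \<rightarrow>\<^sub>E {1..n}. tuple_proj k a z) - real n ^ (card R - 1) * proj a z\<bar>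
      \<le> real (card R - 1) * real n ^ (card R - 1 - 1) * (\<delta> * H)" for z
  proof -
    have m: "(\<lambda>x. h (x(a := z))) \<in> borel_measurable (PiM ?J (\<lambda>_. borel))"
      using slots.slot_section_measurable[OF slots_\<mu> a, of z] slots.sets_rest[OF slots_\<mu>, of "{a}"]
      by (simp cong: measurable_cong_sets)
    have "finite ?J" using finR by simp
    from hybrid[OF this m hH] show ?thesis
      unfolding tuple_proj_def proj_def cJ .
  qed
  have "\<bar>\<Sum>i\<in>{1..n}. (\<Sum>k\<in>?J \<rightarrow>\<^sub>E {1..n}. tuple_proj k a (pt \<sigma> U i)) - real n ^ (card R - 1) * proj a (pt \<sigma> U i)\<bar>
      \<le> (\<Sum>i\<in>{1..n}. real (card R - 1) * real n ^ (card R - 1 - 1) * (\<delta> * H))"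
    by (rule order_trans[OF sum_abs]) (intro sum_mono one)
  also have "\<dots> = (real n * (real (card R - 1) * real n ^ (card R - 1 - 1))) * (\<delta> * H)" by simp
  also have "\<dots> \<le> (real (card R) * real n ^ (card R - 1)) * (\<delta> * H)"
  proof (rule mult_right_mono[OF _ \<delta>0])
    obtain m where m: "card R = Suc m" using a finR by (metis card_eq_0_iff empty_iff not0_implies_Suc)
    show "real n * (real (card R - 1) * real n ^ (card R - 1 - 1)) \<le> real (card R) * real n ^ (card R - 1)"
      unfolding m by (cases m) (auto simp: algebra_simps)
  qed
  finally show ?thesis unfolding S by (simp add: sum_subtractf sum_distrib_left)
qed

lemma proj_sum:
  assumes a: "a \<in> R"
  shows "\<bar>(\<Sum>i\<in>{1..n}. \<integral>z. proj a z \<partial>law i) - real n * hmean\<bar> \<le> \<delta> * H"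
proof -
  have "(\<integral>z. proj a z \<partial>\<mu>) = hmean"
    unfolding proj_def hmean_def by (rule slots.slot_integral[OF slots_\<mu> a])
  then show ?thesis using discrepancy[OF proj_measurable[OF a] proj_bound[OF a]] by simp
qed

text \<open>Sum the definition of \<open>tuple_rest\<close> over all tuples and replace the means
  and projections of each tuple by those under \<open>\<mu>\<close>. The bound is deterministic in
  \<open>U\<close>: the randomness of the part to be discarded sits in the remainder sum
  alone.\<close>

lemma decomposition:
  "\<bar>(\<Sum>k\<in>R \<rightarrow>\<^sub>E {1..n}. h (tuple_points k U)) - real n ^ card R * hmean - (\<Sum>k\<in>R \<rightarrow>\<^sub>E {1..n}. tuple_rest k (tuple_points k U))
     - real n ^ (card R - 1) * (\<Sum>a\<in>R. \<Sum>i\<in>{1..n}. proj a (pt \<sigma> U i) - (\<integral>z. proj a z \<partial>law i))\<bar>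
   \<le> 3 * (real (card R))\<^sup>2 * real n ^ (card R - 1) * (\<delta> * H)"
proof -
  define N r E where "N = real n" and "r = real (card R)" and "E = N ^ (card R - 1) * (\<delta> * H)"
  define K where "K = R \<rightarrow>\<^sub>E {1..n}"
  define A where "A a = (\<Sum>k\<in>K. tuple_proj k a (pt \<sigma> U (k a)))" for a
  define B where "B a = (\<Sum>i\<in>{1..n}. proj a (pt \<sigma> U i))" for a
  define C where "C a = (\<Sum>i\<in>{1..n}. \<integral>z. proj a z \<partial>law i)" for a
  define e where "e = (\<Sum>k\<in>K. tuple_mean k)"
  have cR: "card R \<noteq> 0" using Rne finR by simp
  have r1: "r \<ge> 1" using cR unfolding r_def by linarith
  have E0: "E \<ge> 0" unfolding E_def N_def using \<delta>0 by simp
  have Npow: "N ^ card R = N ^ (card R - 1) * N" using cR by (cases "card R") auto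
  have tk: "tuple_points k U a = pt \<sigma> U (k a)" if "a \<in> R" for k a using that by (simp add: tuple_points_def)
  have "(\<Sum>k\<in>K. tuple_rest k (tuple_points k U)) = (\<Sum>k\<in>K. h (tuple_points k U)) - e - (\<Sum>k\<in>K. \<Sum>a\<in>R. tuple_proj k a (pt \<sigma> U (k a)) - tuple_mean k)"
    by (simp add: tuple_rest_def sum_subtractf e_def tk)
  also have "(\<Sum>k\<in>K. \<Sum>a\<in>R. tuple_proj k a (pt \<sigma> U (k a)) - tuple_mean k) = (\<Sum>a\<in>R. A a) - r * e"
    by (subst sum.swap) (simp add: A_def sum_subtractf e_def r_def)
  finally have D: "(\<Sum>k\<in>K. tuple_rest k (tuple_points k U)) = (\<Sum>k\<in>K. h (tuple_points k U)) - e - ((\<Sum>a\<in>R. A a) - r * e)" .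
  have bc: "(\<Sum>a\<in>R. \<Sum>i\<in>{1..n}. proj a (pt \<sigma> U i) - (\<integral>z. proj a z \<partial>law i)) = (\<Sum>a\<in>R. B a - C a)"
    by (simp add: B_def C_def sum_subtractf)
  \<comment> \<open>Three errors appear: in the projections, in the means, which occur with total
    coefficient \<open>r - 1\<close>, and in the centring of the linear part. Each is at most
    \<open>r^2 * E\<close>, whence the factor \<open>3\<close>.\<close>
  have eq: "(\<Sum>k\<in>K. h (tuple_points k U)) - N ^ card R * hmean - (\<Sum>k\<in>K. tuple_rest k (tuple_points k U)) - N ^ (card R - 1) * (\<Sum>a\<in>R. B a - C a)
    = (\<Sum>a\<in>R. A a - N ^ (card R - 1) * B a) - (r - 1) * (e - N ^ card R * hmean) + N ^ (card R - 1) * (\<Sum>a\<in>R. C a - N * hmean)"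
    unfolding D Npow by (simp add: sum_subtractf sum_distrib_left[symmetric] sum_distrib_right[symmetric] r_def algebra_simps)
  have 1: "\<bar>\<Sum>a\<in>R. A a - N ^ (card R - 1) * B a\<bar> \<le> r * (r * E)"
  proof (rule order_trans[OF sum_abs])
    show "(\<Sum>a\<in>R. \<bar>A a - N ^ (card R - 1) * B a\<bar>) \<le> r * (r * E)"
      unfolding r_def
    proof (rule sum_bounded_above)
      fix a assume "a \<in> R"
      from tuple_proj_sum[OF this, of U] show "\<bar>A a - N ^ (card R - 1) * B a\<bar> \<le> real (card R) * E"
        by (simp add: A_def B_def K_def N_def E_def mult.assoc)
    qed
  qed
  have "\<bar>(r - 1) * (e - N ^ card R * hmean)\<bar> \<le> r * (r * E)"
    unfolding abs_mult using r1 E0 tuple_mean_sum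
    by (intro mult_mono) (auto simp: e_def K_def N_def E_def r_def mult.assoc)
  moreover have "\<bar>N ^ (card R - 1) * (\<Sum>a\<in>R. C a - N * hmean)\<bar> \<le> N ^ (card R - 1) * (r * (\<delta> * H))"
    unfolding abs_mult
  proof (intro mult_mono)
    show "\<bar>\<Sum>a\<in>R. C a - N * hmean\<bar> \<le> r * (\<delta> * H)"
      unfolding r_def
      by (rule order_trans[OF sum_abs], rule sum_bounded_above) (use proj_sum in \<open>simp add: C_def N_def\<close>)
  qed (auto simp: N_def)
  moreover have "N ^ (card R - 1) * (r * (\<delta> * H)) \<le> r * (r * E)"
  proof -
    have "N ^ (card R - 1) * (r * (\<delta> * H)) = r * (1 * E)" by (simp add: E_def)
    also have "\<dots> \<le> r * (r * E)" using r1 E0 by (intro mult_left_mono mult_right_mono) auto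
    finally show ?thesis .
  qed
  ultimately have "\<bar>(\<Sum>a\<in>R. A a - N ^ (card R - 1) * B a) - (r - 1) * (e - N ^ card R * hmean) + N ^ (card R - 1) * (\<Sum>a\<in>R. C a - N * hmean)\<bar>
     \<le> 3 * (r * (r * E))" using 1 by linarith
  then show ?thesis
    unfolding bc eq[unfolded N_def K_def, symmetric, folded N_def K_def]
    unfolding N_def K_def r_def E_def bc by (simp add: power2_eq_square mult.assoc)
qed

end

section \<open>The linear part\<close>

text \<open>Splits one coordinate off a product measure; \<open>upd\<close> says that
  \<open>f\<close> does not read coordinate \<open>a\<close>.\<close>

lemma distr_PiM_component_pair:
  fixes f :: "('i \<Rightarrow> real) \<Rightarrow> 'b"
  assumes a: "a \<notin> I" and f: "f \<in> measurable (PiM I (\<lambda>_. borel)) N"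
    and upd: "\<And>x z. f (x(a := z)) = f x" and f': "f \<in> measurable (PiM (insert a I) (\<lambda>_. borel)) N"
  shows "distr (PiM (insert a I) (\<lambda>_. unif)) (borel \<Otimes>\<^sub>M N) (\<lambda>x. (x a, f x)) = unif \<Otimes>\<^sub>M distr (PiM I (\<lambda>_. unif)) N f"
proof -
  have s: "sets (PiM J (\<lambda>_. unif)) = sets (PiM J (\<lambda>_. borel))" for J :: "'i set"
    by (rule sets_PiM_cong) auto
  have f1: "f \<in> measurable (PiM I (\<lambda>_. unif)) N" using f by (simp add: measurable_cong_sets[OF s refl])
  have f2: "f \<in> measurable (PiM (insert a I) (\<lambda>_. unif)) N" using f' by (simp add: measurable_cong_sets[OF s refl])
  have u: "(\<lambda>(z, x). x(a := z)) \<in> measurable (unif \<Otimes>\<^sub>M PiM I (\<lambda>_. unif)) (PiM (insert a I) (\<lambda>_. unif))"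
    unfolding case_prod_beta by (intro measurable_fun_upd[where J=I]) auto
  interpret X: prob_space "distr (PiM I (\<lambda>_. unif)) N f"
    by (intro prob_space.prob_space_distr prob_space_PiM prob_space_unif f1)
  have "distr (PiM (insert a I) (\<lambda>_. unif)) (borel \<Otimes>\<^sub>M N) (\<lambda>x. (x a, f x))
    = distr (distr (unif \<Otimes>\<^sub>M PiM I (\<lambda>_. unif)) (PiM (insert a I) (\<lambda>_. unif)) (\<lambda>(z, x). x(a := z))) (borel \<Otimes>\<^sub>M N) (\<lambda>x. (x a, f x))"
    by (subst distr_pair_PiM_eq_PiM) (auto intro: prob_space_unif)
  also have "\<dots> = distr (unif \<Otimes>\<^sub>M PiM I (\<lambda>_. unif)) (borel \<Otimes>\<^sub>M N) (\<lambda>(z, x). (z, f x))"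
    using f2 by (subst distr_distr[OF _ u]) (auto simp: o_def upd split_def intro!: measurable_Pair measurable_component_singleton)
  also have "\<dots> = distr unif borel (\<lambda>x. x) \<Otimes>\<^sub>M distr (PiM I (\<lambda>_. unif)) N f"
    by (rule pair_measure_distr[symmetric]) (auto intro: f1 X.sigma_finite_measure_axioms)
  also have "distr unif borel (\<lambda>x. x) = unif" by (rule distr_id2) simp
  finally show ?thesis .
qed

text \<open>Realising the triple on a product indexed by \<open>{0, 1, 2}\<close> reduces
  expectations over distinct labels to a reindexing of coordinates.\<close>

lemma UVW_eq_distr:
  "UVW = distr (PiM {0, 1, 2 :: nat} (\<lambda>_. unif)) (borel \<Otimes>\<^sub>M (borel \<Otimes>\<^sub>M borel)) (\<lambda>x. (x 0, x 1, x 2))"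
proof -
  have "distr (PiM {2 :: nat} (\<lambda>_. unif)) borel (\<lambda>x. x 2) = unif"
    using distr_PiM_component[of "{2::nat}" "\<lambda>_. unif" 2] prob_space_unif by (simp cong: distr_cong)
  then have "distr (PiM {1, 2 :: nat} (\<lambda>_. unif)) (borel \<Otimes>\<^sub>M borel) (\<lambda>x. (x 1, x 2)) = unif \<Otimes>\<^sub>M unif"
    by (subst distr_PiM_component_pair) (auto intro!: measurable_component_singleton)
  then show ?thesis
    unfolding UVW_def by (subst distr_PiM_component_pair) (auto intro!: measurable_component_singleton measurable_Pair)
qed

lemma integral_PiM_unif_reindex:
  fixes F :: "('j \<Rightarrow> real) \<Rightarrow> real"
  assumes "inj_on f I" "f \<in> I \<rightarrow> K" and F: "F \<in> borel_measurable (PiM I (\<lambda>_. borel))"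
  shows "(\<integral>x. F (\<lambda>j\<in>I. x (f j)) \<partial>PiM K (\<lambda>_. unif)) = (\<integral>x. F x \<partial>PiM I (\<lambda>_. unif))"
proof -
  have s: "sets (PiM I (\<lambda>_. unif)) = sets (PiM I (\<lambda>_. borel))"
    by (rule sets_PiM_cong) auto
  have "(\<integral>x. F x \<partial>PiM I (\<lambda>_. unif)) = (\<integral>x. F x \<partial>distr (PiM K (\<lambda>_. unif)) (PiM I (\<lambda>_. unif)) (\<lambda>x. \<lambda>j\<in>I. x (f j)))"
    using distr_PiM_reindex[OF prob_space_unif assms(1,2)] by simp
  also have "\<dots> = (\<integral>x. F (\<lambda>j\<in>I. x (f j)) \<partial>PiM K (\<lambda>_. unif))"
    using assms by (intro integral_distr) (auto simp: measurable_cong_sets[OF s refl] dest: Pi_mem intro!: measurable_restrict measurable_component_singleton)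
  finally show ?thesis by simp
qed

lemma borel_measurable_fst_prod[measurable]:
  "(fst :: 'a::second_countable_topology \<times> 'b::second_countable_topology \<Rightarrow> 'a) \<in> borel_measurable borel"
  unfolding borel_prod[symmetric] by simp

lemma borel_measurable_snd_prod[measurable]:
  "(snd :: 'a::second_countable_topology \<times> 'b::second_countable_topology \<Rightarrow> 'b) \<in> borel_measurable borel"
  unfolding borel_prod[symmetric] by simp

lemma integral_UVW:
  assumes \<phi>[measurable]: "(\<phi> :: _ \<Rightarrow> real) \<in> borel_measurable (borel :: (real \<times> real \<times> real) measure)"
  shows "(\<integral>z. \<phi> z \<partial>UVW) = (\<integral>x. \<phi> (x 0, x 1, x 2) \<partial>PiM {0, 1, 2 :: nat} (\<lambda>_. unif))"
  unfolding UVW_eq_distr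
  by (rule integral_distr) (auto simp: borel_prod intro!: borel_measurable_Pair measurable_component_singleton)

lemma prob_space_UVW: "prob_space UVW"
  unfolding UVW_eq_distr by (intro prob_space.prob_space_distr prob_space_PiM prob_space_unif) auto

lemma sets_UVW[measurable_cong]: "sets UVW = sets borel"
  unfolding UVW_eq_distr by (simp add: borel_prod)

section \<open>Covariances of neighbouring points and the normal approximation of their sum\<close>

context sample begin

lemma expectation_coord1:
  assumes "a \<in> {1..n}" and [measurable]: "(\<phi> :: _ \<Rightarrow> real) \<in> borel_measurable borel"
  shows "P.expectation (\<lambda>U. \<phi> (U a)) = (\<integral>(u, v, w). \<phi> u \<partial>UVW)"
proof -
  have "P.expectation (\<lambda>U. \<phi> (U a)) = (\<integral>x. \<phi> (x 0) \<partial>PiM {0 :: nat} (\<lambda>_. unif))"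
    using integral_PiM_unif_reindex[of "\<lambda>_. a" "{0 :: nat}" "{1..n}" "\<lambda>x. \<phi> (x 0)"] assms by (simp add: P_def)
  also have "\<dots> = (\<integral>x. \<phi> (x 0) \<partial>PiM {0, 1, 2 :: nat} (\<lambda>_. unif))"
    using integral_PiM_unif_reindex[of "\<lambda>i. i" "{0 :: nat}" "{0, 1, 2 :: nat}" "\<lambda>x. \<phi> (x 0)"] by simp
  finally show ?thesis using integral_UVW[of "\<lambda>z. \<phi> (fst z)"] by (simp add: split_def)
qed

lemma expectation_coord2:
  assumes "a \<in> {1..n}" "b \<in> {1..n}" "a \<noteq> b" and [measurable]: "(\<phi> :: _ \<Rightarrow> real) \<in> borel_measurable borel"
  shows "P.expectation (\<lambda>U. \<phi> (U a, U b)) = (\<integral>(u, v, w). \<phi> (u, v) \<partial>UVW)"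
proof -
  have "P.expectation (\<lambda>U. \<phi> (U a, U b)) = (\<integral>x. \<phi> (x 0, x 1) \<partial>PiM {0, 1 :: nat} (\<lambda>_. unif))"
    using integral_PiM_unif_reindex[of "\<lambda>i. if i = 0 then a else b" "{0, 1 :: nat}" "{1..n}" "\<lambda>x. \<phi> (x 0, x 1)"] assms
    by (simp add: P_def)
  also have "\<dots> = (\<integral>x. \<phi> (x 0, x 1) \<partial>PiM {0, 1, 2 :: nat} (\<lambda>_. unif))"
    using integral_PiM_unif_reindex[of "\<lambda>i. i" "{0, 1 :: nat}" "{0, 1, 2 :: nat}" "\<lambda>x. \<phi> (x 0, x 1)"] by simp
  finally show ?thesis using integral_UVW[of "\<lambda>z. \<phi> (fst z, fst (snd z))"] by (simp add: split_def)
qed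

lemma expectation_coord3:
  assumes "a \<in> {1..n}" "b \<in> {1..n}" "c \<in> {1..n}" "a \<noteq> b" "a \<noteq> c" "b \<noteq> c" and [measurable]: "(\<phi> :: _ \<Rightarrow> real) \<in> borel_measurable borel"
  shows "P.expectation (\<lambda>U. \<phi> (U a, U b, U c)) = (\<integral>(u, v, w). \<phi> (u, v, w) \<partial>UVW)"
proof -
  have "P.expectation (\<lambda>U. \<phi> (U a, U b, U c)) = (\<integral>x. \<phi> (x 0, x 1, x 2) \<partial>PiM {0, 1, 2 :: nat} (\<lambda>_. unif))"
    using integral_PiM_unif_reindex[of "\<lambda>i. if i = 0 then a else if i = 1 then b else c" "{0, 1, 2 :: nat}" "{1..n}" "\<lambda>x. \<phi> (x 0, x 1, x 2)"] assms
    by (simp add: P_def inj_on_def)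
  then show ?thesis by (simp add: integral_UVW)
qed

definition nb :: "nat \<Rightarrow> nat set" where
  "nb i = {j \<in> {1..n}. edge i \<inter> edge j \<noteq> {}}"

text \<open>For bounded measurable \<open>g\<close> this is the variance of the sum of
  \<open>g\<close> over all points, because points with disjoint edges are uncorrelated. Since
  \<open>i\<close> lies in \<open>nb i\<close>, the individual variances are included.\<close>

definition vsum :: "(real \<times> real \<Rightarrow> real) \<Rightarrow> real" where
  "vsum g = (\<Sum>i\<in>{1..n}. \<Sum>j\<in>nb i. Cov P (\<lambda>U. g (pt \<sigma> U i)) (\<lambda>U. g (pt \<sigma> U j)))"

lemma nb_eq: "i \<in> {1..n} \<Longrightarrow> nb i = {i, \<sigma> i, inv \<sigma> i}"
  using permutes_inverses[OF perm] permutes_inj[OF perm] permutes_in_image[OF perm, of i] permutes_in_image[OF permutes_inv[OF perm], of i]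
  by (auto simp: nb_def edge_def inj_eq)

lemma card_nb: "i \<in> {1..n} \<Longrightarrow> card (nb i) \<le> 3"
  by (auto simp: nb_eq card_insert_if)

lemma Cov_commute: "Cov M X Y = Cov M Y X"
  by (simp add: Cov_def mult.commute)

text \<open>A fixed point has no neighbour but itself, a point of a two-cycle has its mirror image
  as only other neighbour, and any other point has a successor and a predecessor that share one
  label with it, whence the factor \<open>2\<close>. \<open>t2\<close> counts indices, that is,
  twice the number of two-cycles.\<close>

lemma vsum_eq:
  fixes g :: "real \<times> real \<Rightarrow> real"
  assumes g[measurable]: "g \<in> borel_measurable borel"
  defines "t1 \<equiv> card {i \<in> {1..n}. \<sigma> i = i}" and "t2 \<equiv> card {i \<in> {1..n}. \<sigma> i \<noteq> i \<and> \<sigma> (\<sigma> i) = i}"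
  shows "vsum g = real t1 * Cov UVW (\<lambda>(u, v, w). g (u, u)) (\<lambda>(u, v, w). g (u, u))
    + (real n - real t1) * Cov UVW (\<lambda>(u, v, w). g (u, v)) (\<lambda>(u, v, w). g (u, v))
    + real t2 * Cov UVW (\<lambda>(u, v, w). g (u, v)) (\<lambda>(u, v, w). g (v, u))
    + 2 * (real n - real t1 - real t2) * Cov UVW (\<lambda>(u, v, w). g (u, v)) (\<lambda>(u, v, w). g (v, w))"
proof -
  let ?c1 = "Cov UVW (\<lambda>(u, v, w). g (u, u)) (\<lambda>(u, v, w). g (u, u))"
  let ?c2 = "Cov UVW (\<lambda>(u, v, w). g (u, v)) (\<lambda>(u, v, w). g (u, v))"
  let ?c3 = "Cov UVW (\<lambda>(u, v, w). g (u, v)) (\<lambda>(u, v, w). g (v, u))"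
  let ?c4 = "Cov UVW (\<lambda>(u, v, w). g (u, v)) (\<lambda>(u, v, w). g (v, w))"
  let ?A = "{i \<in> {1..n}. \<sigma> i = i}"
  let ?B = "{i \<in> {1..n}. \<sigma> i \<noteq> i \<and> \<sigma> (\<sigma> i) = i}"
  let ?C = "{i \<in> {1..n}. \<sigma> i \<noteq> i \<and> \<sigma> (\<sigma> i) \<noteq> i}"
  let ?cv = "\<lambda>i j. Cov P (\<lambda>U. g (pt \<sigma> U i)) (\<lambda>U. g (pt \<sigma> U j))"
  have \<sigma>I: "\<sigma> i \<in> {1..n}" "inv \<sigma> i \<in> {1..n}" if "i \<in> {1..n}" for i
    using that permutes_in_image[OF perm, of i] permutes_in_image[OF permutes_inv[OF perm], of i] by auto
  have inv1: "\<sigma> (inv \<sigma> i) = i" "inv \<sigma> (\<sigma> i) = i" for i using permutes_inverses[OF perm] by auto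
  have c1: "?cv i i = ?c1" if "i \<in> {1..n}" "\<sigma> i = i" for i
    unfolding Cov_def pt_def that(2) using that(1)
    by (simp add: expectation_coord1[of i "\<lambda>u. g (u, u)"] expectation_coord1[of i "\<lambda>u. (g (u, u) - c) * (g (u, u) - c)" for c]
        split_def)
  have c2: "?cv i i = ?c2" if "i \<in> {1..n}" "\<sigma> i \<noteq> i" for i
    unfolding Cov_def pt_def using that \<sigma>I[of i]
    by (simp add: expectation_coord2[of i "\<sigma> i" g] expectation_coord2[of i "\<sigma> i" "\<lambda>z. (g z - c) * (g z - c)" for c]
        split_def)
  have c3: "?cv i (\<sigma> i) = ?c3" if "i \<in> {1..n}" "\<sigma> i \<noteq> i" "\<sigma> (\<sigma> i) = i" for i
  proof -
    have d: "i \<in> {1..n}" "\<sigma> i \<in> {1..n}" "i \<noteq> \<sigma> i" using that \<sigma>I by auto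
    note E = expectation_coord2[OF d]
    show ?thesis
      unfolding Cov_def pt_def that(3)
      using E[of g] E[of "\<lambda>z. g (snd z, fst z)"] E[of "\<lambda>z. (g z - c) * (g (snd z, fst z) - d)" for c d]
      by (simp add: split_def)
  qed
  have c4: "?cv i (\<sigma> i) = ?c4" if "i \<in> {1..n}" "\<sigma> i \<noteq> i" "\<sigma> (\<sigma> i) \<noteq> i" for i
  proof -
    have d: "i \<in> {1..n}" "\<sigma> i \<in> {1..n}" "\<sigma> (\<sigma> i) \<in> {1..n}" "i \<noteq> \<sigma> i" "i \<noteq> \<sigma> (\<sigma> i)" "\<sigma> i \<noteq> \<sigma> (\<sigma> i)"
      using that \<sigma>I permutes_inj[OF perm] by (auto simp: inj_eq)
    note E = expectation_coord3[OF d]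
    show ?thesis
      unfolding Cov_def pt_def
      using E[of "\<lambda>z. g (fst z, fst (snd z))"] E[of "\<lambda>z. g (snd z)"]
        E[of "\<lambda>z. (g (fst z, fst (snd z)) - c) * (g (snd z) - d)" for c d]
      by (simp add: split_def)
  qed
  have A: "(\<Sum>j\<in>nb i. ?cv i j) = ?c1" if "i \<in> ?A" for i
  proof -
    have "inv \<sigma> i = i" using that inv1(2)[of i] by simp
    then have "nb i = {i}" using that nb_eq[of i] by auto
    then show ?thesis using c1[of i] that by simp
  qed
  have B: "(\<Sum>j\<in>nb i. ?cv i j) = ?c2 + ?c3" if "i \<in> ?B" for i
  proof -
    have "inv \<sigma> i = \<sigma> i" using that inv1(2)[of "\<sigma> i"] by simp
    then have "nb i = {i, \<sigma> i}" using that nb_eq[of i] by auto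
    then show ?thesis using c2[of i] c3[of i] that by simp
  qed
  have C: "(\<Sum>j\<in>nb i. ?cv i j) = ?c2 + 2 * ?c4" if i: "i \<in> ?C" for i
  proof -
    have ne: "\<sigma> i \<noteq> i" "\<sigma> (\<sigma> i) \<noteq> i" using i by auto
    have d1: "i \<noteq> inv \<sigma> i" using ne(1) inv1(1)[of i] by metis
    have d2: "\<sigma> i \<noteq> inv \<sigma> i" using ne(2) inv1(1)[of i] by metis
    have d: "i \<noteq> \<sigma> i" "i \<noteq> inv \<sigma> i" "\<sigma> i \<noteq> inv \<sigma> i" "\<sigma> (inv \<sigma> i) \<noteq> inv \<sigma> i" "\<sigma> (\<sigma> (inv \<sigma> i)) \<noteq> inv \<sigma> i"
      using ne d1 d2 inv1(1)[of i] by simp_all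
    have "?cv i (inv \<sigma> i) = ?c4"
      using c4[of "inv \<sigma> i"] \<sigma>I(2)[of i] i d by (simp add: inv1 Cov_commute)
    then show ?thesis
      using nb_eq[of i] c2[of i] c4[of i] i d by (simp add: Cov_commute)
  qed
  have un: "{1..n} = ?A \<union> (?B \<union> ?C)" by auto
  have cards: "card ?A + (card ?B + card ?C) = n"
  proof -
    have "card {1..n} = card (?A \<union> (?B \<union> ?C))" by (rule arg_cong[OF un])
    also have "\<dots> = card ?A + card (?B \<union> ?C)" by (rule card_Un_disjoint) auto
    also have "card (?B \<union> ?C) = card ?B + card ?C" by (rule card_Un_disjoint) auto
    finally show ?thesis by simp
  qed
  then have cC: "real (card ?C) = real n - real t1 - real t2"
    unfolding t1_def t2_def by linarith
  define F where "F i = (\<Sum>j\<in>nb i. ?cv i j)" for i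
  have "vsum g = sum F (?A \<union> (?B \<union> ?C))" unfolding vsum_def F_def by (rule sum.cong[OF un refl])
  also have "\<dots> = sum F ?A + (sum F ?B + sum F ?C)"
    by (subst sum.union_disjoint, simp, simp, fastforce)+ simp
  also have "sum F ?A = real t1 * ?c1" using A unfolding F_def t1_def by simp
  also have "sum F ?B = real t2 * (?c2 + ?c3)" using B unfolding F_def t2_def by simp
  also have "sum F ?C = real (card ?C) * (?c2 + 2 * ?c4)" using C unfolding F_def by simp
  finally have V: "vsum g = real t1 * ?c1 + (real t2 * (?c2 + ?c3) + (real n - real t1 - real t2) * (?c2 + 2 * ?c4))"
    unfolding cC .
  have "a * x + (b * (y + z) + (m - a - b) * (y + 2 * w)) = a * x + (m - a) * y + b * z + 2 * (m - a - b) * w"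
    for a b m x y z w :: real by (simp add: algebra_simps)
  then show ?thesis unfolding V .
qed

text \<open>\<open>local_dependence_clt\<close> with neighbourhoods of size at most \<open>3\<close>
  and summands bounded by \<open>2 * s * G\<close>, each being \<open>s\<close> times a centred
  value of \<open>g\<close>; the constant is \<open>4 * 3^2 = 36\<close>.\<close>

lemma sum_clt:
  assumes g[measurable]: "g \<in> borel_measurable borel" and G: "\<And>z. \<bar>g z\<bar> \<le> G" and s: "s \<ge> 0"
  shows "s\<^sup>2 * vsum g \<ge> 0"
    "cmod (P.expectation (\<lambda>U. iexp (s * (\<Sum>i\<in>{1..n}. g (pt \<sigma> U i) - (\<integral>z. g z \<partial>law i)))) - exp (- of_real (s\<^sup>2 * vsum g / 2)))
     \<le> 36 * real n * (s * (2 * G)) ^ 3"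
proof -
  define X where "X i U = s * (g (pt \<sigma> U i) - (\<integral>z. g z \<partial>law i))" for i U
  have G0: "G \<ge> 0" using G[of undefined] by linarith
  have mean: "P.expectation (\<lambda>U. g (pt \<sigma> U i)) = (\<integral>z. g z \<partial>law i)" if "i \<in> {1..n}" for i
    unfolding law_def using that by (subst integral_distr) auto
  have Xm: "X i \<in> borel_measurable (PiM A (\<lambda>_. borel))" if "edge i \<subseteq> A" for i A
    unfolding X_def using measurable_compose[OF measurable_pt[OF that] g] by simp
  have XmP[measurable]: "X i \<in> borel_measurable P" if "i \<in> {1..n}" for i
    using Xm[OF edge_sub[OF that]] by (simp add: measurable_cong_sets[OF sets_P refl])
  have law_b: "\<bar>\<integral>z. g z \<partial>law i\<bar> \<le> G" if "i \<in> {1..n}" for i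
  proof -
    interpret prob_space "law i" by (rule prob_space_law[OF that])
    show ?thesis using norm_expectation_le[of g G] G by simp
  qed
  have Xb: "\<bar>X i U\<bar> \<le> s * (2 * G)" if "i \<in> {1..n}" for i U
    unfolding X_def abs_mult using s G[of "pt \<sigma> U i"] law_b[OF that] by (intro mult_mono) auto
  have Xr: "X i (restrict U A) = X i U" if "edge i \<subseteq> A" for i U A
    unfolding X_def pt_restrict[OF that] ..
  have EX: "P.expectation (X i) = 0" if i: "i \<in> {1..n}" for i
  proof -
    have "integrable P (\<lambda>U. g (pt \<sigma> U i))"
      using i G by (intro P.bounded_integrable[of _ G]) auto
    then show ?thesis unfolding X_def using mean[OF i] by (simp add: P.prob_space)
  qed
  have sub: "nb i \<subseteq> {1..n}" for i by (auto simp: nb_def)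
  have EXX: "P.expectation (\<lambda>U. X i U * X j U) = s\<^sup>2 * Cov P (\<lambda>U. g (pt \<sigma> U i)) (\<lambda>U. g (pt \<sigma> U j))"
    if "i \<in> {1..n}" "j \<in> {1..n}" for i j
  proof -
    have "(\<lambda>U. X i U * X j U) = (\<lambda>U. s\<^sup>2 * ((g (pt \<sigma> U i) - (\<integral>z. g z \<partial>law i)) * (g (pt \<sigma> U j) - (\<integral>z. g z \<partial>law j))))"
      by (simp add: X_def power2_eq_square mult_ac)
    then show ?thesis unfolding Cov_def mean[OF that(1)] mean[OF that(2)] by simp
  qed
  define S where "S A U = (\<Sum>l\<in>A. X l U)" for A U
  have Sm: "S A \<in> borel_measurable (PiM B (\<lambda>_. borel))" if "\<And>l. l \<in> A \<Longrightarrow> edge l \<subseteq> B" for A B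
    unfolding S_def using that by (intro borel_measurable_sum Xm) auto
  have Sr: "S A (restrict U B) = S A U" if "\<And>l. l \<in> A \<Longrightarrow> edge l \<subseteq> B" for A B U
    unfolding S_def using that by (intro sum.cong refl Xr) auto
  have h1: "P.expectation (\<lambda>U. of_real (X i U) * iexp (t * S ({1..n} - nb i) U)) = 0" if i: "i \<in> {1..n}" for i t
  proof -
    let ?B = "{1..n} - edge i"
    have e: "edge l \<subseteq> ?B" if "l \<in> {1..n} - nb i" for l
      using that edge_sub[of l] by (auto simp: nb_def)
    have Sm': "S ({1..n} - nb i) \<in> borel_measurable (PiM ?B (\<lambda>_. borel))" by (rule Sm[OF e])
    have Sr': "S ({1..n} - nb i) (restrict U ?B) = S ({1..n} - nb i) U" for U by (rule Sr[OF e])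
    have "P.expectation (\<lambda>U. complex_of_real (X i U) * iexp (t * S ({1..n} - nb i) U))
      = P.expectation (\<lambda>U. complex_of_real (X i U)) * P.expectation (\<lambda>U. iexp (t * S ({1..n} - nb i) U))"
      using edge_sub[OF i] Xm[OF order_refl, of i] Sm' Xb[OF i] Xr[OF order_refl, of i] Sr'
      by (intro expectation_mult_disjoint[of "edge i" ?B _ _ "s * (2 * G)" 1]) auto
    then show ?thesis using EX[OF i] by simp
  qed
  have h2: "P.expectation (\<lambda>U. of_real (X i U * X j U) * iexp (t * S ({1..n} - (nb i \<union> nb j)) U))
      = of_real (P.expectation (\<lambda>U. X i U * X j U)) * P.expectation (\<lambda>U. iexp (t * S ({1..n} - (nb i \<union> nb j)) U))"
    if i: "i \<in> {1..n}" and j: "j \<in> nb i" for i j t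
  proof -
    have jn: "j \<in> {1..n}" using j by (auto simp: nb_def)
    let ?A = "edge i \<union> edge j"
    let ?B = "{1..n} - ?A"
    have e: "edge l \<subseteq> ?B" if "l \<in> {1..n} - (nb i \<union> nb j)" for l
      using that edge_sub[of l] by (auto simp: nb_def)
    have sq: "\<bar>X i U * X j U\<bar> \<le> (s * (2 * G))\<^sup>2" for U
      unfolding abs_mult power2_eq_square using Xb[OF i] Xb[OF jn] s G0 by (intro mult_mono) auto
    have Sm': "S ({1..n} - (nb i \<union> nb j)) \<in> borel_measurable (PiM ?B (\<lambda>_. borel))" by (rule Sm[OF e])
    have Sr': "S ({1..n} - (nb i \<union> nb j)) (restrict U ?B) = S ({1..n} - (nb i \<union> nb j)) U" for U by (rule Sr[OF e])
    have "P.expectation (\<lambda>U. complex_of_real (X i U * X j U) * iexp (t * S ({1..n} - (nb i \<union> nb j)) U))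
      = P.expectation (\<lambda>U. complex_of_real (X i U * X j U)) * P.expectation (\<lambda>U. iexp (t * S ({1..n} - (nb i \<union> nb j)) U))"
      using edge_sub[OF i] edge_sub[OF jn] Xm[of i ?A] Xm[of j ?A] Sm' sq Xr[of i ?A] Xr[of j ?A] Sr'
      by (intro expectation_mult_disjoint[of ?A ?B _ _ "(s * (2 * G))\<^sup>2" 1]) (auto simp: norm_mult abs_mult simp del: of_real_mult)
    then show ?thesis by (simp del: of_real_mult)
  qed
  have var: "(\<Sum>i\<in>{1..n}. \<Sum>j\<in>nb i. P.expectation (\<lambda>U. X i U * X j U)) = s\<^sup>2 * vsum g"
    unfolding vsum_def sum_distrib_left by (intro sum.cong refl EXX) (auto dest: subsetD[OF sub])
  have unc: "P.expectation (\<lambda>U. X i U * X j U) = 0" if "i \<in> {1..n}" "j \<in> {1..n}" "j \<notin> nb i" for i j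
  proof -
    have "P.expectation (\<lambda>U. X i U * X j U) = P.expectation (X i) * P.expectation (X j)"
      using that edge_sub Xm[OF order_refl] Xb Xr[OF order_refl]
      by (intro expectation_mult_disjoint[of "edge i" "edge j" _ _ "s * (2 * G)" "s * (2 * G)"]) (auto simp: nb_def)
    then show ?thesis using EX[OF that(1)] by simp
  qed
  \<comment> \<open>Adding the uncorrelated pairs, which contribute zero, turns the local sum into a
    full double sum and hence into a second moment.\<close>
  show ss: "s\<^sup>2 * vsum g \<ge> 0"
  proof -
    have i: "integrable P (\<lambda>U. X i U * X j U)" if "i \<in> {1..n}" "j \<in> {1..n}" for i j
    proof (rule P.bounded_integrable)
      show "norm (X i U * X j U) \<le> (s * (2 * G)) * (s * (2 * G))" for U
        unfolding real_norm_def abs_mult using Xb[OF that(1)] Xb[OF that(2)] s G0 by (intro mult_mono) auto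
    qed (use that in measurable)
    have "s\<^sup>2 * vsum g = (\<Sum>i\<in>{1..n}. \<Sum>j\<in>{1..n}. P.expectation (\<lambda>U. X i U * X j U))"
      unfolding var[symmetric] using sub unc by (intro sum.cong refl sum.mono_neutral_left) auto
    also have "\<dots> = P.expectation (\<lambda>U. \<Sum>i\<in>{1..n}. \<Sum>j\<in>{1..n}. X i U * X j U)"
      by (subst Bochner_Integration.integral_sum, intro Bochner_Integration.integrable_sum i, assumption+,
          intro sum.cong refl Bochner_Integration.integral_sum[symmetric] i, assumption+)
    also have "\<dots> = P.expectation (\<lambda>U. (\<Sum>i\<in>{1..n}. X i U)\<^sup>2)"
      by (simp add: power2_eq_square sum_product)
    also have "\<dots> \<ge> 0" by simp
    finally show ?thesis .
  qed
  have "cmod (P.expectation (\<lambda>U. iexp (\<Sum>i\<in>{1..n}. X i U)) - exp (- of_real (s\<^sup>2 * vsum g / 2)))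
    \<le> 4 * real (card {1..n}) * (real 3)\<^sup>2 * (s * (2 * G)) ^ 3"
    using s G0 Xb sub card_nb h1[unfolded S_def] h2[unfolded S_def] var ss
    by (intro P.local_dependence_clt[where N=nb]) auto
  then show "cmod (P.expectation (\<lambda>U. iexp (s * (\<Sum>i\<in>{1..n}. g (pt \<sigma> U i) - (\<integral>z. g z \<partial>law i)))) - exp (- of_real (s\<^sup>2 * vsum g / 2)))
     \<le> 36 * real n * (s * (2 * G)) ^ 3"
    by (simp add: X_def sum_distrib_left)
qed

end

section \<open>Patterns of planar points\<close>

text \<open>Turns counting in the image set into counting over indices. Where \<open>x\<close> is
  not injective both sides fail: the image has fewer than \<open>r\<close> points, and two indices
  share a first coordinate.\<close>

lemma is_Perm_image_iff:
  assumes A: "finite A" "card A = r"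
  shows "is_Perm r (x ` A) \<pi> \<longleftrightarrow> \<pi> \<in> perms r \<and> inj_on (\<lambda>i. fst (x i)) A \<and> inj_on (\<lambda>i. snd (x i)) A \<and>
    (\<forall>i\<in>A. \<pi> (card {j \<in> A. fst (x j) \<le> fst (x i)}) = card {j \<in> A. snd (x j) \<le> snd (x i)})"
proof (cases "inj_on x A")
  case True
  have c: "card {w \<in> x ` A. Q w} = card {j \<in> A. Q (x j)}" for Q
  proof -
    have "{w \<in> x ` A. Q w} = x ` {j \<in> A. Q (x j)}" by auto
    then show ?thesis using card_image[OF inj_on_subset[OF True, of "{j \<in> A. Q (x j)}"]] by auto
  qed
  have "inj_on fst (x ` A) \<longleftrightarrow> inj_on (\<lambda>i. fst (x i)) A" "inj_on snd (x ` A) \<longleftrightarrow> inj_on (\<lambda>i. snd (x i)) A"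
    using comp_inj_on_iff[OF True] by (simp_all add: o_def)
  then show ?thesis
    unfolding is_Perm_def c using A True by (auto simp: card_image)
next
  case False
  then have "card (x ` A) \<noteq> r" using A eq_card_imp_inj_on[of A x] by auto
  moreover have "\<not> inj_on (\<lambda>i. fst (x i)) A" using False unfolding inj_on_def by metis
  ultimately show ?thesis by (auto simp: is_Perm_def)
qed

text \<open>A function of the set of points only, hence symmetric in its slots; this is why the
  projections at all slots turn out to be \<open>psi\<close>. Tuples with a repeated point get the
  value \<open>0\<close>.\<close>

definition perm_ind :: "nat \<Rightarrow> (nat \<Rightarrow> nat) \<Rightarrow> (nat \<Rightarrow> real \<times> real) \<Rightarrow> real" where
  "perm_ind r \<pi> x = of_bool (is_Perm r (x ` {1..r}) \<pi>)"

lemma perm_ind_measurable: "perm_ind r \<pi> \<in> borel_measurable (PiM {1..r} (\<lambda>_. borel))"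
proof -
  have comp[measurable]: "(\<lambda>x. fst (x i)) \<in> borel_measurable (PiM {1..r} (\<lambda>_. borel :: (real \<times> real) measure))"
    "(\<lambda>x. snd (x i)) \<in> borel_measurable (PiM {1..r} (\<lambda>_. borel :: (real \<times> real) measure))" if "i \<in> {1..r}" for i
    using measurable_compose[OF measurable_component_singleton[OF that] borel_measurable_fst_prod]
      measurable_compose[OF measurable_component_singleton[OF that] borel_measurable_snd_prod] by auto
  have card_m: "Measurable.pred (PiM {1..r} (\<lambda>_. borel :: (real \<times> real) measure)) (\<lambda>x. card {j \<in> {1..r}. f (x j) \<le> f (x i)} = a)"
    if i: "i \<in> {1..r}" and f: "\<And>i. i \<in> {1..r} \<Longrightarrow> (\<lambda>x. f (x i)) \<in> borel_measurable (PiM {1..r} (\<lambda>_. borel :: (real \<times> real) measure))"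
    for i a and f :: "real \<times> real \<Rightarrow> real"
  proof -
    have "real (card {j \<in> {1..r}. f (x j) \<le> f (x i)}) = (\<Sum>j\<in>{1..r}. of_bool (f (x j) \<le> f (x i)))" for x :: "nat \<Rightarrow> real \<times> real"
      by (simp add: sum_of_bool_eq Int_def)
    then have eq: "card {j \<in> {1..r}. f (x j) \<le> f (x i)} = a \<longleftrightarrow> (\<Sum>j\<in>{1..r}. of_bool (f (x j) \<le> f (x i))) = real a"
      for x :: "nat \<Rightarrow> real \<times> real"
      using of_nat_eq_iff[where 'a=real] by simp
    have "(\<lambda>x. \<Sum>j\<in>{1..r}. of_bool (f (x j) \<le> f (x i)) :: real) \<in> borel_measurable (PiM {1..r} (\<lambda>_. borel :: (real \<times> real) measure))"
    proof (intro borel_measurable_sum)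
      fix j assume j: "j \<in> {1..r}"
      have "Measurable.pred (PiM {1..r} (\<lambda>_. borel :: (real \<times> real) measure)) (\<lambda>x. f (x j) \<le> f (x i))"
        unfolding pred_def by (rule borel_measurable_le[OF f[OF j] f[OF i]])
      then show "(\<lambda>x. of_bool (f (x j) \<le> f (x i)) :: real) \<in> borel_measurable (PiM {1..r} (\<lambda>_. borel :: (real \<times> real) measure))"
        by measurable
    qed
    then show ?thesis unfolding eq by measurable
  qed
  have ne: "Measurable.pred (PiM {1..r} (\<lambda>_. borel :: (real \<times> real) measure)) (\<lambda>x. fst (x i) \<noteq> fst (x j))"
    "Measurable.pred (PiM {1..r} (\<lambda>_. borel :: (real \<times> real) measure)) (\<lambda>x. snd (x i) \<noteq> snd (x j))"
    if "i \<in> {1..r}" "j \<in> {1..r}" for i j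
    unfolding pred_def by (intro borel_measurable_neq comp that)+
  \<comment> \<open>The value of \<open>\<pi>\<close> at a varying cardinality is resolved by a
    finite case split over that cardinality, which leaves finite combinations of comparison
    events.\<close>
  have eqP: "(\<lambda>x. is_Perm r (x ` {1..r}) \<pi>) = (\<lambda>x. \<pi> \<in> perms r
      \<and> (\<forall>i\<in>{1..r}. \<forall>j\<in>{1..r}. i \<noteq> j \<longrightarrow> fst (x i) \<noteq> fst (x j))
      \<and> (\<forall>i\<in>{1..r}. \<forall>j\<in>{1..r}. i \<noteq> j \<longrightarrow> snd (x i) \<noteq> snd (x j))
      \<and> (\<forall>i\<in>{1..r}. \<exists>a\<in>{0..r}. card {j \<in> {1..r}. fst (x j) \<le> fst (x i)} = a \<and> card {j \<in> {1..r}. snd (x j) \<le> snd (x i)} = \<pi> a))"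
    (is "_ = ?P")
  proof
    fix x :: "nat \<Rightarrow> real \<times> real"
    have cr: "card {1..r} = r" by simp
    have le: "card {j \<in> {1..r}. fst (x j) \<le> fst (x i)} \<le> r" for i
      by (rule order_trans[OF card_mono[of "{1..r}"]]) auto
    have 1: "inj_on (\<lambda>i. f (x i)) {1..r} \<longleftrightarrow> (\<forall>i\<in>{1..r}. \<forall>j\<in>{1..r}. i \<noteq> j \<longrightarrow> f (x i) \<noteq> f (x j))"
      for f :: "real \<times> real \<Rightarrow> real" unfolding inj_on_def by blast
    have 2: "(\<pi> c = d) = (\<exists>a\<in>{0..r}. c = a \<and> d = \<pi> a)" if "c \<le> r" for c d :: nat
      using that by auto
    show "is_Perm r (x ` {1..r}) \<pi> = ?P x"
      unfolding is_Perm_image_iff[OF finite_atLeastAtMost cr] 1 2[OF le] ..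
  qed
  have "Measurable.pred (PiM {1..r} (\<lambda>_. borel)) (\<lambda>x. is_Perm r (x ` {1..r}) \<pi>)"
    unfolding eqP
    by (intro pred_intros_conj1' pred_intros_logic(3) pred_intros_finite(3,4) pred_intros_imp' ne card_m comp finite_atLeastAtMost)
  then show ?thesis unfolding perm_ind_def[abs_def] by measurable
qed

lemma perm_ind_bound: "\<bar>perm_ind r \<pi> x\<bar> \<le> 1"
  by (simp add: perm_ind_def)

section \<open>Relative order, ranks and pattern occurrences\<close>

lemma permutes_card_le:
  assumes "\<pi> permutes {1..r}" "j \<in> {1..r}"
  shows "card {k \<in> {1..r}. \<pi> k \<le> \<pi> j} = \<pi> j"
proof -
  have eq: "\<pi> ` {k \<in> {1..r}. \<pi> k \<le> \<pi> j} = {1..\<pi> j}"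
  proof
    show "{1..\<pi> j} \<subseteq> \<pi> ` {k \<in> {1..r}. \<pi> k \<le> \<pi> j}"
    proof
      fix m assume m: "m \<in> {1..\<pi> j}"
      then have "m \<in> {1..r}" using permutes_in_image[OF assms(1), of j] assms(2) by auto
      then have "inv \<pi> m \<in> {1..r}" using permutes_in_image[OF permutes_inv[OF assms(1)], of m] by auto
      then show "m \<in> \<pi> ` {k \<in> {1..r}. \<pi> k \<le> \<pi> j}"
        using m permutes_inverses(1)[OF assms(1), of m] by (intro image_eqI[of _ _ "inv \<pi> m"]) auto
    qed
    show "\<pi> ` {k \<in> {1..r}. \<pi> k \<le> \<pi> j} \<subseteq> {1..\<pi> j}"
    proof
      fix m assume "m \<in> \<pi> ` {k \<in> {1..r}. \<pi> k \<le> \<pi> j}"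
      then obtain k where k: "k \<in> {1..r}" "\<pi> k \<le> \<pi> j" "m = \<pi> k" by blast
      have "\<pi> k \<in> {1..r}" using permutes_in_image[OF assms(1)] k(1) by blast
      then show "m \<in> {1..\<pi> j}" using k by simp
    qed
  qed
  have "card (\<pi> ` {k \<in> {1..r}. \<pi> k \<le> \<pi> j}) = card {k \<in> {1..r}. \<pi> k \<le> \<pi> j}"
    by (rule card_image[OF permutes_inj_on[OF assms(1)]])
  then show ?thesis unfolding eq by simp
qed

lemma card_le_iff:
  fixes f :: "'a \<Rightarrow> 'b::linorder"
  assumes "finite A" "i \<in> A" "j \<in> A"
  shows "card {k \<in> A. f k \<le> f i} < card {k \<in> A. f k \<le> f j} \<longleftrightarrow> f i < f j"
proof
  assume "f i < f j"
  then have "{k \<in> A. f k \<le> f i} \<subseteq> {k \<in> A. f k \<le> f j}" "j \<in> {k \<in> A. f k \<le> f j}" "j \<notin> {k \<in> A. f k \<le> f i}"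
    using assms by auto
  then have "{k \<in> A. f k \<le> f i} \<subset> {k \<in> A. f k \<le> f j}" by blast
  then show "card {k \<in> A. f k \<le> f i} < card {k \<in> A. f k \<le> f j}" using assms by (intro psubset_card_mono) auto
next
  assume l: "card {k \<in> A. f k \<le> f i} < card {k \<in> A. f k \<le> f j}"
  show "f i < f j"
  proof (rule ccontr)
    assume "\<not> f i < f j"
    then have "{k \<in> A. f k \<le> f j} \<subseteq> {k \<in> A. f k \<le> f i}" by auto
    then have "card {k \<in> A. f k \<le> f j} \<le> card {k \<in> A. f k \<le> f i}" using assms by (intro card_mono) auto
    with l show False by simp
  qed
qed

text \<open>A permutation is its own rank function, and ranks are determined by pairwise
  comparisons. So \<open>\<pi>\<close> orders positions as \<open>T\<close> orders \<open>S\<close>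
  exactly when \<open>\<pi> j\<close> is the rank of \<open>T\<close> at the \<open>j\<close>-th
  smallest element, which is what \<open>is_Perm\<close> says of the graph of \<open>T\<close> over
  \<open>S\<close>.\<close>

lemma pattern_iff_is_Perm:
  assumes S: "finite S" "card S = r" and \<pi>: "\<pi> \<in> perms r" and T: "inj_on T S"
  shows "(\<forall>j\<in>{1..r}. \<forall>k\<in>{1..r}. \<pi> j > \<pi> k \<longleftrightarrow>
      T (sorted_list_of_set S ! (j - 1)) > (T (sorted_list_of_set S ! (k - 1)) :: nat))
    \<longleftrightarrow> is_Perm r ((\<lambda>s. (real s, real (T s))) ` S) \<pi>"
proof -
  define s where "s j = sorted_list_of_set S ! (j - 1)" for j
  have len: "length (sorted_list_of_set S) = r" using S by simp
  have mono: "s j < s k" if "j \<in> {1..r}" "k \<in> {1..r}" "j < k" for j k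
    unfolding s_def using that len strict_sorted_list_of_set[of S]
    by (intro sorted_wrt_nth_less[of "(<)"]) auto
  have mono_iff: "s j \<le> s k \<longleftrightarrow> j \<le> k" if "j \<in> {1..r}" "k \<in> {1..r}" for j k
    using mono[OF that] mono[OF that(2,1)] by (cases j k rule: linorder_cases) auto
  have inj: "inj_on s {1..r}"
  proof (rule inj_onI)
    fix j k assume jk: "j \<in> {1..r}" "k \<in> {1..r}" "s j = s k"
    show "j = k" using mono_iff[OF jk(1,2)] mono_iff[OF jk(2,1)] jk(3) by simp
  qed
  have img: "s ` {1..r} = S"
  proof -
    have "{1..r} = Suc ` {0..<r}" by (simp add: atLeastLessThanSuc_atLeastAtMost)
    then have "s ` {1..r} = s ` (Suc ` {0..<r})" by (rule arg_cong)
    also have "\<dots> = (\<lambda>i. sorted_list_of_set S ! i) ` {0..<r}"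
      unfolding image_image s_def by simp
    also have "\<dots> = set (sorted_list_of_set S)"
      using nth_image[of r "sorted_list_of_set S"] len by simp
    finally show ?thesis using S by simp
  qed
  have cS: "card {w \<in> S. Q w} = card {k \<in> {1..r}. Q (s k)}" for Q
  proof -
    have "{w \<in> S. Q w} = s ` {k \<in> {1..r}. Q (s k)}" using img by auto
    moreover have "{k \<in> {1..r}. Q (s k)} \<subseteq> {1..r}" by auto
    ultimately show ?thesis using card_image[OF inj_on_subset[OF inj]] by metis
  qed
  have bS: "(\<forall>w\<in>S. Q w) \<longleftrightarrow> (\<forall>j\<in>{1..r}. Q (s j))" for Q using img by blast
  have c1: "card {k \<in> {1..r}. s k \<le> s j} = j" if "j \<in> {1..r}" for j
  proof -
    have "{k \<in> {1..r}. s k \<le> s j} = {1..j}" using mono_iff that by auto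
    then show ?thesis by simp
  qed
  have p: "\<pi> permutes {1..r}" using \<pi> by (simp add: perms_def)
  have inj1: "inj_on (\<lambda>i. real i) S" "inj_on (\<lambda>i. real (T i)) S" using T by (auto simp: inj_on_def)
  have "is_Perm r ((\<lambda>s. (real s, real (T s))) ` S) \<pi> \<longleftrightarrow> (\<forall>w\<in>S. \<pi> (card {v \<in> S. v \<le> w}) = card {v \<in> S. T v \<le> T w})"
    using \<pi> inj1 by (subst is_Perm_image_iff[OF S]) simp
  also have "\<dots> \<longleftrightarrow> (\<forall>j\<in>{1..r}. \<pi> j = card {k \<in> {1..r}. T (s k) \<le> T (s j)})"
    unfolding bS cS by (intro ball_cong refl) (simp only: c1)
  also have "\<dots> \<longleftrightarrow> (\<forall>j\<in>{1..r}. \<forall>k\<in>{1..r}. \<pi> j > \<pi> k \<longleftrightarrow> T (s j) > T (s k))"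
  proof
    assume a: "\<forall>j\<in>{1..r}. \<pi> j = card {k \<in> {1..r}. T (s k) \<le> T (s j)}"
    show "\<forall>j\<in>{1..r}. \<forall>k\<in>{1..r}. \<pi> j > \<pi> k \<longleftrightarrow> T (s j) > T (s k)"
      using a card_le_iff[of "{1..r}" _ _ "\<lambda>k. T (s k)"] by simp
  next
    assume a: "\<forall>j\<in>{1..r}. \<forall>k\<in>{1..r}. \<pi> j > \<pi> k \<longleftrightarrow> T (s j) > T (s k)"
    show "\<forall>j\<in>{1..r}. \<pi> j = card {k \<in> {1..r}. T (s k) \<le> T (s j)}"
    proof
      fix j assume j: "j \<in> {1..r}"
      have "{k \<in> {1..r}. T (s k) \<le> T (s j)} = {k \<in> {1..r}. \<pi> k \<le> \<pi> j}"
        using a j by (metis (no_types, lifting) linorder_not_less)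
      then show "\<pi> j = card {k \<in> {1..r}. T (s k) \<le> T (s j)}" using permutes_card_le[OF p j] by simp
    qed
  qed
  finally show ?thesis by (simp add: s_def)
qed

text \<open>The identity outside \<open>{1..n}\<close> is what \<open>permutes\<close> demands. With
  distinct labels this is the relabelling that turns the order of labels into the order of
  integers.\<close>

definition rank :: "nat \<Rightarrow> (nat \<Rightarrow> real) \<Rightarrow> nat \<Rightarrow> nat" where
  "rank n U i = (if i \<in> {1..n} then card {j \<in> {1..n}. U j \<le> U i} else i)"

lemma rank_less_iff: "i \<in> {1..n} \<Longrightarrow> j \<in> {1..n} \<Longrightarrow> rank n U i < rank n U j \<longleftrightarrow> U i < U j"
  using card_le_iff[of "{1..n}" i j U] by (simp add: rank_def)

lemma rank_permutes:
  assumes "inj_on U {1..n}"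
  shows "rank n U permutes {1..n}"
proof (rule bij_imp_permutes)
  have inj: "inj_on (rank n U) {1..n}"
  proof (rule inj_onI)
    fix i j assume ij: "i \<in> {1..n}" "j \<in> {1..n}" "rank n U i = rank n U j"
    then have "U i = U j" using rank_less_iff[of i n j U] rank_less_iff[of j n i U] by linarith
    then show "i = j" using assms ij by (auto dest: inj_onD)
  qed
  have "rank n U ` {1..n} \<subseteq> {1..n}"
  proof
    fix m assume "m \<in> rank n U ` {1..n}"
    then obtain i where i: "i \<in> {1..n}" "m = card {j \<in> {1..n}. U j \<le> U i}" by (auto simp: rank_def)
    have "card {i} \<le> m" unfolding i(2) using i(1) by (intro card_mono) auto
    moreover have "m \<le> card {1..n}" unfolding i(2) by (intro card_mono) auto
    ultimately show "m \<in> {1..n}" by simp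
  qed
  then show "bij_betw (rank n U) {1..n} {1..n}"
    using inj by (simp add: bij_betw_def card_image card_subset_eq endo_inj_surj)
qed (auto simp: rank_def)

text \<open>With \<open>\<rho>\<close> the rank permutation, the conjugate \<open>T\<close> sends
  \<open>\<rho> i\<close> to \<open>\<rho> (\<sigma> i)\<close>. Its graph over
  \<open>\<rho>\<close> I\<open>thus has the same relative order, in both coordinates, as the
  points\<close>(U i, U (\<sigma> i))\<open>with\<close>i\<open>in\<close>I\<open>, and\<close>I
  \<mapsto> \<rho> \<open>I\<close> is a bijection of the candidate sets.\<close>

lemma pattern_count_rank:
  assumes U: "inj_on U {1..n}" and \<sigma>: "\<sigma> permutes {1..n}" and \<pi>: "\<pi> \<in> perms r"
  shows "pattern_count n r \<pi> (rank n U \<circ> \<sigma> \<circ> inv (rank n U))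
    = card {I. I \<subseteq> {1..n} \<and> card I = r \<and> is_Perm r (pt \<sigma> U ` I) \<pi>}"
proof -
  define \<rho> where "\<rho> = rank n U"
  define T where "T = \<rho> \<circ> \<sigma> \<circ> inv \<rho>"
  have \<rho>: "\<rho> permutes {1..n}" unfolding \<rho>_def by (rule rank_permutes[OF U])
  have injT: "inj T" unfolding T_def
    by (intro inj_compose permutes_inj[OF \<rho>] permutes_inj[OF \<sigma>] permutes_inj[OF permutes_inv[OF \<rho>]])
  have T\<rho>: "T (\<rho> i) = \<rho> (\<sigma> i)" for i using permutes_inverses(2)[OF \<rho>] by (simp add: T_def)
  have le: "\<rho> i \<le> \<rho> j \<longleftrightarrow> U i \<le> U j" if "i \<in> {1..n}" "j \<in> {1..n}" for i j
    using rank_less_iff[OF that(2,1), of U] by (simp add: \<rho>_def flip: not_less)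
  have \<sigma>I: "\<sigma> i \<in> {1..n}" if "i \<in> {1..n}" for i using that permutes_in_image[OF \<sigma>] by auto
  have perm_iff: "is_Perm r ((\<lambda>s. (real s, real (T s))) ` (\<rho> ` I)) \<pi> \<longleftrightarrow> is_Perm r (pt \<sigma> U ` I) \<pi>"
    if I: "I \<subseteq> {1..n}" "card I = r" for I
  proof -
    have fI: "finite I" using I by (auto intro: finite_subset)
    have in_n: "i \<in> {1..n}" "\<sigma> i \<in> {1..n}" if "i \<in> I" for i using that I \<sigma>I by auto
    have i1: "inj_on (\<lambda>i. U i) I" using inj_on_subset[OF U I(1)] by simp
    have i2: "inj_on (\<lambda>i. U (\<sigma> i)) I"
      using U permutes_inj[OF \<sigma>] in_n(2) unfolding inj_on_def inj_def by blast
    have i3: "inj_on (\<lambda>i. real (\<rho> i)) I" "inj_on (\<lambda>i. real (\<rho> (\<sigma> i))) I"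
      by (intro inj_onI; simp add: inj_eq[OF permutes_inj[OF \<rho>]] inj_eq[OF permutes_inj[OF \<sigma>]])+
    have e1: "{j \<in> I. \<rho> j \<le> \<rho> i} = {j \<in> I. U j \<le> U i}"
       "{j \<in> I. \<rho> (\<sigma> j) \<le> \<rho> (\<sigma> i)} = {j \<in> I. U (\<sigma> j) \<le> U (\<sigma> i)}" if "i \<in> I" for i
      using le in_n that by blast+
    show ?thesis
      unfolding image_image T\<rho> is_Perm_image_iff[OF fI I(2)]
      using i1 i2 i3 e1 by (simp add: pt_def)
  qed
  have pc: "pattern_count n r \<pi> T = card {S. S \<subseteq> {1..n} \<and> card S = r \<and> is_Perm r ((\<lambda>s. (real s, real (T s))) ` S) \<pi>}"
    unfolding pattern_count_def
  proof (intro arg_cong[where f=card] Collect_cong conj_cong refl)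
    fix S assume "S \<subseteq> {1..n}" "card S = r"
    then show "(\<forall>j\<in>{1..r}. \<forall>k\<in>{1..r}. (\<pi> k < \<pi> j) = (T (sorted_list_of_set S ! (k - 1)) < T (sorted_list_of_set S ! (j - 1))))
      = is_Perm r ((\<lambda>s. (real s, real (T s))) ` S) \<pi>"
      using pattern_iff_is_Perm[of S r \<pi> T] \<pi> inj_on_subset[OF injT] finite_subset[of S "{1..n}"] by auto
  qed
  have img: "(`) \<rho> ` {I. I \<subseteq> {1..n} \<and> card I = r \<and> is_Perm r (pt \<sigma> U ` I) \<pi>}
     = {S. S \<subseteq> {1..n} \<and> card S = r \<and> is_Perm r ((\<lambda>s. (real s, real (T s))) ` S) \<pi>}"
  proof (intro set_eqI iffI)
    fix S assume "S \<in> (`) \<rho> ` {I. I \<subseteq> {1..n} \<and> card I = r \<and> is_Perm r (pt \<sigma> U ` I) \<pi>}"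
    then obtain I where I: "I \<subseteq> {1..n}" "card I = r" "is_Perm r (pt \<sigma> U ` I) \<pi>" "S = \<rho> ` I" by auto
    have "card S = r" unfolding I(4) using I(2) card_image[OF permutes_inj_on[OF \<rho>]] by simp
    moreover have "S \<subseteq> {1..n}" unfolding I(4) using I(1) permutes_image[OF \<rho>] by blast
    ultimately show "S \<in> {S. S \<subseteq> {1..n} \<and> card S = r \<and> is_Perm r ((\<lambda>s. (real s, real (T s))) ` S) \<pi>}"
      using perm_iff[OF I(1,2)] I(3,4) by simp
  next
    fix S assume S: "S \<in> {S. S \<subseteq> {1..n} \<and> card S = r \<and> is_Perm r ((\<lambda>s. (real s, real (T s))) ` S) \<pi>}"
    define I where "I = inv \<rho> ` S"
    have SI: "S = \<rho> ` I" unfolding I_def image_image using permutes_inverses(1)[OF \<rho>] by simp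
    have "card I = r" unfolding I_def using S card_image[OF permutes_inj_on[OF permutes_inv[OF \<rho>]]] by simp
    moreover have "I \<subseteq> {1..n}" unfolding I_def using S permutes_image[OF permutes_inv[OF \<rho>]] by blast
    ultimately show "S \<in> (`) \<rho> ` {I. I \<subseteq> {1..n} \<and> card I = r \<and> is_Perm r (pt \<sigma> U ` I) \<pi>}"
      using perm_iff[of I] S SI by auto
  qed
  have "inj_on ((`) \<rho>) A" for A :: "nat set set"
    using permutes_inj[OF \<rho>] by (simp add: inj_image_eq_iff inj_on_def)
  from card_image[OF this] show ?thesis
    unfolding \<rho>_def[symmetric] T_def[symmetric] pc img[symmetric] .
qed

text \<open>Every occurrence is the image of \<open>r!\<close> injective maps, and a map that is not
  injective contributes nothing because \<open>is_Perm\<close> asks for \<open>r\<close> distinct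
  points.\<close>

lemma sum_perm_ind:
  fixes f :: "nat \<Rightarrow> real \<times> real"
  assumes "finite B"
  shows "(\<Sum>k\<in>{1..r} \<rightarrow>\<^sub>E B. perm_ind r \<pi> (\<lambda>j\<in>{1..r}. f (k j)))
    = fact r * real (card {I. I \<subseteq> B \<and> card I = r \<and> is_Perm r (f ` I) \<pi>})"
proof -
  define \<I> where "\<I> = {I. I \<subseteq> B \<and> card I = r \<and> is_Perm r (f ` I) \<pi>}"
  define K where "K I = {k \<in> {1..r} \<rightarrow>\<^sub>E I. inj_on k {1..r}}" for I :: "nat set"
  have fin: "finite \<I>" using assms by (auto simp: \<I>_def)
  have fin_I: "finite I" "card I = r" if "I \<in> \<I>" for I using that assms by (auto simp: \<I>_def intro: finite_subset)
  have img: "k ` {1..r} = I" if "k \<in> K I" "I \<in> \<I>" for k I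
  proof (rule card_subset_eq)
    show "card (k ` {1..r}) = card I" using that fin_I[OF that(2)] by (simp add: K_def card_image)
  qed (use that fin_I in \<open>auto simp: K_def\<close>)
  have cK: "card (K I) = fact r" if "I \<in> \<I>" for I
    unfolding K_def using card_inj_on_subset_funcset[of "{1..r}" I "{1..r}"] fin_I[OF that]
    by (simp add: fact_prod_rev)
  have "(\<Sum>k\<in>{1..r} \<rightarrow>\<^sub>E B. perm_ind r \<pi> (\<lambda>j\<in>{1..r}. f (k j)))
     = real (card {k \<in> {1..r} \<rightarrow>\<^sub>E B. is_Perm r ((\<lambda>j. f (k j)) ` {1..r}) \<pi>})"
    using finite_PiE[of "{1..r}" "\<lambda>_. B"] assms
    by (simp add: perm_ind_def sum_of_bool_eq Int_def)
  also have "{k \<in> {1..r} \<rightarrow>\<^sub>E B. is_Perm r ((\<lambda>j. f (k j)) ` {1..r}) \<pi>} = (\<Union>I\<in>\<I>. K I)"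
  proof (intro set_eqI iffI)
    fix k assume k: "k \<in> {k \<in> {1..r} \<rightarrow>\<^sub>E B. is_Perm r ((\<lambda>j. f (k j)) ` {1..r}) \<pi>}"
    then have P: "is_Perm r (f ` (k ` {1..r})) \<pi>" by (simp add: image_image)
    have "r = card (f ` (k ` {1..r}))" using P by (simp add: is_Perm_def)
    also have "\<dots> \<le> card (k ` {1..r})" by (intro card_image_le) auto
    finally have "card (k ` {1..r}) = r" using card_image_le[of "{1..r}" k] by simp
    moreover from this have "inj_on k {1..r}" by (intro eq_card_imp_inj_on) auto
    ultimately have "k ` {1..r} \<in> \<I>" "k \<in> K (k ` {1..r})"
      using k P by (auto simp: \<I>_def K_def PiE_def extensional_def)
    then show "k \<in> (\<Union>I\<in>\<I>. K I)" by blast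
  next
    fix k assume "k \<in> (\<Union>I\<in>\<I>. K I)"
    then obtain I where I: "I \<in> \<I>" "k \<in> K I" by auto
    then have "k ` {1..r} = I" using img by simp
    moreover have "(\<lambda>j. f (k j)) ` {1..r} = f ` (k ` {1..r})" by (rule image_image[symmetric])
    ultimately have "is_Perm r ((\<lambda>j. f (k j)) ` {1..r}) \<pi>" using I by (simp add: \<I>_def)
    then show "k \<in> {k \<in> {1..r} \<rightarrow>\<^sub>E B. is_Perm r ((\<lambda>j. f (k j)) ` {1..r}) \<pi>}"
      using I by (auto simp: K_def \<I>_def PiE_def)
  qed
  also have "card (\<Union>I\<in>\<I>. K I) = (\<Sum>I\<in>\<I>. card (K I))"
  proof (rule card_UN_disjoint[OF fin])
    show "\<forall>I\<in>\<I>. finite (K I)"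
    proof
      fix I assume "I \<in> \<I>"
      then have "finite ({1..r} \<rightarrow>\<^sub>E I)" using fin_I by (intro finite_PiE) auto
      then show "finite (K I)" by (rule rev_finite_subset) (auto simp: K_def)
    qed
    show "\<forall>I\<in>\<I>. \<forall>J\<in>\<I>. I \<noteq> J \<longrightarrow> K I \<inter> K J = {}" using img by blast
  qed
  also have "\<dots> = card \<I> * fact r" using cK by simp
  finally show ?thesis unfolding \<I>_def by (simp only: of_nat_mult of_nat_fact mult.commute)
qed

section \<open>The limiting mixture\<close>

lemma sets_Leb_square[measurable_cong, simp]: "sets Leb_square = sets borel"
  by (simp add: Leb_square_def)

text \<open>Agreement on rectangles suffices. The product form is what gives a point with two
  distinct labels the law \<open>Leb_square\<close>.\<close>

lemma Leb_square_eq: "Leb_square = unif \<Otimes>\<^sub>M unif"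
proof -
  interpret prob_space unif by (rule prob_space_unif)
  have sf: "sigma_finite_measure unif" by unfold_locales
  have em: "emeasure lborel ((A :: real set) \<times> (B :: real set)) = emeasure lborel A * emeasure lborel B"
    if "A \<in> sets borel" "B \<in> sets borel" for A B
    unfolding lborel_prod[symmetric] using that by (intro lborel.emeasure_pair_measure_Times) auto
  have one: "emeasure lborel ({0..1::real} \<times> {0..1::real}) = 1" by (subst em) auto
  have Q: "{0..1::real} \<times> {0..1::real} \<in> sets lborel" unfolding lborel_prod[symmetric] by simp
  have "unif \<Otimes>\<^sub>M unif = Leb_square"
  proof (rule pair_measure_eqI[OF sf sf])
    show "sets (unif \<Otimes>\<^sub>M unif) = sets Leb_square"
    proof -
      have "sets (unif \<Otimes>\<^sub>M unif) = sets (borel \<Otimes>\<^sub>M borel :: (real \<times> real) measure)"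
        by (rule sets_pair_measure_cong) auto
      moreover have "sets (borel \<Otimes>\<^sub>M borel :: (real \<times> real) measure) = sets (borel :: (real \<times> real) measure)"
        by (simp only: borel_prod)
      ultimately show ?thesis by (simp only: sets_Leb_square)
    qed
    fix A B assume "A \<in> sets unif" "B \<in> sets unif"
    then have AB[measurable]: "A \<in> sets borel" "B \<in> sets borel" by auto
    have ABl: "A \<times> B \<in> sets lborel" unfolding lborel_prod[symmetric] by simp
    have "emeasure Leb_square (A \<times> B) = emeasure lborel (({0..1} \<times> {0..1}) \<inter> (A \<times> B)) / 1"
      unfolding Leb_square_def using Q ABl by (subst emeasure_uniform_measure) (auto simp: one)
    also have "({0..1} \<times> {0..1}) \<inter> (A \<times> B) = ({0..1} \<inter> A) \<times> ({0..1} \<inter> B)" by auto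
    also have "emeasure lborel (({0..1} \<inter> A) \<times> ({0..1} \<inter> B)) / 1 = emeasure unif A * emeasure unif B"
      unfolding unif_def by (subst em) (auto simp: emeasure_uniform_measure divide_ennreal_def)
    finally show "emeasure unif A * emeasure unif B = emeasure Leb_square (A \<times> B)" ..
  qed
  then show ?thesis ..
qed

lemma prob_space_Leb_square: "prob_space Leb_square"
proof -
  interpret prob_space unif by (rule prob_space_unif)
  interpret pair_prob_space unif unif ..
  show ?thesis unfolding Leb_square_eq by unfold_locales
qed

lemma diag_measurable: "(\<lambda>u :: real. (u, u)) \<in> measurable unif borel"
  by (intro borel_measurable_Pair) auto

lemma sets_Leb_diag[measurable_cong, simp]: "sets Leb_diag = sets borel"
  by (simp add: Leb_diag_def)

lemma prob_space_Leb_diag: "prob_space Leb_diag"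
  unfolding Leb_diag_def by (intro prob_space.prob_space_distr prob_space_unif diag_measurable)

lemma emeasure_mixture:
  assumes A: "A \<in> sets borel" and p: "0 \<le> p" "p \<le> 1"
  shows "emeasure (mixture p) A = ennreal p * emeasure Leb_diag A + ennreal (1 - p) * emeasure Leb_square A"
proof (rule emeasure_measure_of[OF mixture_def])
  show "sets borel \<subseteq> Pow (UNIV :: (real \<times> real) set)" by auto
  show "A \<in> sets (mixture p)" using A sigma_algebra.sigma_sets_eq[OF sets.sigma_algebra_axioms, of borel]
    by (auto simp: mixture_def sets_measure_of)
  show "positive (sets (mixture p)) (\<lambda>A. ennreal p * emeasure Leb_diag A + ennreal (1 - p) * emeasure Leb_square A)"
    by (simp add: positive_def)
  have s: "sets (mixture p) = sets borel"
    using sigma_algebra.sigma_sets_eq[OF sets.sigma_algebra_axioms, of borel] by (simp add: mixture_def sets_measure_of)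
  show "countably_additive (sets (mixture p)) (\<lambda>A. ennreal p * emeasure Leb_diag A + ennreal (1 - p) * emeasure Leb_square A)"
    unfolding s countably_additive_def
  proof safe
    fix A :: "nat \<Rightarrow> (real \<times> real) set" assume A: "range A \<subseteq> sets borel" "disjoint_family A"
    have "(\<Sum>i. ennreal p * emeasure Leb_diag (A i) + ennreal (1 - p) * emeasure Leb_square (A i))
      = (\<Sum>i. ennreal p * emeasure Leb_diag (A i)) + (\<Sum>i. ennreal (1 - p) * emeasure Leb_square (A i))"
      by (rule suminf_add[symmetric]) auto
    also have "\<dots> = ennreal p * emeasure Leb_diag (\<Union> (range A)) + ennreal (1 - p) * emeasure Leb_square (\<Union> (range A))"
      using A by (simp add: suminf_emeasure)
    finally show "(\<Sum>i. ennreal p * emeasure Leb_diag (A i) + ennreal (1 - p) * emeasure Leb_square (A i))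
      = ennreal p * emeasure Leb_diag (\<Union> (range A)) + ennreal (1 - p) * emeasure Leb_square (\<Union> (range A))" .
  qed
qed

lemma sets_mixture[measurable_cong, simp]: "sets (mixture p) = sets borel"
  using sigma_algebra.sigma_sets_eq[OF sets.sigma_algebra_axioms, of borel] by (simp add: mixture_def sets_measure_of)

lemma space_mixture[simp]: "space (mixture p) = UNIV"
  using sets_eq_imp_space_eq[OF sets_mixture] by simp

lemma prob_space_mixture:
  assumes p: "0 \<le> p" "p \<le> 1"
  shows "prob_space (mixture p)"
proof
  have "emeasure Leb_diag UNIV = 1" "emeasure Leb_square UNIV = 1"
    using prob_space.emeasure_space_1[OF prob_space_Leb_diag] prob_space.emeasure_space_1[OF prob_space_Leb_square]
      sets_eq_imp_space_eq[OF sets_Leb_diag] sets_eq_imp_space_eq[OF sets_Leb_square] by auto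
  then show "emeasure (mixture p) (space (mixture p)) = 1"
    using p by (simp add: emeasure_mixture flip: ennreal_plus)
qed

lemma nn_integral_mixture:
  assumes f: "f \<in> borel_measurable borel" and p: "0 \<le> p" "p \<le> 1"
  shows "(\<integral>\<^sup>+z. f z \<partial>mixture p) = ennreal p * (\<integral>\<^sup>+z. f z \<partial>Leb_diag) + ennreal (1 - p) * (\<integral>\<^sup>+z. f z \<partial>Leb_square)"
  using f
proof (induction rule: borel_measurable_induct)
  case (cong f g)
  then have "f = g" by (auto simp: fun_eq_iff)
  with cong show ?case by simp
next
  case (set A)
  then show ?case using p by (simp add: emeasure_mixture)
next
  case (mult u c)
  then show ?case
    by (simp add: nn_integral_cmult distrib_left mult_ac measurable_cong_sets[OF sets_mixture refl]
        measurable_cong_sets[OF sets_Leb_diag refl] measurable_cong_sets[OF sets_Leb_square refl])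
next
  case (add u v)
  then show ?case
    by (simp add: nn_integral_add distrib_left add_ac measurable_cong_sets[OF sets_mixture refl]
        measurable_cong_sets[OF sets_Leb_diag refl] measurable_cong_sets[OF sets_Leb_square refl])
next
  case (seq U)
  have m: "\<And>i. U i \<in> borel_measurable (mixture p)" "\<And>i. U i \<in> borel_measurable Leb_diag" "\<And>i. U i \<in> borel_measurable Leb_square"
    using seq(1) by (simp_all add: measurable_cong_sets[OF sets_mixture refl]
        measurable_cong_sets[OF sets_Leb_diag refl] measurable_cong_sets[OF sets_Leb_square refl])
  have inc: "incseq (\<lambda>i. \<integral>\<^sup>+z. U i z \<partial>N)" for N
    using seq(3) by (auto simp: incseq_def le_fun_def intro!: nn_integral_mono)
  have c: "c * (SUP i. f i) = (SUP i. c * f i)" for c :: ennreal and f :: "nat \<Rightarrow> ennreal"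
    by (rule SUP_mult_left_ennreal)
  have sup: "(\<integral>\<^sup>+z. (SUP i. U i) z \<partial>N) = (SUP i. \<integral>\<^sup>+z. U i z \<partial>N)" if "\<And>i. U i \<in> borel_measurable N" for N
    unfolding SUP_apply by (rule nn_integral_monotone_convergence_SUP[OF seq(3) that])
  have IH: "(\<integral>\<^sup>+z. U i z \<partial>mixture p) = ennreal p * (\<integral>\<^sup>+z. U i z \<partial>Leb_diag) + ennreal (1 - p) * (\<integral>\<^sup>+z. U i z \<partial>Leb_square)" for i
    using seq by blast
  show ?case
    unfolding sup[OF m(1)] sup[OF m(2)] sup[OF m(3)] c
    by (subst ennreal_SUP_add[symmetric]) (use inc IH in \<open>auto simp: incseq_def mult_left_mono\<close>)
qed

text \<open>Adding \<open>C\<close> makes the integrand nonnegative, so that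
  \<open>nn_integral_mixture\<close> applies; boundedness keeps everything finite when passing back
  to reals.\<close>

lemma integral_mixture:
  assumes G: "G \<in> borel_measurable borel" and C: "\<And>z. \<bar>G z\<bar> \<le> (C :: real)" and p: "0 \<le> p" "p \<le> 1"
  shows "(\<integral>z. G z \<partial>mixture p) = p * (\<integral>z. G z \<partial>Leb_diag) + (1 - p) * (\<integral>z. G z \<partial>Leb_square)"
proof -
  have nn: "(\<integral>z. G z + C \<partial>N) = enn2real (\<integral>\<^sup>+z. ennreal (G z + C) \<partial>N)" if "sets N = sets borel" for N :: "(real \<times> real) measure"
  proof (intro integral_eq_nn_integral AE_I2)
    show "(\<lambda>z. G z + C) \<in> borel_measurable N" using G by (simp add: measurable_cong_sets[OF that refl])
    fix z show "0 \<le> G z + C" using C[of z] by linarith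
  qed
  have sh: "(\<integral>z. G z + C \<partial>N) = (\<integral>z. G z \<partial>N) + C" if "sets N = sets borel" "prob_space N" for N :: "(real \<times> real) measure"
  proof -
    interpret prob_space N by fact
    have "integrable N G" using G C by (intro bounded_integrable[of _ C]) (auto simp: measurable_cong_sets[OF that(1) refl])
    then show ?thesis by (simp add: prob_space)
  qed
  have fin: "(\<integral>\<^sup>+z. ennreal (G z + C) \<partial>N) < \<top>" if "sets N = sets borel" "prob_space N" for N :: "(real \<times> real) measure"
  proof -
    interpret prob_space N by fact
    have "(\<integral>\<^sup>+z. ennreal (G z + C) \<partial>N) \<le> (\<integral>\<^sup>+z. ennreal (2 * C) \<partial>N)"
    proof (intro nn_integral_mono ennreal_leI)
      fix z show "G z + C \<le> 2 * C" using C[of z] by linarith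
    qed
    also have "\<dots> = ennreal (2 * C)" by (simp add: emeasure_space_1)
    finally show ?thesis using le_less_trans by force
  qed
  have gm: "(\<lambda>z. ennreal (G z + C)) \<in> borel_measurable borel" using G by simp
  have "(\<integral>z. G z \<partial>mixture p) + C = enn2real (ennreal p * (\<integral>\<^sup>+z. ennreal (G z + C) \<partial>Leb_diag)
      + ennreal (1 - p) * (\<integral>\<^sup>+z. ennreal (G z + C) \<partial>Leb_square))"
    using sh[OF sets_mixture prob_space_mixture[OF p]] nn[OF sets_mixture] nn_integral_mixture[OF gm p] by simp
  also have "\<dots> = p * enn2real (\<integral>\<^sup>+z. ennreal (G z + C) \<partial>Leb_diag) + (1 - p) * enn2real (\<integral>\<^sup>+z. ennreal (G z + C) \<partial>Leb_square)"
    using fin[OF sets_Leb_diag prob_space_Leb_diag] fin[OF sets_Leb_square prob_space_Leb_square] p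
    by (subst enn2real_plus) (auto simp: ennreal_mult_less_top enn2real_mult)
  also have "\<dots> = p * ((\<integral>z. G z \<partial>Leb_diag) + C) + (1 - p) * ((\<integral>z. G z \<partial>Leb_square) + C)"
    using sh[OF sets_Leb_diag prob_space_Leb_diag] nn[OF sets_Leb_diag]
      sh[OF sets_Leb_square prob_space_Leb_square] nn[OF sets_Leb_square] by simp
  finally show ?thesis by (simp add: algebra_simps)
qed

lemma distr_PiM_unif_two:
  assumes "i \<noteq> j" "i \<in> I" "j \<in> I"
  shows "distr (PiM I (\<lambda>_. unif)) borel (\<lambda>U. (U i, U j)) = unif \<Otimes>\<^sub>M unif"
proof -
  have I: "insert i (I - {i}) = I" using assms by auto
  have j: "distr (PiM (I - {i}) (\<lambda>_. unif)) borel (\<lambda>x. x j) = unif"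
    using distr_PiM_component[of "I - {i}" "\<lambda>_. unif" j] prob_space_unif assms by (simp cong: distr_cong)
  have "distr (PiM (insert i (I - {i})) (\<lambda>_. unif)) (borel \<Otimes>\<^sub>M borel) (\<lambda>x. (x i, x j)) = unif \<Otimes>\<^sub>M distr (PiM (I - {i}) (\<lambda>_. unif)) borel (\<lambda>x. x j)"
    using assms by (intro distr_PiM_component_pair) (auto intro!: measurable_component_singleton)
  then show ?thesis unfolding I j borel_prod .
qed

context sample begin

lemma law_fixed:
  assumes i: "i \<in> {1..n}" "\<sigma> i = i"
  shows "law i = Leb_diag"
proof -
  have "distr P borel (\<lambda>U. U i) = unif"
    unfolding P_def using distr_PiM_component[of "{1..n}" "\<lambda>_. unif" i] prob_space_unif i(1) by (simp cong: distr_cong)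
  then have "Leb_diag = distr (distr P borel (\<lambda>U. U i)) borel (\<lambda>u. (u, u))" by (simp add: Leb_diag_def)
  also have "\<dots> = distr P borel (\<lambda>U. (U i, U i))"
    using i(1) by (subst distr_distr) (auto simp: o_def measurable_cong_sets[OF sets_P refl] intro!: borel_measurable_Pair measurable_component_singleton)
  finally show ?thesis by (simp add: law_def pt_def i(2))
qed

lemma law_not_fixed:
  assumes i: "i \<in> {1..n}" "\<sigma> i \<noteq> i"
  shows "law i = Leb_square"
  unfolding law_def pt_def P_def Leb_square_eq
  using i permutes_in_image[OF perm, of i] by (intro distr_PiM_unif_two) auto

text \<open>The \<open>t1\<close> fixed points have the diagonal law and all others the square law,
  so the difference equals \<open>(t1 - n p) * (d - s)\<close> exactly, and
  \<open>\<bar>d - s\<bar> \<le> 2 * C\<close>.\<close>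

lemma discrepancy_mixture:
  assumes G: "G \<in> borel_measurable borel" and C: "\<And>z. \<bar>G z\<bar> \<le> C" and p: "0 \<le> p" "p \<le> 1"
  defines "t1 \<equiv> card {i \<in> {1..n}. \<sigma> i = i}"
  shows "\<bar>(\<Sum>i\<in>{1..n}. \<integral>z. G z \<partial>law i) - real n * (\<integral>z. G z \<partial>mixture p)\<bar> \<le> (2 * \<bar>real t1 - real n * p\<bar>) * C"
proof -
  define d s where "d = (\<integral>z. G z \<partial>Leb_diag)" and "s = (\<integral>z. G z \<partial>Leb_square)"
  have b: "\<bar>d\<bar> \<le> C" "\<bar>s\<bar> \<le> C"
    unfolding d_def s_def
    using prob_space.norm_expectation_le[OF prob_space_Leb_diag, of G C] prob_space.norm_expectation_le[OF prob_space_Leb_square, of G C] G C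
    by (auto simp: measurable_cong_sets[OF sets_Leb_diag refl] measurable_cong_sets[OF sets_Leb_square refl])
  have un: "{1..n} = {i \<in> {1..n}. \<sigma> i = i} \<union> {i \<in> {1..n}. \<sigma> i \<noteq> i}" by auto
  have cards: "card {i \<in> {1..n}. \<sigma> i = i} + card {i \<in> {1..n}. \<sigma> i \<noteq> i} = n"
  proof -
    have "card {1..n} = card {i \<in> {1..n}. \<sigma> i = i} + card {i \<in> {1..n}. \<sigma> i \<noteq> i}"
      by (subst un, rule card_Un_disjoint) auto
    then show ?thesis by simp
  qed
  have "(\<Sum>i\<in>{1..n}. \<integral>z. G z \<partial>law i)
    = (\<Sum>i\<in>{i \<in> {1..n}. \<sigma> i = i}. \<integral>z. G z \<partial>law i) + (\<Sum>i\<in>{i \<in> {1..n}. \<sigma> i \<noteq> i}. \<integral>z. G z \<partial>law i)"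
    by (subst un, rule sum.union_disjoint) auto
  also have "(\<Sum>i\<in>{i \<in> {1..n}. \<sigma> i = i}. \<integral>z. G z \<partial>law i) = (\<Sum>i\<in>{i \<in> {1..n}. \<sigma> i = i}. d)"
    by (intro sum.cong refl) (simp add: law_fixed d_def)
  also have "(\<Sum>i\<in>{i \<in> {1..n}. \<sigma> i \<noteq> i}. \<integral>z. G z \<partial>law i) = (\<Sum>i\<in>{i \<in> {1..n}. \<sigma> i \<noteq> i}. s)"
    by (intro sum.cong refl) (simp add: law_not_fixed s_def)
  also have "(\<Sum>i\<in>{i \<in> {1..n}. \<sigma> i = i}. d) + (\<Sum>i\<in>{i \<in> {1..n}. \<sigma> i \<noteq> i}. s) = real t1 * d + (real n - real t1) * s"
  proof -
    have "real (card {i \<in> {1..n}. \<sigma> i \<noteq> i}) = real n - real t1" using cards unfolding t1_def by linarith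
    then show ?thesis unfolding t1_def by (simp only: sum_constant)
  qed
  finally have "(\<Sum>i\<in>{1..n}. \<integral>z. G z \<partial>law i) - real n * (\<integral>z. G z \<partial>mixture p) = (real t1 - real n * p) * (d - s)"
    unfolding integral_mixture[OF G C p] by (simp add: d_def s_def algebra_simps)
  also have "\<bar>\<dots>\<bar> \<le> \<bar>real t1 - real n * p\<bar> * (2 * C)"
    unfolding abs_mult using b by (intro mult_left_mono) auto
  finally show ?thesis by (simp add: mult_ac)
qed

text \<open>Two labels with distinct indices follow a product of atomless laws and coincide with
  probability zero; there are finitely many pairs. Off this null set the ranks form a
  permutation.\<close>

lemma AE_inj: "AE U in P. inj_on U {1..n}"
proof -
  have "AE U in P. U i \<noteq> U j" if "i \<in> {1..n}" "j \<in> {1..n}" "i \<noteq> j" for i j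
  proof -
    interpret U: prob_space unif by (rule prob_space_unif)
    interpret UU: pair_prob_space unif unif ..
    have m: "Measurable.pred (unif \<Otimes>\<^sub>M unif) (\<lambda>z. fst z \<noteq> snd z)"
    proof -
      have "fst \<in> borel_measurable (unif \<Otimes>\<^sub>M unif)" "snd \<in> borel_measurable (unif \<Otimes>\<^sub>M unif)"
        using measurable_fst[of unif unif] measurable_snd[of unif unif] by (simp_all cong: measurable_cong_sets)
      then show ?thesis unfolding pred_def by (rule borel_measurable_neq)
    qed
    have "AE x in unif. AE y in unif. fst (x, y) \<noteq> snd (x, y)"
    proof (rule AE_I2)
      fix x :: real
      have "AE y in unif. y \<noteq> x"
        unfolding unif_def by (rule AE_uniform_measureI) (auto intro: AE_lborel_singleton[THEN AE_mp] )
      then show "AE y in unif. fst (x, y) \<noteq> snd (x, y)" by eventually_elim auto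
    qed
    then have "AE z in unif \<Otimes>\<^sub>M unif. fst z \<noteq> snd z"
      using m by (intro UU.AE_pair_measure) (auto simp: pred_def)
    then have "AE z in distr P borel (\<lambda>U. (U i, U j)). fst z \<noteq> snd z"
      unfolding P_def distr_PiM_unif_two[OF that(3,1,2)] .
    then have "AE U in P. fst (U i, U j) \<noteq> snd (U i, U j)"
      by (rule AE_distrD[rotated]) (use that in \<open>auto simp: measurable_cong_sets[OF sets_P refl] intro!: borel_measurable_Pair measurable_component_singleton\<close>)
    then show ?thesis by simp
  qed
  then have "AE U in P. \<forall>i\<in>{1..n}. \<forall>j\<in>{1..n}. i \<noteq> j \<longrightarrow> U i \<noteq> U j"
    by (intro AE_finite_allI) auto
  then show ?thesis by eventually_elim (auto simp: inj_on_def)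
qed

end

text \<open>\<open>psi\<close> leaves the last slot \<open>r\<close> for \<open>z\<close>. By
  symmetry of \<open>perm_ind\<close>, a bijection from \<open>{1..<r}\<close> to
  \<open>{1..r} - {a}\<close> moves the distinguished slot to any \<open>a\<close>.\<close>

lemma integral_perm_ind_slot:
  assumes a: "a \<in> {1..r}" and p: "0 \<le> p" "p \<le> 1"
  shows "(\<integral>x. perm_ind r \<pi> (x(a := z)) \<partial>PiM ({1..r} - {a}) (\<lambda>_. mixture p)) = psi r p \<pi> z"
proof -
  have r: "{1..r} - {r} = {1..<r}" "r \<in> {1..r}" using a by auto
  define F where "F Z = perm_ind r \<pi> (Z(r := z))" for Z
  interpret Q: prob_space "PiM {1..<r} (\<lambda>_. mixture p)" by (intro prob_space_PiM prob_space_mixture p)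
  have Fm: "F \<in> borel_measurable (PiM {1..<r} (\<lambda>_. mixture p))"
  proof -
    have "slots {1..r} (\<lambda>_. mixture p) (perm_ind r \<pi>) 1"
      unfolding slots_def using prob_space_mixture[OF p] perm_ind_measurable perm_ind_bound by auto
    from slots.slot_section_measurable[OF this r(2), of z] show ?thesis
      unfolding F_def[abs_def] r(1) .
  qed
  have Z_img: "(Z(r := z)) ` {1..r} = insert z (Z ` {1..<r})" for Z :: "nat \<Rightarrow> real \<times> real"
  proof -
    have "{1..r} = insert r {1..<r}" using a by auto
    then have "(Z(r := z)) ` {1..r} = (Z(r := z)) ` insert r {1..<r}" by (rule arg_cong)
    also have "\<dots> = insert z (Z ` {1..<r})" by auto
    finally show ?thesis .
  qed
  have psi: "psi r p \<pi> z = (\<integral>Z. F Z \<partial>PiM {1..<r} (\<lambda>_. mixture p))"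
  proof -
    let ?S = "{Z \<in> space (PiM {1..<r} (\<lambda>_. mixture p)). is_Perm r (insert z (Z ` {1..<r})) \<pi>}"
    have eq: "F Z = indicator ?S Z" if "Z \<in> space (PiM {1..<r} (\<lambda>_. mixture p))" for Z
      unfolding F_def perm_ind_def Z_img using that by (simp add: indicator_def)
    have "?S = F -` {1} \<inter> space (PiM {1..<r} (\<lambda>_. mixture p))"
      using eq by (auto simp: indicator_def split: if_splits)
    also have "\<dots> \<in> sets (PiM {1..<r} (\<lambda>_. mixture p))" by (rule measurable_sets[OF Fm]) simp
    finally have S: "?S \<in> sets (PiM {1..<r} (\<lambda>_. mixture p))" .
    have "(\<integral>Z. F Z \<partial>PiM {1..<r} (\<lambda>_. mixture p)) = (\<integral>Z. indicator ?S Z \<partial>PiM {1..<r} (\<lambda>_. mixture p))"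
      by (rule Bochner_Integration.integral_cong[OF refl eq])
    also have "\<dots> = Q.prob ?S" using S by simp
    finally show ?thesis by (simp add: psi_def Let_def)
  qed
  have "card {1..<r} = card ({1..r} - {a})" using a by simp
  then obtain f where f: "bij_betw f {1..<r} ({1..r} - {a})"
    by (metis finite_Diff finite_atLeastAtMost finite_atLeastLessThan finite_same_card_bij)
  have re: "distr (PiM ({1..r} - {a}) (\<lambda>_. mixture p)) (PiM {1..<r} (\<lambda>_. mixture p)) (\<lambda>\<omega>. \<lambda>n\<in>{1..<r}. \<omega> (f n)) = PiM {1..<r} (\<lambda>_. mixture p)"
    using f by (intro distr_PiM_reindex prob_space_mixture p) (auto simp: bij_betw_def)
  have rm: "(\<lambda>\<omega>. \<lambda>n\<in>{1..<r}. \<omega> (f n)) \<in> measurable (PiM ({1..r} - {a}) (\<lambda>_. mixture p)) (PiM {1..<r} (\<lambda>_. mixture p))"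
  proof (rule measurable_restrict)
    fix i assume "i \<in> {1..<r}"
    then have "f i \<in> {1..r} - {a}" using bij_betwE[OF f] by blast
    then show "(\<lambda>\<omega>. \<omega> (f i)) \<in> measurable (PiM ({1..r} - {a}) (\<lambda>_. mixture p)) (mixture p)"
      by (rule measurable_component_singleton)
  qed
  have eqF: "F (\<lambda>n\<in>{1..<r}. x (f n)) = perm_ind r \<pi> (x(a := z))" for x
  proof -
    have "(x(a := z)) ` {1..r} = insert z (x ` ({1..r} - {a}))" using a by auto
    also have "x ` ({1..r} - {a}) = (\<lambda>n\<in>{1..<r}. x (f n)) ` {1..<r}"
      using f by (simp add: bij_betw_def flip: image_image[of x f])
    finally show ?thesis unfolding F_def perm_ind_def Z_img by simp
  qed
  have "psi r p \<pi> z = (\<integral>x. F (\<lambda>n\<in>{1..<r}. x (f n)) \<partial>PiM ({1..r} - {a}) (\<lambda>_. mixture p))"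
    unfolding psi by (subst (1) re[symmetric], rule integral_distr[OF rm Fm])
  then show ?thesis by (simp only: eqF)
qed

lemma integral_perm_ind:
  assumes p: "0 \<le> p" "p \<le> 1"
  shows "(\<integral>x. perm_ind r \<pi> x \<partial>PiM {1..r} (\<lambda>_. mixture p)) = mu r p \<pi>"
proof -
  let ?S = "{Z \<in> space (PiM {1..r} (\<lambda>_. mixture p)). is_Perm r (Z ` {1..r}) \<pi>}"
  have sets: "sets (PiM {1..r} (\<lambda>_. mixture p)) = sets (PiM {1..r} (\<lambda>_. borel))"
    by (rule sets_PiM_cong) auto
  have m: "perm_ind r \<pi> \<in> borel_measurable (PiM {1..r} (\<lambda>_. mixture p))"
    using perm_ind_measurable by (simp add: measurable_cong_sets[OF sets refl])
  have eq: "perm_ind r \<pi> Z = indicator ?S Z" if "Z \<in> space (PiM {1..r} (\<lambda>_. mixture p))" for Z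
    using that by (simp add: perm_ind_def indicator_def)
  have "?S = perm_ind r \<pi> -` {1} \<inter> space (PiM {1..r} (\<lambda>_. mixture p))"
    using eq by (auto simp: indicator_def split: if_splits)
  also have "\<dots> \<in> sets (PiM {1..r} (\<lambda>_. mixture p))" by (rule measurable_sets[OF m]) simp
  finally have S: "?S \<in> sets (PiM {1..r} (\<lambda>_. mixture p))" .
  have "(\<integral>x. perm_ind r \<pi> x \<partial>PiM {1..r} (\<lambda>_. mixture p)) = (\<integral>x. indicator ?S x \<partial>PiM {1..r} (\<lambda>_. mixture p))"
    by (rule Bochner_Integration.integral_cong[OF refl eq])
  then show ?thesis using S by (simp add: mu_def Let_def)
qed

section \<open>Bilinearity of the covariance, and powers against falling factorials\<close>

lemma Cov_sum:
  fixes X Y :: "'i \<Rightarrow> 'a \<Rightarrow> real"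
  assumes M: "prob_space M"
    and X: "\<And>i. i \<in> I \<Longrightarrow> X i \<in> borel_measurable M" "\<And>i \<omega>. i \<in> I \<Longrightarrow> \<bar>X i \<omega>\<bar> \<le> B"
    and Y: "\<And>i. i \<in> I \<Longrightarrow> Y i \<in> borel_measurable M" "\<And>i \<omega>. i \<in> I \<Longrightarrow> \<bar>Y i \<omega>\<bar> \<le> B"
  shows "Cov M (\<lambda>\<omega>. \<Sum>i\<in>I. t i * X i \<omega>) (\<lambda>\<omega>. \<Sum>j\<in>I. t j * Y j \<omega>) = (\<Sum>i\<in>I. \<Sum>j\<in>I. t i * t j * Cov M (X i) (Y j))"
proof -
  interpret prob_space M by (rule M)
  have iX: "integrable M (X i)" if "i \<in> I" for i using X that by (intro bounded_integrable[of _ B]) auto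
  have iY: "integrable M (Y i)" if "i \<in> I" for i using Y that by (intro bounded_integrable[of _ B]) auto
  have mX: "\<bar>expectation (X i)\<bar> \<le> B" if "i \<in> I" for i
    using norm_expectation_le[of "X i" B] X that by auto
  have mY: "\<bar>expectation (Y i)\<bar> \<le> B" if "i \<in> I" for i
    using norm_expectation_le[of "Y i" B] Y that by auto
  have ip: "integrable M (\<lambda>\<omega>. (X i \<omega> - expectation (X i)) * (Y j \<omega> - expectation (Y j)))" if "i \<in> I" "j \<in> I" for i j
  proof (rule bounded_integrable)
    show "(\<lambda>\<omega>. (X i \<omega> - expectation (X i)) * (Y j \<omega> - expectation (Y j))) \<in> borel_measurable M"
      using X(1)[OF that(1)] Y(1)[OF that(2)] by measurable
    fix \<omega>
    have "\<bar>X i \<omega> - expectation (X i)\<bar> \<le> 2 * B" "\<bar>Y j \<omega> - expectation (Y j)\<bar> \<le> 2 * B"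
      using X(2)[OF that(1), of \<omega>] mX[OF that(1)] Y(2)[OF that(2), of \<omega>] mY[OF that(2)] by linarith+
    then show "norm ((X i \<omega> - expectation (X i)) * (Y j \<omega> - expectation (Y j))) \<le> (2 * B) * (2 * B)"
      unfolding real_norm_def abs_mult by (intro mult_mono) auto
  qed
  have eX: "expectation (\<lambda>\<omega>. \<Sum>i\<in>I. t i * X i \<omega>) = (\<Sum>i\<in>I. t i * expectation (X i))"
    using iX by (subst Bochner_Integration.integral_sum) auto
  have eY: "expectation (\<lambda>\<omega>. \<Sum>i\<in>I. t i * Y i \<omega>) = (\<Sum>i\<in>I. t i * expectation (Y i))"
    using iY by (subst Bochner_Integration.integral_sum) auto
  have "Cov M (\<lambda>\<omega>. \<Sum>i\<in>I. t i * X i \<omega>) (\<lambda>\<omega>. \<Sum>j\<in>I. t j * Y j \<omega>)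
    = expectation (\<lambda>\<omega>. \<Sum>i\<in>I. \<Sum>j\<in>I. t i * t j * ((X i \<omega> - expectation (X i)) * (Y j \<omega> - expectation (Y j))))"
    unfolding Cov_def eX eY sum_subtractf[symmetric] right_diff_distrib[symmetric] sum_product
    by (simp add: mult_ac)
  also have "\<dots> = (\<Sum>i\<in>I. \<Sum>j\<in>I. expectation (\<lambda>\<omega>. t i * t j * ((X i \<omega> - expectation (X i)) * (Y j \<omega> - expectation (Y j)))))"
  proof -
    have ij: "integrable M (\<lambda>\<omega>. t i * t j * ((X i \<omega> - expectation (X i)) * (Y j \<omega> - expectation (Y j))))" if "i \<in> I" "j \<in> I" for i j
      using ip[OF that] by simp
    show ?thesis
      by (subst Bochner_Integration.integral_sum, intro Bochner_Integration.integrable_sum ij, assumption+,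
          intro sum.cong refl Bochner_Integration.integral_sum ij, assumption+)
  qed
  also have "\<dots> = (\<Sum>i\<in>I. \<Sum>j\<in>I. t i * t j * Cov M (X i) (Y j))"
    by (simp add: Cov_def)
  finally show ?thesis .
qed

text \<open>\<open>fact r * (n choose r)\<close> is the falling factorial, and induction multiplies
  in one factor \<open>n - r\<close> at a time. Needed because the theorem centres by
  \<open>n choose r\<close> but the sum over all tuples by \<open>n^r / r!\<close>.\<close>

lemma power_minus_falling:
  "\<bar>real n ^ r - fact r * real (n choose r)\<bar> \<le> (real r)\<^sup>2 * real n ^ (r - 1)"
proof (induction r)
  case 0
  show ?case by simp
next
  case (Suc r)
  define F where "F = fact r * real (n choose r)"
  have rec: "fact (Suc r) * real (n choose Suc r) = F * (real n - real r)"
  proof (cases "r \<le> n")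
    case True
    have "real (Suc r) * real (n choose Suc r) = real (n choose r) * (real n - real r)"
    proof -
      have "Suc r * (n choose Suc r) = (n choose r) * (n - r)"
        by (metis Suc_times_binomial_add binomial_absorption mult.commute binomial_absorb_comp)
      then show ?thesis using True by (metis of_nat_diff of_nat_mult)
    qed
    then have "fact r * (real (Suc r) * real (n choose Suc r)) = fact r * (real (n choose r) * (real n - real r))" by simp
    then show ?thesis by (simp only: F_def fact_Suc mult_ac)
  qed (simp add: F_def binomial_eq_0)
  have F: "0 \<le> F" "F \<le> real n ^ r"
  proof -
    show "F \<le> real n ^ r"
    proof -
      have "real ((n choose r) * fact r) \<le> real (n ^ r)" by (rule of_nat_mono[OF binomial_fact_pow])
      then show ?thesis by (simp add: F_def mult.commute)
    qed
  qed (simp add: F_def)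
  have "\<bar>real n ^ Suc r - F * (real n - real r)\<bar> \<le> real n * \<bar>real n ^ r - F\<bar> + real r * F"
  proof -
    have "real n ^ Suc r - F * (real n - real r) = real n * (real n ^ r - F) + real r * F" by (simp add: algebra_simps)
    also have "\<bar>\<dots>\<bar> \<le> \<bar>real n * (real n ^ r - F)\<bar> + \<bar>real r * F\<bar>" by (rule abs_triangle_ineq)
    finally show ?thesis using F by (simp add: abs_mult)
  qed
  also have "\<dots> \<le> real n * ((real r)\<^sup>2 * real n ^ (r - 1)) + real r * real n ^ r"
    using Suc F by (intro add_mono mult_left_mono) (auto simp: F_def)
  also have "real n * ((real r)\<^sup>2 * real n ^ (r - 1)) = (real r)\<^sup>2 * real n ^ r" by (cases r) auto
  also have "(real r)\<^sup>2 * real n ^ r + real r * real n ^ r \<le> (real (Suc r))\<^sup>2 * real n ^ (Suc r - 1)"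
    by (simp add: power2_eq_square algebra_simps)
  finally show ?case unfolding rec .
qed

section \<open>The pattern statistic\<close>

lemma cycle_count_1:
  assumes "\<sigma> permutes {1..n}"
  shows "cycle_count n \<sigma> 1 = card {i \<in> {1..n}. \<sigma> i = i}"
proof -
  have fixed_orbit: "orbit \<sigma> i = {i}" if "\<sigma> i = i" for i
  proof -
    have "x = i" if "x \<in> orbit \<sigma> i" for x using that by induction (use \<open>\<sigma> i = i\<close> in auto)
    moreover have "i \<in> orbit \<sigma> i" using orbit.base[of \<sigma> i] that by simp
    ultimately show ?thesis by auto
  qed
  have "{C \<in> orbit \<sigma> ` {1..n}. card C = 1} = (\<lambda>i. {i}) ` {i \<in> {1..n}. \<sigma> i = i}"
  proof (intro set_eqI iffI)
    fix C assume "C \<in> {C \<in> orbit \<sigma> ` {1..n}. card C = 1}"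
    then obtain i where i: "i \<in> {1..n}" "C = orbit \<sigma> i" "card C = 1" by auto
    have "i \<in> C" "\<sigma> i \<in> C"
      using i(2) permutation_self_in_orbit[of \<sigma> i] permutation_permutes[of \<sigma>] assms orbit.base[of \<sigma> i] by auto
    then have "\<sigma> i = i" using i(3) by (auto simp: card_1_singleton_iff)
    then show "C \<in> (\<lambda>i. {i}) ` {i \<in> {1..n}. \<sigma> i = i}" using i fixed_orbit by auto
  qed (use fixed_orbit in \<open>auto simp: image_iff\<close>, use fixed_orbit in fastforce)
  then show ?thesis unfolding cycle_count_def by (simp add: card_image)
qed

text \<open>The orbits of size two partition the indices of \<open>?B\<close> into pairs.\<close>

lemma cycle_count_2:
  assumes \<sigma>: "\<sigma> permutes {1..n}"
  shows "2 * cycle_count n \<sigma> 2 = card {i \<in> {1..n}. \<sigma> i \<noteq> i \<and> \<sigma> (\<sigma> i) = i}"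
proof -
  let ?B = "{i \<in> {1..n}. \<sigma> i \<noteq> i \<and> \<sigma> (\<sigma> i) = i}"
  have inj: "\<sigma> i = \<sigma> j \<longleftrightarrow> i = j" for i j using permutes_inj[OF \<sigma>] by (simp add: inj_eq)
  have orbit2: "orbit \<sigma> i = {i, \<sigma> i}" if "\<sigma> (\<sigma> i) = i" for i
  proof -
    have "x \<in> {i, \<sigma> i}" if "x \<in> orbit \<sigma> i" for x using that by induction (use \<open>\<sigma> (\<sigma> i) = i\<close> in auto)
    moreover have "\<sigma> i \<in> orbit \<sigma> i" by (rule orbit.base)
    moreover from orbit.step[OF this] have "i \<in> orbit \<sigma> i" using that by simp
    ultimately show ?thesis by auto
  qed
  define \<C> where "\<C> = {C \<in> orbit \<sigma> ` {1..n}. card C = 2}"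
  have \<C>: "\<C> = (\<lambda>i. {i, \<sigma> i}) ` ?B"
  proof (intro set_eqI iffI)
    fix C assume "C \<in> \<C>"
    then obtain i where i: "i \<in> {1..n}" "C = orbit \<sigma> i" "card C = 2" by (auto simp: \<C>_def)
    have in_C: "i \<in> C" "\<sigma> i \<in> C" "\<sigma> (\<sigma> i) \<in> C"
      using i(2) permutation_self_in_orbit[of \<sigma> i] permutation_permutes[of \<sigma>] \<sigma> orbit.base[of \<sigma> i] orbit.step[OF orbit.base[of \<sigma> i]] by auto
    have ne: "\<sigma> i \<noteq> i"
    proof
      assume "\<sigma> i = i"
      then show False using orbit2[of i] i by simp
    qed
    have "{i, \<sigma> i} = C"
      using in_C ne i(3) by (intro card_subset_eq) (auto intro: card_ge_0_finite)
    \<comment> \<open>\<open>\<sigma> (\<sigma> i)\<close> lies in the orbit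
      \<open>{i, \<sigma> i}\<close> and differs from \<open>\<sigma> i\<close> by
      injectivity.\<close>
    then have "\<sigma> (\<sigma> i) = i" using in_C(3) ne inj by auto
    then show "C \<in> (\<lambda>i. {i, \<sigma> i}) ` ?B" using i ne orbit2 by auto
  next
    fix C assume "C \<in> (\<lambda>i. {i, \<sigma> i}) ` ?B"
    then obtain i where i: "i \<in> {1..n}" "\<sigma> i \<noteq> i" "\<sigma> (\<sigma> i) = i" "C = {i, \<sigma> i}" by auto
    then have "C = orbit \<sigma> i" "card C = 2" using orbit2[of i] by auto
    then show "C \<in> \<C>" using i(1) by (auto simp: \<C>_def)
  qed
  have U: "?B = \<Union>\<C>"
  proof
    show "?B \<subseteq> \<Union>\<C>" unfolding \<C> by blast
    show "\<Union>\<C> \<subseteq> ?B"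
    proof
      fix x assume "x \<in> \<Union>\<C>"
      then obtain i where i: "i \<in> {1..n}" "\<sigma> i \<noteq> i" "\<sigma> (\<sigma> i) = i" "x = i \<or> x = \<sigma> i" unfolding \<C> by blast
      moreover have "\<sigma> i \<in> {1..n}" using permutes_in_image[OF \<sigma>] i(1) by blast
      ultimately show "x \<in> ?B" by auto
    qed
  qed
  have "card (\<Union>\<C>) = sum card \<C>"
  proof (rule card_Union_disjoint)
    show "pairwise disjnt \<C>"
    proof (rule pairwiseI)
      fix C D assume "C \<in> \<C>" "D \<in> \<C>" "C \<noteq> D"
      then obtain i j where ij: "\<sigma> (\<sigma> i) = i" "C = {i, \<sigma> i}" "\<sigma> (\<sigma> j) = j" "D = {j, \<sigma> j}" unfolding \<C> by blast
      have same: "{k, \<sigma> k} = {x, \<sigma> x}" if "x \<in> {k, \<sigma> k}" "\<sigma> (\<sigma> k) = k" for k x using that by auto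
      have "C = D" if "x \<in> C" "x \<in> D" for x
        using same[of x i] same[of x j] that ij by simp
      with \<open>C \<noteq> D\<close> show "disjnt C D" unfolding disjnt_def by blast
    qed
  qed (auto simp: \<C>)
  also have "\<dots> = 2 * card \<C>" by (simp add: \<C>_def)
  finally show ?thesis unfolding U[symmetric] by (simp add: cycle_count_def \<C>_def)
qed

section \<open>Linear combinations of pattern counts\<close>

lemma finite_perms: "finite (perms r)"
  unfolding perms_def by (rule finite_permutations) simp

lemma psi_measurable:
  assumes p: "0 \<le> p" "p \<le> 1" and r: "r \<ge> 1"
  shows "psi r p \<pi> \<in> borel_measurable borel" "\<bar>psi r p \<pi> z\<bar> \<le> 1"
proof -
  have sl: "slots {1..r} (\<lambda>_. mixture p) (perm_ind r \<pi>) 1"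
    unfolding slots_def using prob_space_mixture[OF p] perm_ind_measurable perm_ind_bound by auto
  have r': "r \<in> {1..r}" using r by simp
  have "psi r p \<pi> = (\<lambda>z. \<integral>x. perm_ind r \<pi> (x(r := z)) \<partial>PiM ({1..r} - {r}) (\<lambda>_. mixture p))"
    using integral_perm_ind_slot[OF r' p] by simp
  then show "psi r p \<pi> \<in> borel_measurable borel" using slots.slot_measurable[OF sl r'] by simp
  show "\<bar>psi r p \<pi> z\<bar> \<le> 1"
    using slots.slot_bound[OF sl r', of z] integral_perm_ind_slot[OF r' p] by simp
qed

lemma mu_bound:
  assumes "0 \<le> p" "p \<le> 1"
  shows "\<bar>mu r p \<pi>\<bar> \<le> 1"
proof -
  interpret prob_space "PiM {1..r} (\<lambda>_. mixture p)" by (intro prob_space_PiM prob_space_mixture assms)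
  show ?thesis unfolding mu_def Let_def using prob_le_1 by simp
qed

text \<open>A linear combination of the coordinates of the statistic is again a sum over tuples,
  with kernel \<open>kernel r \<theta>\<close>, so the vector case reduces to a scalar one.
  \<open>psi_lin\<close> is the projection of that kernel, and \<open>l1norm\<close> bounds
  both.\<close>

definition psi_lin :: "nat \<Rightarrow> real \<Rightarrow> ((nat \<Rightarrow> nat) \<Rightarrow> real) \<Rightarrow> real \<times> real \<Rightarrow> real" where
  "psi_lin r p \<theta> z = (\<Sum>\<pi>\<in>perms r. \<theta> \<pi> * psi r p \<pi> z)"

definition kernel :: "nat \<Rightarrow> ((nat \<Rightarrow> nat) \<Rightarrow> real) \<Rightarrow> (nat \<Rightarrow> real \<times> real) \<Rightarrow> real" where
  "kernel r \<theta> x = (\<Sum>\<pi>\<in>perms r. \<theta> \<pi> * perm_ind r \<pi> x)"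

definition l1norm :: "nat \<Rightarrow> ((nat \<Rightarrow> nat) \<Rightarrow> real) \<Rightarrow> real" where
  "l1norm r \<theta> = (\<Sum>\<pi>\<in>perms r. \<bar>\<theta> \<pi>\<bar>)"

lemma lin_bound:
  assumes "\<And>\<pi>. \<bar>f \<pi>\<bar> \<le> (1::real)"
  shows "\<bar>\<Sum>\<pi>\<in>perms r. \<theta> \<pi> * f \<pi>\<bar> \<le> l1norm r \<theta>"
  unfolding l1norm_def
proof (rule order_trans[OF sum_abs sum_mono])
  fix \<pi>
  show "\<bar>\<theta> \<pi> * f \<pi>\<bar> \<le> \<bar>\<theta> \<pi>\<bar>"
    using mult_left_mono[OF assms[of \<pi>] abs_ge_zero[of "\<theta> \<pi>"]] by (simp add: abs_mult)
qed

text \<open>The statistic of the theorem, evaluated at the pattern counts of the points \<open>(U\<^sub>i, U\<^bsub>\<sigma> i\<^esub>)\<close>.\<close>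

definition stat :: "nat \<Rightarrow> nat \<Rightarrow> real \<Rightarrow> ((nat \<Rightarrow> nat) \<Rightarrow> real) \<Rightarrow> (nat \<Rightarrow> nat) \<Rightarrow> (nat \<Rightarrow> real) \<Rightarrow> real" where
  "stat n r p \<theta> \<sigma> U = (\<Sum>\<pi>\<in>perms r. \<theta> \<pi> *
     (((\<Sum>k\<in>{1..r} \<rightarrow>\<^sub>E {1..n}. perm_ind r \<pi> (\<lambda>j\<in>{1..r}. pt \<sigma> U (k j))) / fact r - real (n choose r) * mu r p \<pi>)
        / real n powr (real r - 1 / 2)))"

context sample begin

lemma stat_measurable: "stat n r p \<theta> \<sigma> \<in> borel_measurable P"
proof -
  have "(\<lambda>U. perm_ind r \<pi> (\<lambda>j\<in>{1..r}. pt \<sigma> U (k j))) \<in> borel_measurable P" if "k \<in> {1..r} \<rightarrow>\<^sub>E {1..n}" for k \<pi>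
  proof (rule measurable_compose[OF _ perm_ind_measurable])
    show "(\<lambda>U. \<lambda>j\<in>{1..r}. pt \<sigma> U (k j)) \<in> measurable P (PiM {1..r} (\<lambda>_. borel))"
      using that by (intro measurable_restrict measurable_pt_P) auto
  qed
  then show ?thesis unfolding stat_def[abs_def] by measurable
qed

text \<open>\<open>decomposition\<close> divided by \<open>r! n^(r-1/2)\<close>, with discrepancy
  \<open>2 * \<bar>t1 - n p\<bar>\<close>. The three terms come from the Hoeffding remainder, the
  falling factorial and the discrepancy. An estimate in mean is what characteristic functions can
  use, \<open>iexp\<close> being 1-Lipschitz.\<close>

lemma stat_approximation:
  fixes \<theta> :: "(nat \<Rightarrow> nat) \<Rightarrow> real"
  assumes r: "r \<ge> 1" and p: "0 \<le> p" "p \<le> 1"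
  defines "t1 \<equiv> card {i \<in> {1..n}. \<sigma> i = i}"
  defines "H \<equiv> l1norm r \<theta>"
  defines "W \<equiv> \<lambda>U. 1 / (fact (r - 1) * sqrt (real n)) *
      (\<Sum>i\<in>{1..n}. psi_lin r p \<theta> (pt \<sigma> U i) - (\<integral>z. psi_lin r p \<theta> z \<partial>law i))"
  shows "integrable P (\<lambda>U. \<bar>stat n r p \<theta> \<sigma> U - W U\<bar>)"
    and "P.expectation (\<lambda>U. \<bar>stat n r p \<theta> \<sigma> U - W U\<bar>)
    \<le> (12 * (real r)\<^sup>2 * (2 + 2 * real r) * H + (real r)\<^sup>2 * H + 6 * (real r)\<^sup>2 * H * \<bar>real t1 - real n * p\<bar>) / sqrt (real n)"
proof -
  let ?R = "{1..r}"
  let ?g = "psi_lin r p \<theta>"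
  interpret L: ustat_limit n \<sigma> ?R "kernel r \<theta>" H "mixture p" "2 * \<bar>real t1 - real n * p\<bar>"
  proof (intro ustat_limit.intro ustat.intro ustat_axioms.intro ustat_limit_axioms.intro)
    show "sample n \<sigma>" by (rule sample_axioms)
    show "kernel r \<theta> \<in> borel_measurable (PiM ?R (\<lambda>_. borel))"
      unfolding kernel_def[abs_def] using perm_ind_measurable by (intro borel_measurable_sum borel_measurable_times) auto
    show "\<bar>kernel r \<theta> x\<bar> \<le> H" for x
      unfolding kernel_def H_def by (rule lin_bound[OF perm_ind_bound])
    show "prob_space (mixture p)" by (rule prob_space_mixture[OF p])
    show "\<bar>(\<Sum>i\<in>{1..n}. \<integral>z. G z \<partial>law i) - real n * (\<integral>z. G z \<partial>mixture p)\<bar> \<le> 2 * \<bar>real t1 - real n * p\<bar> * C"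
      if "G \<in> borel_measurable borel" "\<And>z. \<bar>G z\<bar> \<le> C" for G C
      unfolding t1_def by (rule discrepancy_mixture[OF that p])
  qed (use r in auto)
  have H0: "H \<ge> 0" by (rule L.H0)
  have proj: "L.proj a z = ?g z" if a: "a \<in> ?R" for a z
  proof -
    interpret Q: prob_space "PiM (?R - {a}) (\<lambda>_. mixture p)" by (intro prob_space_PiM prob_space_mixture p)
    have sl: "slots ?R (\<lambda>_. mixture p) (perm_ind r \<pi>) 1" for \<pi>
      unfolding slots_def using prob_space_mixture[OF p] perm_ind_measurable perm_ind_bound by auto
    have "integrable (PiM (?R - {a}) (\<lambda>_. mixture p)) (\<lambda>x. perm_ind r \<pi> (x(a := z)))" for \<pi>
      by (rule Q.bounded_integrable[where B=1, OF slots.slot_section_measurable[OF sl a]]) (use perm_ind_bound in auto)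
    then show ?thesis
      unfolding L.proj_def kernel_def psi_lin_def integral_perm_ind_slot[OF a p, symmetric] by simp
  qed
  have hmean: "L.hmean = (\<Sum>\<pi>\<in>perms r. \<theta> \<pi> * mu r p \<pi>)"
  proof -
    interpret Q: prob_space "PiM ?R (\<lambda>_. mixture p)" by (intro prob_space_PiM prob_space_mixture p)
    have s: "sets (PiM ?R (\<lambda>_. mixture p)) = sets (PiM ?R (\<lambda>_. borel))" by (rule sets_PiM_cong) auto
    have "perm_ind r \<pi> \<in> borel_measurable (PiM ?R (\<lambda>_. mixture p))" for \<pi>
      using perm_ind_measurable by (simp add: measurable_cong_sets[OF s refl])
    then have "integrable (PiM ?R (\<lambda>_. mixture p)) (perm_ind r \<pi>)" for \<pi>
      using perm_ind_bound by (intro Q.bounded_integrable[of _ 1]) auto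
    then show ?thesis
      unfolding L.hmean_def kernel_def integral_perm_ind[OF p, symmetric] by simp
  qed
  have hm: "\<bar>L.hmean\<bar> \<le> H"
    unfolding hmean H_def by (rule lin_bound[OF mu_bound[OF p]])
  define N where "N = real n ^ (r - 1)"
  have N: "N > 0" using n1 by (simp add: N_def)
  have sq: "sqrt (real n) > 0" using n1 by simp
  have pw: "real n powr (real r - 1 / 2) = N * sqrt (real n)"
  proof -
    have eq: "real r - 1 / 2 = real (r - 1) + 1 / 2" using r by (simp add: of_nat_diff)
    have n0: "0 < real n" using n1 by simp
    show ?thesis unfolding eq powr_add powr_realpow[OF n0] N_def using powr_half_sqrt[of "real n"] by simp
  qed
  define D where "D U = (\<Sum>k\<in>?R \<rightarrow>\<^sub>E {1..n}. L.tuple_rest k (L.tuple_points k U))" for U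
  define S where "S U = (\<Sum>k\<in>?R \<rightarrow>\<^sub>E {1..n}. kernel r \<theta> (L.tuple_points k U))" for U
  define V where "V U = (\<Sum>i\<in>{1..n}. ?g (pt \<sigma> U i) - (\<integral>z. ?g z \<partial>law i))" for U
  define d where "d = \<bar>real t1 - real n * p\<bar>"
  have stat: "stat n r p \<theta> \<sigma> U = (S U / fact r - real (n choose r) * L.hmean) / (N * sqrt (real n))" for U
  proof -
    have "S U = (\<Sum>\<pi>\<in>perms r. \<theta> \<pi> * (\<Sum>k\<in>?R \<rightarrow>\<^sub>E {1..n}. perm_ind r \<pi> (\<lambda>j\<in>?R. pt \<sigma> U (k j))))"
      unfolding S_def kernel_def L.tuple_points_def by (subst sum.swap) (simp add: sum_distrib_left)
    moreover have "(\<Sum>\<pi>\<in>perms r. \<theta> \<pi> * ((A \<pi> / F - c * m \<pi>) / d))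
        = ((\<Sum>\<pi>\<in>perms r. \<theta> \<pi> * A \<pi>) / F - c * (\<Sum>\<pi>\<in>perms r. \<theta> \<pi> * m \<pi>)) / d"
      for A m and F c d :: real
      by (simp add: sum_divide_distrib sum_distrib_left sum_subtractf diff_divide_distrib right_diff_distrib mult.left_commute)
    ultimately show ?thesis unfolding stat_def pw hmean by simp
  qed
  have dec: "\<bar>S U - real n ^ r * L.hmean - D U - N * (real r * V U)\<bar> \<le> 3 * (real r)\<^sup>2 * N * (2 * d * H)" for U
  proof -
    have "(\<Sum>a\<in>?R. \<Sum>i\<in>{1..n}. L.proj a (pt \<sigma> U i) - (\<integral>z. L.proj a z \<partial>law i)) = real r * V U"
      using proj by (simp add: V_def)
    then show ?thesis using L.decomposition[of U] by (simp add: S_def D_def N_def d_def)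
  qed
  \<comment> \<open>The \<open>r\<close> equal projections turn \<open>1 / r!\<close> into
    \<open>1 / (r - 1)!\<close>, the normalisation of \<open>W\<close> and the origin of
    \<open>((r - 1)!)^2\<close> in the covariance.\<close>
  have fact_r: "fact r = real r * fact (r - 1)" using r by (simp add: fact_reduce)
  have f1: "(fact r :: real) \<ge> 1" by (rule fact_ge_1)
  have bound: "\<bar>stat n r p \<theta> \<sigma> U - W U\<bar> \<le> (\<bar>D U\<bar> / N + 6 * (real r)\<^sup>2 * H * d + (real r)\<^sup>2 * H) / sqrt (real n)" for U
  proof -
    \<comment> \<open>\<open>E1\<close> is the error of \<open>decomposition\<close>;
      \<open>E2\<close>, multiplied by the mean, accounts for the two different centrings.\<close>
    define E1 where "E1 = S U - real n ^ r * L.hmean - D U - N * (real r * V U)"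
    define E2 where "E2 = real n ^ r - fact r * real (n choose r)"
    have W: "W U = N * (real r * V U) / fact r / (N * sqrt (real n))"
      unfolding W_def V_def[symmetric] fact_r using N r by simp
    have "stat n r p \<theta> \<sigma> U - W U = ((D U + E1 + E2 * L.hmean) / fact r) / (N * sqrt (real n))"
    proof -
      have "S U / fact r - real (n choose r) * L.hmean = (S U - fact r * (real (n choose r) * L.hmean)) / fact r"
        by (simp add: diff_divide_distrib)
      moreover have "S U - fact r * (real (n choose r) * L.hmean) - N * (real r * V U) = D U + E1 + E2 * L.hmean"
        by (simp add: E1_def E2_def algebra_simps)
      ultimately show ?thesis unfolding stat W by (simp only: diff_divide_distrib[symmetric])
    qed
    also have "\<bar>\<dots>\<bar> = \<bar>D U + E1 + E2 * L.hmean\<bar> / fact r / (N * sqrt (real n))"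
      using N sq by (simp add: abs_mult)
    also have "\<dots> \<le> \<bar>D U + E1 + E2 * L.hmean\<bar> / 1 / (N * sqrt (real n))"
      using N sq f1 by (intro divide_right_mono divide_left_mono) auto
    also have "\<dots> \<le> (\<bar>D U\<bar> + 3 * (real r)\<^sup>2 * N * (2 * d * H) + (real r)\<^sup>2 * N * H) / (N * sqrt (real n))"
    proof -
      have "\<bar>E2 * L.hmean\<bar> \<le> ((real r)\<^sup>2 * N) * H"
        unfolding abs_mult using power_minus_falling[of n r] hm N by (intro mult_mono) (auto simp: E2_def N_def)
      moreover have "\<bar>D U + E1 + E2 * L.hmean\<bar> \<le> \<bar>D U\<bar> + \<bar>E1\<bar> + \<bar>E2 * L.hmean\<bar>" by linarith
      ultimately show ?thesis
        using dec[of U] N sq by (simp add: E1_def divide_right_mono)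
    qed
    also have "\<dots> = (\<bar>D U\<bar> / N + 6 * (real r)\<^sup>2 * H * d + (real r)\<^sup>2 * H) / sqrt (real n)"
      using N sq by (simp add: field_simps)
    finally show ?thesis .
  qed
  have KR: "k \<in> ?R \<rightarrow> {1..n}" if "k \<in> ?R \<rightarrow>\<^sub>E {1..n}" for k using that by (auto simp: PiE_def)
  have Dm[measurable]: "D \<in> borel_measurable P"
    unfolding D_def using measurable_compose[OF L.tuple_points_measurable_P L.tuple_rest_measurable] KR by (intro borel_measurable_sum) auto
  have Db: "\<bar>D U\<bar> \<le> (\<Sum>k\<in>?R \<rightarrow>\<^sub>E {1..n}. L.rest_bound)" for U
    unfolding D_def using L.tuple_rest_bound[OF KR] by (intro order_trans[OF sum_abs sum_mono]) auto
  have iD: "integrable P (\<lambda>U. \<bar>D U\<bar>)" using Db by (intro P.bounded_integrable[of _ "\<Sum>k\<in>?R \<rightarrow>\<^sub>E {1..n}. L.rest_bound"]) auto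
  have iD2: "integrable P (\<lambda>U. \<bar>D U\<bar>\<^sup>2)"
    using Db power_mono[OF Db abs_ge_zero, of _ 2]
    by (intro P.bounded_integrable[of _ "(\<Sum>k\<in>?R \<rightarrow>\<^sub>E {1..n}. L.rest_bound)\<^sup>2"]) auto
  \<comment> \<open>The first moment is bounded through the second by nonnegativity of the variance;
    \<open>(2 * r) ^ 4 * 9\<close> is the square of \<open>12 * r^2\<close>.\<close>
  have ED: "P.expectation (\<lambda>U. \<bar>D U\<bar>) \<le> 12 * (real r)\<^sup>2 * N * ((2 + 2 * real r) * H)"
  proof (rule power2_le_imp_le)
    have "(P.expectation (\<lambda>U. \<bar>D U\<bar>))\<^sup>2 \<le> P.expectation (\<lambda>U. \<bar>D U\<bar>\<^sup>2)"
      using P.variance_eq[OF iD iD2] P.variance_positive[of "\<lambda>U. \<bar>D U\<bar>"] by linarith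
    also have "\<dots> \<le> real ((2 * r) ^ 4 * 9 * n ^ (2 * r - 2)) * L.rest_bound\<^sup>2"
      using L.tuple_rest_second_moment by (simp add: D_def)
    also have "\<dots> = (12 * (real r)\<^sup>2 * N * ((2 + 2 * real r) * H))\<^sup>2"
    proof -
      have "n ^ (2 * r - 2) = (n ^ (r - 1))\<^sup>2" by (simp add: power_mult[symmetric] diff_mult_distrib2 mult.commute)
      moreover have "L.rest_bound = (2 + 2 * real r) * H" unfolding L.rest_bound_def by simp
      ultimately show ?thesis by (simp only: N_def) (simp add: power_mult_distrib power2_eq_square power4_eq_xxxx mult_ac)
    qed
    finally show "(P.expectation (\<lambda>U. \<bar>D U\<bar>))\<^sup>2 \<le> (12 * (real r)\<^sup>2 * N * ((2 + 2 * real r) * H))\<^sup>2" .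
  qed (use N H0 in auto)
  have Wm: "W \<in> borel_measurable P"
  proof -
    have "?g \<in> borel_measurable borel"
      unfolding psi_lin_def[abs_def] using psi_measurable[OF p r] by (intro borel_measurable_sum borel_measurable_times) auto
    then have "(\<lambda>U. ?g (pt \<sigma> U i)) \<in> borel_measurable P" if "i \<in> {1..n}" for i
      using measurable_compose[OF measurable_pt_P[OF that]] by blast
    then show ?thesis unfolding W_def by measurable
  qed
  have ib: "integrable P (\<lambda>U. (\<bar>D U\<bar> / N + 6 * (real r)\<^sup>2 * H * d + (real r)\<^sup>2 * H) / sqrt (real n))"
    using iD by simp
  show iW: "integrable P (\<lambda>U. \<bar>stat n r p \<theta> \<sigma> U - W U\<bar>)"
  proof (rule Bochner_Integration.integrable_bound[OF ib])
    show "AE U in P. norm \<bar>stat n r p \<theta> \<sigma> U - W U\<bar> \<le> norm ((\<bar>D U\<bar> / N + 6 * (real r)\<^sup>2 * H * d + (real r)\<^sup>2 * H) / sqrt (real n))"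
      using order_trans[OF bound abs_ge_self] by (intro AE_I2) (simp only: real_norm_def abs_idempotent)
  qed (use stat_measurable Wm in auto)
  have "P.expectation (\<lambda>U. \<bar>stat n r p \<theta> \<sigma> U - W U\<bar>)
    \<le> P.expectation (\<lambda>U. (\<bar>D U\<bar> / N + 6 * (real r)\<^sup>2 * H * d + (real r)\<^sup>2 * H) / sqrt (real n))"
    by (rule integral_mono[OF iW ib]) (rule bound)
  also have "\<dots> = (P.expectation (\<lambda>U. \<bar>D U\<bar>) / N + 6 * (real r)\<^sup>2 * H * d + (real r)\<^sup>2 * H) / sqrt (real n)"
    using iD by (simp add: P.prob_space)
  also have "\<dots> \<le> (12 * (real r)\<^sup>2 * ((2 + 2 * real r) * H) + 6 * (real r)\<^sup>2 * H * d + (real r)\<^sup>2 * H) / sqrt (real n)"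
    using ED N sq by (intro divide_right_mono add_mono) (auto simp: divide_le_eq mult_ac)
  finally show "P.expectation (\<lambda>U. \<bar>stat n r p \<theta> \<sigma> U - W U\<bar>)
    \<le> (12 * (real r)\<^sup>2 * (2 + 2 * real r) * H + (real r)\<^sup>2 * H + 6 * (real r)\<^sup>2 * H * \<bar>real t1 - real n * p\<bar>) / sqrt (real n)"
    by (simp add: d_def mult_ac add_ac)
qed

end

section \<open>Characteristic functions and conjugation\<close>

lemma abs_exp_diff_le:
  fixes x y :: real
  assumes "x \<ge> 0" "y \<ge> 0"
  shows "\<bar>exp (- x) - exp (- y)\<bar> \<le> \<bar>x - y\<bar>"
proof -
  have main: "exp (- a) - exp (- b) \<le> b - a" "exp (- b) \<le> exp (- a)" if "a \<ge> 0" "a \<le> b" for a b :: real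
  proof -
    have "exp (- a) - exp (- b) = exp (- a) * (1 - exp (- (b - a)))" by (simp add: algebra_simps flip: exp_add)
    also have "\<dots> \<le> 1 * (b - a)"
    proof (rule mult_mono)
      show "1 - exp (- (b - a)) \<le> b - a" using exp_ge_add_one_self[of "- (b - a)"] by linarith
    qed (use that in auto)
    finally show "exp (- a) - exp (- b) \<le> b - a" by simp
  qed (use that in simp)
  show ?thesis using main[of x y] main[of y x] assms by (cases "x \<le> y") auto
qed

definition qvar :: "nat \<Rightarrow> real \<Rightarrow> real \<Rightarrow> ((nat \<Rightarrow> nat) \<Rightarrow> real) \<Rightarrow> real" where
  "qvar r p1 p2 \<theta> = (\<Sum>\<pi>\<in>perms r. \<Sum>\<rho>\<in>perms r. \<theta> \<pi> * \<theta> \<rho> * Sigma_lim r p1 p2 \<pi> \<rho>)"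

text \<open>By bilinearity, the quadratic form of \<open>Sigma_lim\<close> at
  \<open>\<theta>\<close> is its defining formula for the single function
  \<open>psi_lin r p1 \<theta>\<close>, the shape in which \<open>vsum_eq\<close> delivers
  variances.\<close>

lemma qvar_eq:
  fixes \<theta> :: "(nat \<Rightarrow> nat) \<Rightarrow> real"
  assumes p: "0 \<le> p1" "p1 \<le> 1" and r: "r \<ge> 1"
  defines "g \<equiv> psi_lin r p1 \<theta>"
  shows "qvar r p1 p2 \<theta> =
    (p1 * Cov UVW (\<lambda>(u, v, w). g (u, u)) (\<lambda>(u, v, w). g (u, u))
      + (1 - p1) * Cov UVW (\<lambda>(u, v, w). g (u, v)) (\<lambda>(u, v, w). g (u, v))
      + p2 * Cov UVW (\<lambda>(u, v, w). g (u, v)) (\<lambda>(u, v, w). g (v, u))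
      + 2 * (1 - p1 - p2) * Cov UVW (\<lambda>(u, v, w). g (u, v)) (\<lambda>(u, v, w). g (v, w))) / (fact (r - 1))\<^sup>2"
proof -
  have ps[measurable]: "psi r p1 \<pi> \<in> borel_measurable borel" for \<pi> by (rule psi_measurable[OF p r])
  have bd: "\<bar>psi r p1 \<pi> z\<bar> \<le> 1" for \<pi> z by (rule psi_measurable[OF p r])
  have C: "Cov UVW (\<lambda>z. g (f z)) (\<lambda>z. g (h z))
     = (\<Sum>\<pi>\<in>perms r. \<Sum>\<rho>\<in>perms r. \<theta> \<pi> * \<theta> \<rho> * Cov UVW (\<lambda>z. psi r p1 \<pi> (f z)) (\<lambda>z. psi r p1 \<rho> (h z)))"
    if [measurable]: "f \<in> borel_measurable borel" "h \<in> borel_measurable borel" for f h :: "real \<times> real \<times> real \<Rightarrow> real \<times> real"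
    unfolding g_def psi_lin_def
    by (rule Cov_sum[OF prob_space_UVW, where B=1]) (auto simp: bd measurable_cong_sets[OF sets_UVW refl])
  note C1 = C[of "\<lambda>z. (fst z, fst z)" "\<lambda>z. (fst z, fst z)"]
  note C2 = C[of "\<lambda>z. (fst z, fst (snd z))" "\<lambda>z. (fst z, fst (snd z))"]
  note C3 = C[of "\<lambda>z. (fst z, fst (snd z))" "\<lambda>z. (fst (snd z), fst z)"]
  note C4 = C[of "\<lambda>z. (fst z, fst (snd z))" "\<lambda>z. (fst (snd z), snd (snd z))"]
  show ?thesis
    unfolding qvar_def Sigma_lim_def split_def
    by (subst C1, measurable, subst C2, measurable, subst C3, measurable, subst C4, measurable)
       (simp only: sum_distrib_left sum_divide_distrib sum.distrib[symmetric], intro sum.cong refl,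
        simp add: add_divide_distrib algebra_simps)
qed

text \<open>The sign of \<open>qvar\<close> is still open at this point. The first bound holds
  because \<open>qvar\<close> is within the error of a nonnegative variance, and it is what later
  settles the sign; the second is conditional on it. \<open>K\<close> depends on neither
  \<open>n\<close> nor \<open>\<sigma>\<close>, so the bounds can be averaged over random
  permutations.\<close>

lemma charfun_bound:
  fixes \<theta> :: "(nat \<Rightarrow> nat) \<Rightarrow> real"
  assumes p: "0 \<le> p1" "p1 \<le> 1" and r: "r \<ge> 1"
  shows "\<exists>K\<ge>0. \<forall>n \<sigma>. n \<ge> 1 \<longrightarrow> \<sigma> \<in> perms n \<longrightarrow>
    (let err = 1 / sqrt (real n) + \<bar>(real (cycle_count n \<sigma> 1) - real n * p1) / sqrt (real n)\<bar>
            + \<bar>(2 * real (cycle_count n \<sigma> 2) - real n * p2) / real n\<bar>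
     in - qvar r p1 p2 \<theta> \<le> K * err \<and>
        (qvar r p1 p2 \<theta> \<ge> 0 \<longrightarrow>
          cmod ((\<integral>U. iexp (stat n r p1 \<theta> \<sigma> U) \<partial>PiM {1..n} (\<lambda>_. unif)) - exp (- of_real (qvar r p1 p2 \<theta> / 2))) \<le> K * err))"
proof -
  define g where "g = psi_lin r p1 \<theta>"
  define H where "H = l1norm r \<theta>"
  define c1 where "c1 = Cov UVW (\<lambda>(u, v, w). g (u, u)) (\<lambda>(u, v, w). g (u, u))"
  define c2 where "c2 = Cov UVW (\<lambda>(u, v, w). g (u, v)) (\<lambda>(u, v, w). g (u, v))"
  define c3 where "c3 = Cov UVW (\<lambda>(u, v, w). g (u, v)) (\<lambda>(u, v, w). g (v, u))"
  define c4 where "c4 = Cov UVW (\<lambda>(u, v, w). g (u, v)) (\<lambda>(u, v, w). g (v, w))"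
  define f where "f = (fact (r - 1) :: real)"
  define Q where "Q = qvar r p1 p2 \<theta>"
  define Mc where "Mc = \<bar>c1\<bar> + \<bar>c2\<bar> + \<bar>c3\<bar> + 4 * \<bar>c4\<bar>"
  define K1 where "K1 = 12 * (real r)\<^sup>2 * (2 + 2 * real r) * H + (real r)\<^sup>2 * H + 6 * (real r)\<^sup>2 * H"
  \<comment> \<open>\<open>K1\<close> pays for replacing the statistic by its linear part,
    \<open>288 * H ^ 3 = 36 * (2 * H) ^ 3\<close> for the normal approximation, and
    \<open>Mc\<close> for replacing its variance by \<open>qvar\<close>.\<close>
  define K where "K = K1 + 288 * H ^ 3 + Mc"
  have H0: "H \<ge> 0" by (simp add: H_def l1norm_def sum_nonneg)
  have K0: "K1 \<ge> 0" "Mc \<ge> 0" "K \<ge> 0" using H0 by (simp_all add: K1_def Mc_def K_def)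
  have f1: "f \<ge> 1" unfolding f_def by (rule fact_ge_1)
  have gm: "g \<in> borel_measurable borel"
    unfolding g_def psi_lin_def[abs_def] using psi_measurable[OF p r] by (intro borel_measurable_sum borel_measurable_times) auto
  have gb: "\<bar>g z\<bar> \<le> H" for z
    unfolding g_def psi_lin_def H_def by (rule lin_bound) (rule psi_measurable[OF p r])
  have Qf: "Q = (p1 * c1 + (1 - p1) * c2 + p2 * c3 + 2 * (1 - p1 - p2) * c4) / f\<^sup>2"
    unfolding Q_def qvar_eq[OF p r] c1_def c2_def c3_def c4_def g_def f_def ..
  have main: "- Q \<le> K * err \<and> (Q \<ge> 0 \<longrightarrow> cmod ((\<integral>U. iexp (stat n r p1 \<theta> \<sigma> U) \<partial>PiM {1..n} (\<lambda>_. unif)) - exp (- of_real (Q / 2))) \<le> K * err)"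
    if n: "n \<ge> 1" and \<sigma>: "\<sigma> \<in> perms n"
      and err: "err = 1 / sqrt (real n) + \<bar>(real (cycle_count n \<sigma> 1) - real n * p1) / sqrt (real n)\<bar>
            + \<bar>(2 * real (cycle_count n \<sigma> 2) - real n * p2) / real n\<bar>" for n \<sigma> err
  proof -
    have perm: "\<sigma> permutes {1..n}" using \<sigma> by (simp add: perms_def)
    interpret sample n \<sigma> by unfold_locales (use n perm in auto)
    define t1 where "t1 = card {i \<in> {1..n}. \<sigma> i = i}"
    define t2 where "t2 = card {i \<in> {1..n}. \<sigma> i \<noteq> i \<and> \<sigma> (\<sigma> i) = i}"
    define N where "N = sqrt (real n)"
    have N: "N \<ge> 1" "N * N = real n" using n by (simp_all add: N_def)
    have cc: "cycle_count n \<sigma> 1 = t1" "2 * real (cycle_count n \<sigma> 2) = real t2"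
    proof -
      show "cycle_count n \<sigma> 1 = t1" unfolding t1_def by (rule cycle_count_1[OF perm])
      have "2 * real (cycle_count n \<sigma> 2) = real (2 * cycle_count n \<sigma> 2)" by simp
      also have "\<dots> = real t2" unfolding t2_def cycle_count_2[OF perm] ..
      finally show "2 * real (cycle_count n \<sigma> 2) = real t2" .
    qed
    define a b where "a = real t1 / real n - p1" and "b = real t2 / real n - p2"
    define a' where "a' = \<bar>real t1 - real n * p1\<bar> / N"
    have b': "\<bar>b\<bar> = \<bar>(2 * real (cycle_count n \<sigma> 2) - real n * p2) / real n\<bar>"
      unfolding cc b_def using n by (simp add: diff_divide_distrib)
    \<comment> \<open>Since \<open>n \<ge> sqrt n\<close>, precision at scale \<open>sqrt n\<close>
      for the number of fixed points controls their proportion too.\<close>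
    have a_le: "\<bar>a\<bar> \<le> a'"
    proof -
      have "a = (real t1 - real n * p1) / (N * N)"
        unfolding a_def N using n by (simp add: diff_divide_distrib)
      then have "\<bar>a\<bar> = \<bar>real t1 - real n * p1\<bar> / (N * N)" using N by (simp add: abs_mult)
      also have "\<dots> \<le> \<bar>real t1 - real n * p1\<bar> / (1 * N)"
        using N(1) by (intro divide_left_mono mult_right_mono mult_pos_pos) auto
      finally show ?thesis by (simp add: a'_def)
    qed
    have err': "err = 1 / N + a' + \<bar>b\<bar>"
      unfolding err b'[symmetric] unfolding cc a'_def N_def by simp
    have a0: "a' \<ge> 0" "1 / N \<ge> 0" using N by (simp_all add: a'_def)
    have err0: "err \<ge> 0" "1 / N \<le> err" "\<bar>a\<bar> + \<bar>b\<bar> \<le> err" "1 / N + a' \<le> err"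
      using err' a_le a0 by linarith+
    define s where "s = 1 / (f * N)"
    have s0: "s \<ge> 0" "s \<le> 1 / N" using f1 N by (simp_all add: s_def frac_le)
    have s2: "s\<^sup>2 = 1 / (f\<^sup>2 * real n)" unfolding s_def N(2)[symmetric] by (simp add: power2_eq_square)
    define v where "v = s\<^sup>2 * vsum g"
    have v0: "v \<ge> 0" unfolding v_def by (rule sum_clt(1)[OF gm gb s0(1)])
    \<comment> \<open>\<open>f^2 * (v - Q)\<close> is linear in the deviations \<open>a\<close> and
      \<open>b\<close> of the two proportions, with coefficients \<open>c1 - c2 - 2 * c4\<close> and
      \<open>c3 - 2 * c4\<close>; \<open>Mc\<close> dominates both.\<close>
    have vQ: "\<bar>v - Q\<bar> \<le> Mc * err"
    proof -
      have vs: "vsum g = real t1 * c1 + (real n - real t1) * c2 + real t2 * c3 + 2 * (real n - real t1 - real t2) * c4"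
        using vsum_eq[OF gm] by (simp only: t1_def t2_def c1_def c2_def c3_def c4_def)
      have "v = (vsum g / real n) / f\<^sup>2" unfolding v_def s2 by simp
      also have "vsum g / real n = (a + p1) * c1 + (1 - (a + p1)) * c2 + (b + p2) * c3 + 2 * (1 - (a + p1) - (b + p2)) * c4"
        unfolding vs a_def b_def using n by (simp add: field_simps)
      finally have "v - Q = ((a + p1) * c1 + (1 - (a + p1)) * c2 + (b + p2) * c3 + 2 * (1 - (a + p1) - (b + p2)) * c4
          - (p1 * c1 + (1 - p1) * c2 + p2 * c3 + 2 * (1 - p1 - p2) * c4)) / f\<^sup>2"
        by (simp only: Qf diff_divide_distrib)
      also have "(a + p1) * c1 + (1 - (a + p1)) * c2 + (b + p2) * c3 + 2 * (1 - (a + p1) - (b + p2)) * c4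
          - (p1 * c1 + (1 - p1) * c2 + p2 * c3 + 2 * (1 - p1 - p2) * c4) = a * (c1 - c2 - 2 * c4) + b * (c3 - 2 * c4)"
        by (simp add: algebra_simps)
      finally have "\<bar>v - Q\<bar> = \<bar>a * (c1 - c2 - 2 * c4) + b * (c3 - 2 * c4)\<bar> / f\<^sup>2" by simp
      also have "\<dots> \<le> \<bar>a * (c1 - c2 - 2 * c4) + b * (c3 - 2 * c4)\<bar> / 1"
        using f1 by (intro divide_left_mono) auto
      also have "\<dots> \<le> \<bar>a\<bar> * \<bar>c1 - c2 - 2 * c4\<bar> + \<bar>b\<bar> * \<bar>c3 - 2 * c4\<bar>"
        using abs_triangle_ineq by (simp add: abs_mult[symmetric])
      also have "\<dots> \<le> \<bar>a\<bar> * Mc + \<bar>b\<bar> * Mc"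
        by (intro add_mono mult_left_mono) (auto simp: Mc_def)
      also have "\<dots> = Mc * (\<bar>a\<bar> + \<bar>b\<bar>)" by (simp add: algebra_simps)
      also have "\<dots> \<le> Mc * err" using err0 K0 by (intro mult_left_mono) auto
      finally show ?thesis .
    qed
    have KM: "Mc * err \<le> K * err" using err0 K0 H0 by (intro mult_right_mono) (auto simp: K_def)
    have "- Q \<le> K * err" using vQ v0 KM by linarith
    moreover have "cmod ((\<integral>U. iexp (stat n r p1 \<theta> \<sigma> U) \<partial>PiM {1..n} (\<lambda>_. unif)) - exp (- of_real (Q / 2))) \<le> K * err" if Q0: "Q \<ge> 0"
    proof -
      define W where "W U = s * (\<Sum>i\<in>{1..n}. g (pt \<sigma> U i) - (\<integral>z. g z \<partial>law i))" for U
      have Wm: "W \<in> borel_measurable P"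
      proof -
        have "(\<lambda>U. g (pt \<sigma> U i)) \<in> borel_measurable P" if "i \<in> {1..n}" for i
          using measurable_compose[OF measurable_pt_P[OF that] gm] .
        then show ?thesis unfolding W_def by measurable
      qed
      have st[measurable]: "stat n r p1 \<theta> \<sigma> \<in> borel_measurable P" by (rule stat_measurable)
      have i: "integrable P (\<lambda>U. iexp (stat n r p1 \<theta> \<sigma> U))" "integrable P (\<lambda>U. iexp (W U))"
        using Wm by (auto intro!: P.integrable_iexp)
      have K1n: "P.expectation (\<lambda>U. \<bar>stat n r p1 \<theta> \<sigma> U - W U\<bar>) \<le> K1 * err"
      proof -
        have "P.expectation (\<lambda>U. \<bar>stat n r p1 \<theta> \<sigma> U - W U\<bar>)
          \<le> (12 * (real r)\<^sup>2 * (2 + 2 * real r) * H + (real r)\<^sup>2 * H + 6 * (real r)\<^sup>2 * H * \<bar>real t1 - real n * p1\<bar>) / N"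
          using stat_approximation(2)[OF r p, of \<theta>] by (simp only: W_def s_def f_def N_def g_def H_def t1_def)
        also have "\<dots> = (12 * (real r)\<^sup>2 * (2 + 2 * real r) * H + (real r)\<^sup>2 * H) * (1 / N) + 6 * (real r)\<^sup>2 * H * a'"
          by (simp add: a'_def add_divide_distrib)
        also have "\<dots> \<le> K1 * (1 / N) + K1 * a'"
          unfolding K1_def using H0 a0 by (intro add_mono mult_right_mono) auto
        also have "\<dots> = K1 * (1 / N + a')" by (simp add: algebra_simps)
        also have "\<dots> \<le> K1 * err" using err0 K0 by (intro mult_left_mono) auto
        finally show ?thesis .
      qed
      have b1: "cmod (P.expectation (\<lambda>U. iexp (stat n r p1 \<theta> \<sigma> U)) - P.expectation (\<lambda>U. iexp (W U))) \<le> K1 * err"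
      proof -
        have iW: "integrable P (\<lambda>U. \<bar>stat n r p1 \<theta> \<sigma> U - W U\<bar>)"
          using stat_approximation(1)[OF r p, of \<theta>] by (simp only: W_def s_def f_def N_def g_def)
        have "cmod (P.expectation (\<lambda>U. iexp (stat n r p1 \<theta> \<sigma> U)) - P.expectation (\<lambda>U. iexp (W U)))
          = cmod (P.expectation (\<lambda>U. iexp (stat n r p1 \<theta> \<sigma> U) - iexp (W U)))" using i by simp
        also have "\<dots> \<le> P.expectation (\<lambda>U. cmod (iexp (stat n r p1 \<theta> \<sigma> U) - iexp (W U)))" by (rule integral_norm_bound)
        also have "\<dots> \<le> P.expectation (\<lambda>U. \<bar>stat n r p1 \<theta> \<sigma> U - W U\<bar>)"
          using i iW by (intro integral_mono) (auto intro!: iexp_lipschitz integrable_norm)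
        finally show ?thesis using K1n by linarith
      qed
      have b2: "cmod (P.expectation (\<lambda>U. iexp (W U)) - exp (- of_real (v / 2))) \<le> 288 * H ^ 3 * err"
      proof -
        have "cmod (P.expectation (\<lambda>U. iexp (W U)) - exp (- of_real (v / 2))) \<le> 36 * real n * (s * (2 * H)) ^ 3"
          using sum_clt(2)[OF gm gb s0(1)] by (simp only: W_def v_def)
        also have "\<dots> \<le> 36 * real n * (1 / N * (2 * H)) ^ 3"
          using s0 H0 by (intro mult_left_mono power_mono mult_right_mono) auto
        also have "\<dots> = 288 * H ^ 3 * (1 / N)"
          unfolding N(2)[symmetric] using N(1) by (simp add: power3_eq_cube field_simps)
        also have "\<dots> \<le> 288 * H ^ 3 * err" using err0 H0 by (intro mult_left_mono) auto
        finally show ?thesis .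
      qed
      have b3: "cmod (exp (- of_real (v / 2)) - exp (- of_real (Q / 2))) \<le> Mc * err"
      proof -
        have "exp (- complex_of_real (v / 2)) - exp (- complex_of_real (Q / 2)) = of_real (exp (- (v / 2)) - exp (- (Q / 2)))"
          by (simp flip: exp_of_real)
        then have "cmod (exp (- complex_of_real (v / 2)) - exp (- complex_of_real (Q / 2))) = \<bar>exp (- (v / 2)) - exp (- (Q / 2))\<bar>"
          by (simp only: norm_of_real)
        also have "\<dots> \<le> \<bar>v / 2 - Q / 2\<bar>" using v0 Q0 by (intro abs_exp_diff_le) auto
        also have "\<dots> \<le> \<bar>v - Q\<bar>" by (simp add: abs_if)
        finally show ?thesis using vQ by linarith
      qed
      have tri: "cmod (x - w) \<le> cmod (x - y) + cmod (y - z) + cmod (z - w)" for x y z w :: complex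
        using norm_triangle_ineq[of "x - y" "y - z"] norm_triangle_ineq[of "x - z" "z - w"] by simp
      have "cmod (P.expectation (\<lambda>U. iexp (stat n r p1 \<theta> \<sigma> U)) - exp (- of_real (Q / 2))) \<le> K1 * err + 288 * H ^ 3 * err + Mc * err"
        using tri[of "P.expectation (\<lambda>U. iexp (stat n r p1 \<theta> \<sigma> U))" "exp (- of_real (Q / 2))" "P.expectation (\<lambda>U. iexp (W U))" "exp (- of_real (v / 2))"]
          b1 b2 b3 by linarith
      then show ?thesis by (simp add: K_def P_def algebra_simps)
    qed
    ultimately show ?thesis by simp
  qed
  show ?thesis
    unfolding Let_def Q_def[symmetric] using K0(3) main by (intro exI[of _ K]) blast
qed

lemma perms_expectation:
  fixes f :: "(nat \<Rightarrow> nat) \<Rightarrow> 'b::{banach, second_countable_topology}"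
  assumes M: "prob_space M" and \<tau>: "\<tau> \<in> measurable M (count_space (perms n))"
  shows "(\<integral>\<omega>. f (\<tau> \<omega>) \<partial>M) = (\<Sum>\<sigma>\<in>perms n. measure M {\<omega> \<in> space M. \<tau> \<omega> = \<sigma>} *\<^sub>R f \<sigma>)"
proof -
  interpret prob_space M by (rule M)
  have ev: "{\<omega> \<in> space M. \<tau> \<omega> = \<sigma>} \<in> events" if "\<sigma> \<in> perms n" for \<sigma>
  proof -
    have "{\<omega> \<in> space M. \<tau> \<omega> = \<sigma>} = \<tau> -` {\<sigma>} \<inter> space M" by auto
    then show ?thesis using measurable_sets[OF \<tau>, of "{\<sigma>}"] that by simp
  qed
  have "(\<integral>\<omega>. f (\<tau> \<omega>) \<partial>M) = (\<integral>\<omega>. (\<Sum>\<sigma>\<in>perms n. indicator {\<omega> \<in> space M. \<tau> \<omega> = \<sigma>} \<omega> *\<^sub>R f \<sigma>) \<partial>M)"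
  proof (rule Bochner_Integration.integral_cong[OF refl])
    fix \<omega> assume \<omega>: "\<omega> \<in> space M"
    then have "\<tau> \<omega> \<in> perms n" using measurable_space[OF \<tau>] by simp
    then have "f (\<tau> \<omega>) = (\<Sum>\<sigma>\<in>perms n. if \<sigma> = \<tau> \<omega> then f \<sigma> else 0)" by (simp add: finite_perms)
    also have "\<dots> = (\<Sum>\<sigma>\<in>perms n. indicator {\<omega> \<in> space M. \<tau> \<omega> = \<sigma>} \<omega> *\<^sub>R f \<sigma>)"
      using \<omega> by (intro sum.cong) (auto simp: indicator_def)
    finally show "f (\<tau> \<omega>) = (\<Sum>\<sigma>\<in>perms n. indicator {\<omega> \<in> space M. \<tau> \<omega> = \<sigma>} \<omega> *\<^sub>R f \<sigma>)" .
  qed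
  also have "\<dots> = (\<Sum>\<sigma>\<in>perms n. measure M {\<omega> \<in> space M. \<tau> \<omega> = \<sigma>} *\<^sub>R f \<sigma>)"
  proof (subst Bochner_Integration.integral_sum)
    show "integrable M (\<lambda>\<omega>. indicator {\<omega> \<in> space M. \<tau> \<omega> = \<sigma>} \<omega> *\<^sub>R f \<sigma>)" if "\<sigma> \<in> perms n" for \<sigma>
      using ev[OF that] by (intro integrable_scaleR_left integrable_real_indicator) (auto simp: less_top[symmetric])
    show "(\<Sum>\<sigma>\<in>perms n. \<integral>\<omega>. indicator {\<omega> \<in> space M. \<tau> \<omega> = \<sigma>} \<omega> *\<^sub>R f \<sigma> \<partial>M)
       = (\<Sum>\<sigma>\<in>perms n. measure M {\<omega> \<in> space M. \<tau> \<omega> = \<sigma>} *\<^sub>R f \<sigma>)"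
    proof (intro sum.cong refl)
      fix \<sigma> assume \<sigma>: "\<sigma> \<in> perms n"
      let ?S = "{\<omega> \<in> space M. \<tau> \<omega> = \<sigma>}"
      have "(\<integral>\<omega>. indicator ?S \<omega> *\<^sub>R f \<sigma> \<partial>M) = (\<integral>\<omega>. indicat_real ?S \<omega> \<partial>M) *\<^sub>R f \<sigma>"
        using ev[OF \<sigma>] by (intro integral_scaleR_left integrable_real_indicator) (auto simp: less_top[symmetric])
      also have "(\<integral>\<omega>. indicat_real ?S \<omega> \<partial>M) = measure M ?S"
        using ev[OF \<sigma>] by (simp add: Int_absorb2)
      finally show "(\<integral>\<omega>. indicator ?S \<omega> *\<^sub>R f \<sigma> \<partial>M) = measure M ?S *\<^sub>R f \<sigma>" .
    qed
  qed
  finally show ?thesis .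
qed

text \<open>
  Conjugating by the ranks of i.i.d. uniform labels, independent of \<open>\<tau>\<close>, does not change the law of
  \<open>\<tau>\<close>; for this the rank permutation need not be known to be uniform.
\<close>

lemma conjugation_average:
  fixes F :: "(nat \<Rightarrow> nat) \<Rightarrow> complex"
  assumes n: "n \<ge> 1" and rp: "random_permutation n M \<tau>" and ci: "conjugation_invariant n M \<tau>"
    and F': "\<And>\<sigma>. \<sigma> \<in> perms n \<Longrightarrow> F' \<sigma> \<in> borel_measurable (PiM {1..n} (\<lambda>_. unif))"
      "\<And>\<sigma> U. \<sigma> \<in> perms n \<Longrightarrow> cmod (F' \<sigma> U) \<le> 1"
    and eq: "\<And>\<sigma> U. \<sigma> \<in> perms n \<Longrightarrow> inj_on U {1..n} \<Longrightarrow> F' \<sigma> U = F (rank n U \<circ> \<sigma> \<circ> inv (rank n U))"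
  shows "(\<integral>\<omega>. F (\<tau> \<omega>) \<partial>M) = (\<Sum>\<sigma>\<in>perms n. measure M {\<omega> \<in> space M. \<tau> \<omega> = \<sigma>} *\<^sub>R (\<integral>U. F' \<sigma> U \<partial>PiM {1..n} (\<lambda>_. unif)))"
proof -
  have M: "prob_space M" and \<tau>: "\<tau> \<in> measurable M (count_space (perms n))"
    using rp by (auto simp: random_permutation_def)
  interpret prob_space M by (rule M)
  \<comment> \<open>The label measure does not depend on the permutation; the identity gives access
    to it and to \<open>AE_inj\<close>.\<close>
  have "sample n id" by unfold_locales (use n permutes_id in auto)
  then interpret S: sample n id .
  define c where "c = (\<integral>\<omega>. F (\<tau> \<omega>) \<partial>M)"
  have iF: "integrable S.P (F' \<sigma>)" if "\<sigma> \<in> perms n" for \<sigma>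
  proof (rule S.P.bounded_integrable[where B=1])
    show "F' \<sigma> \<in> borel_measurable S.P" unfolding S.P_def by (rule F'(1)[OF that])
  qed (rule F'(2)[OF that])
  have "(\<Sum>\<sigma>\<in>perms n. measure M {\<omega> \<in> space M. \<tau> \<omega> = \<sigma>} *\<^sub>R (\<integral>U. F' \<sigma> U \<partial>S.P))
    = (\<integral>U. (\<Sum>\<sigma>\<in>perms n. measure M {\<omega> \<in> space M. \<tau> \<omega> = \<sigma>} *\<^sub>R F' \<sigma> U) \<partial>S.P)"
    using iF by (subst Bochner_Integration.integral_sum) auto
  also have "\<dots> = (\<integral>U. c \<partial>S.P)"
  proof (rule integral_cong_AE)
    show "AE U in S.P. (\<Sum>\<sigma>\<in>perms n. measure M {\<omega> \<in> space M. \<tau> \<omega> = \<sigma>} *\<^sub>R F' \<sigma> U) = c"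
      using S.AE_inj
    proof eventually_elim
      case (elim U)
      \<comment> \<open>\<open>U\<close> is fixed here, so invariance is applied to the
        deterministic permutation \<open>rank n U\<close>. The weighted sum then equals
        \<open>c\<close> for almost every \<open>U\<close>.\<close>
      define \<rho> where "\<rho> = rank n U"
      have \<rho>: "\<rho> \<in> perms n" unfolding \<rho>_def perms_def using rank_permutes[OF elim] by simp
      have conj: "\<rho> \<circ> \<sigma> \<circ> inv \<rho> \<in> perms n" if "\<sigma> \<in> perms n" for \<sigma>
        using \<rho> that unfolding perms_def by (auto intro!: permutes_compose permutes_inv)
      have cm: "(\<lambda>\<omega>. \<rho> \<circ> \<tau> \<omega> \<circ> inv \<rho>) \<in> measurable M (count_space (perms n))"
      proof (rule measurable_compose[OF \<tau>, where g="\<lambda>\<sigma>. \<rho> \<circ> \<sigma> \<circ> inv \<rho>"])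
        show "(\<lambda>\<sigma>. \<rho> \<circ> \<sigma> \<circ> inv \<rho>) \<in> measurable (count_space (perms n)) (count_space (perms n))"
          unfolding measurable_count_space_eq1 space_count_space using conj by (rule Pi_I)
      qed
      have "(\<Sum>\<sigma>\<in>perms n. measure M {\<omega> \<in> space M. \<tau> \<omega> = \<sigma>} *\<^sub>R F' \<sigma> U)
        = (\<Sum>\<sigma>\<in>perms n. measure M {\<omega> \<in> space M. \<tau> \<omega> = \<sigma>} *\<^sub>R F (\<rho> \<circ> \<sigma> \<circ> inv \<rho>))"
        using eq[OF _ elim] by (simp add: \<rho>_def)
      also have "\<dots> = (\<integral>\<omega>. F (\<rho> \<circ> \<tau> \<omega> \<circ> inv \<rho>) \<partial>M)"
        by (rule perms_expectation[OF M \<tau>, symmetric])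
      also have "\<dots> = (\<integral>\<sigma>. F \<sigma> \<partial>distr M (count_space (perms n)) (\<lambda>\<omega>. \<rho> \<circ> \<tau> \<omega> \<circ> inv \<rho>))"
        by (rule integral_distr[OF cm, symmetric]) simp
      also have "\<dots> = (\<integral>\<sigma>. F \<sigma> \<partial>distr M (count_space (perms n)) \<tau>)"
        using ci \<rho> by (simp add: conjugation_invariant_def)
      also have "\<dots> = c" unfolding c_def by (rule integral_distr[OF \<tau>]) simp
      finally show ?case .
    qed
    show "(\<lambda>U. \<Sum>\<sigma>\<in>perms n. measure M {\<omega> \<in> space M. \<tau> \<omega> = \<sigma>} *\<^sub>R F' \<sigma> U) \<in> borel_measurable S.P"
      using borel_measurable_integrable[OF iF] by (intro borel_measurable_sum borel_measurable_scaleR) auto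
  qed simp
  also have "\<dots> = c" by (simp add: S.P.prob_space)
  finally show ?thesis unfolding c_def S.P_def by (rule sym)
qed

theorem corollary2p16:
  fixes M :: "nat \<Rightarrow> 'a measure" and \<tau> :: "nat \<Rightarrow> 'a \<Rightarrow> nat \<Rightarrow> nat"
    and p1 p2 :: real and r :: nat
  assumes "\<And>n. n \<ge> 1 \<Longrightarrow> random_permutation n (M n) (\<tau> n)"
    and "\<And>n. n \<ge> 1 \<Longrightarrow> conjugation_invariant n (M n) (\<tau> n)"
    and "p1 \<in> {0..1}" and "p2 \<in> {0..1}"
    and "small_o_prob M (\<lambda>n \<omega>. real (cycle_count n (\<tau> n \<omega>) 1) - real n * p1)
           (\<lambda>n. sqrt (real n))"
    and "small_o_prob M (\<lambda>n \<omega>. 2 * real (cycle_count n (\<tau> n \<omega>) 2) - real n * p2)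
           (\<lambda>n. real n)"
    and "r \<ge> 1"
  shows "\<exists>L. centered_gaussian (perms r) (Sigma_lim r p1 p2) L \<and>
           converges_in_distribution (perms r) M
             (\<lambda>n \<omega>. \<lambda>\<pi>\<in>perms r.
                (real (pattern_count n r \<pi> (\<tau> n \<omega>)) - real (n choose r) * mu r p1 \<pi>)
                  / real n powr (real r - 1 / 2))
             L"
proof -
  have p: "0 \<le> p1" "p1 \<le> 1" using assms(3) by auto
  note r = assms(7)
  define e1 where "e1 n \<sigma> = (real (cycle_count n \<sigma> 1) - real n * p1) / sqrt (real n)" for n \<sigma>
  define e2 where "e2 n \<sigma> = (2 * real (cycle_count n \<sigma> 2) - real n * p2) / real n" for n \<sigma>
  define A1 where "A1 \<epsilon> n = {\<omega> \<in> space (M n). \<bar>e1 n (\<tau> n \<omega>)\<bar> > \<epsilon>}" for \<epsilon> n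
  define A2 where "A2 \<epsilon> n = {\<omega> \<in> space (M n). \<bar>e2 n (\<tau> n \<omega>)\<bar> > \<epsilon>}" for \<epsilon> n
  have A: "(\<lambda>n. measure (M n) (A1 \<epsilon> n)) \<longlonglongrightarrow> 0" "(\<lambda>n. measure (M n) (A2 \<epsilon> n)) \<longlonglongrightarrow> 0" if "\<epsilon> > 0" for \<epsilon>
    using assms(5,6) that by (simp_all add: small_o_prob_def A1_def A2_def e1_def e2_def)
  have M: "prob_space (M n)" and \<tau>: "\<tau> n \<in> measurable (M n) (count_space (perms n))" if "n \<ge> 1" for n
    using assms(1)[OF that] by (auto simp: random_permutation_def)
  have \<tau>_in: "\<tau> n \<omega> \<in> perms n" if "n \<ge> 1" "\<omega> \<in> space (M n)" for n \<omega>
    using measurable_space[OF \<tau>[OF that(1)] that(2)] by simp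
  have Am: "A1 \<epsilon> n \<in> sets (M n)" "A2 \<epsilon> n \<in> sets (M n)" if n: "n \<ge> 1" for \<epsilon> n
  proof -
    have pr: "{\<omega> \<in> space (M n). B (\<tau> n \<omega>)} \<in> sets (M n)" for B
    proof -
      have "{\<omega> \<in> space (M n). B (\<tau> n \<omega>)} = \<tau> n -` {\<sigma> \<in> perms n. B \<sigma>} \<inter> space (M n)"
        using \<tau>_in[OF n] by auto
      then show ?thesis using measurable_sets[OF \<tau>[OF n], of "{\<sigma> \<in> perms n. B \<sigma>}"] by simp
    qed
    show "A1 \<epsilon> n \<in> sets (M n)" "A2 \<epsilon> n \<in> sets (M n)"
      unfolding A1_def A2_def by (rule pr)+
  qed
  have sqrt_lim: "(\<lambda>n. 1 / sqrt (real n)) \<longlonglongrightarrow> 0"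
    by real_asymp
  \<comment> \<open>For large \<open>n\<close> each exceptional event has probability below
    \<open>1/2\<close>, so some outcome avoids both. The permutation at that outcome makes the error
    in \<open>charfun_bound\<close> too small for a negative form.\<close>
  have psd: "qvar r p1 p2 \<theta> \<ge> 0" for \<theta>
  proof (rule ccontr)
    assume neg: "\<not> qvar r p1 p2 \<theta> \<ge> 0"
    obtain K where K: "K \<ge> 0" "\<And>n \<sigma>. n \<ge> 1 \<Longrightarrow> \<sigma> \<in> perms n \<Longrightarrow>
       - qvar r p1 p2 \<theta> \<le> K * (1 / sqrt (real n) + \<bar>e1 n \<sigma>\<bar> + \<bar>e2 n \<sigma>\<bar>)"
      using charfun_bound[OF p r, of p2 \<theta>] unfolding Let_def e1_def e2_def by blast
    \<comment> \<open>The error term is then at most \<open>3 * K * \<epsilon>\<close>, strictly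
      less than \<open>4 * (K + 1) * \<epsilon> = - qvar r p1 p2 \<theta>\<close>.\<close>
    define \<epsilon> where "\<epsilon> = - qvar r p1 p2 \<theta> / (4 * (K + 1))"
    have \<epsilon>: "\<epsilon> > 0" using neg K(1) unfolding \<epsilon>_def by (intro divide_pos_pos) auto
    have "\<forall>\<^sub>F n in sequentially. measure (M n) (A1 \<epsilon> n) < 1 / 2 \<and> measure (M n) (A2 \<epsilon> n) < 1 / 2
        \<and> 1 / sqrt (real n) < \<epsilon> \<and> n \<ge> 1"
      by (intro eventually_conj order_tendstoD(2)[OF A(1)[OF \<epsilon>]] order_tendstoD(2)[OF A(2)[OF \<epsilon>]]
        order_tendstoD(2)[OF sqrt_lim \<epsilon>] eventually_ge_at_top) auto
    from eventually_happens'[OF sequentially_bot this] obtain n where n: "measure (M n) (A1 \<epsilon> n) < 1 / 2" "measure (M n) (A2 \<epsilon> n) < 1 / 2" "1 / sqrt (real n) < \<epsilon>" "n \<ge> 1"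
      by blast
    interpret prob_space "M n" by (rule M[OF n(4)])
    have "measure (M n) (A1 \<epsilon> n \<union> A2 \<epsilon> n) < 1"
      using measure_Un_le[OF Am(1)[OF n(4), of \<epsilon>] Am(2)[OF n(4), of \<epsilon>]] n(1,2) by linarith
    then have "A1 \<epsilon> n \<union> A2 \<epsilon> n \<noteq> space (M n)" using prob_space by auto
    moreover have "A1 \<epsilon> n \<union> A2 \<epsilon> n \<subseteq> space (M n)" by (auto simp: A1_def A2_def)
    ultimately obtain \<omega> where o: "\<omega> \<in> space (M n)" "\<omega> \<notin> A1 \<epsilon> n" "\<omega> \<notin> A2 \<epsilon> n" by blast
    then have \<omega>: "\<omega> \<in> space (M n)" "\<bar>e1 n (\<tau> n \<omega>)\<bar> \<le> \<epsilon>" "\<bar>e2 n (\<tau> n \<omega>)\<bar> \<le> \<epsilon>"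
      by (simp_all add: A1_def A2_def not_less)
    have "- qvar r p1 p2 \<theta> \<le> K * (1 / sqrt (real n) + \<bar>e1 n (\<tau> n \<omega>)\<bar> + \<bar>e2 n (\<tau> n \<omega>)\<bar>)"
      by (rule K(2)[OF n(4) \<tau>_in[OF n(4) \<omega>(1)]])
    also have "\<dots> \<le> K * (3 * \<epsilon>)" using K(1) n(3) \<omega> by (intro mult_left_mono) auto
    also have "\<dots> < 4 * (K + 1) * \<epsilon>" using mult_nonneg_nonneg[OF K(1) less_imp_le[OF \<epsilon>]] \<epsilon> by (simp add: algebra_simps)
    also have "\<dots> = - qvar r p1 p2 \<theta>" using K(1) by (simp add: \<epsilon>_def)
    finally show False by simp
  qed
  obtain L where L: "centered_gaussian (perms r) (Sigma_lim r p1 p2) L"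
    and Lc: "\<And>t. (\<integral>x. iexp (\<Sum>\<pi>\<in>perms r. t \<pi> * x \<pi>) \<partial>L) = exp (- of_real (qvar r p1 p2 t / 2))"
    using centered_gaussian_exists[OF finite_perms psd[unfolded qvar_def]] unfolding qvar_def by blast
  define Y where "Y n \<omega> = (\<lambda>\<pi>\<in>perms r. (real (pattern_count n r \<pi> (\<tau> n \<omega>)) - real (n choose r) * mu r p1 \<pi>)
                  / real n powr (real r - 1 / 2))" for n \<omega>
  have Ym: "Y n \<in> measurable (M n) (PiM (perms r) (\<lambda>_. borel))" if "n \<ge> 1" for n
    unfolding Y_def by (intro measurable_restrict measurable_compose[OF \<tau>[OF that]]) auto
  \<comment> \<open>\<open>M n\<close> is known to be a probability space only for
    \<open>n \<ge> 1\<close>, whereas the continuity theorem treats whole sequences. The shift by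
    \<open>Suc\<close> is undone at the end.\<close>
  have char: "(\<lambda>n. \<integral>x. iexp (\<Sum>\<pi>\<in>perms r. t \<pi> * x \<pi>) \<partial>distr (M (Suc n)) (PiM (perms r) (\<lambda>_. borel)) (Y (Suc n)))
      \<longlonglongrightarrow> (\<integral>x. iexp (\<Sum>\<pi>\<in>perms r. t \<pi> * x \<pi>) \<partial>L)" for t
  proof -
    define q where "q = exp (- complex_of_real (qvar r p1 p2 t / 2))"
    have nq: "cmod q \<le> 1" unfolding q_def using psd[of t] by (simp add: norm_exp)
    obtain K where K: "K \<ge> 0" "\<And>n \<sigma>. n \<ge> 1 \<Longrightarrow> \<sigma> \<in> perms n \<Longrightarrow>
       cmod ((\<integral>U. iexp (stat n r p1 t \<sigma> U) \<partial>PiM {1..n} (\<lambda>_. unif)) - q) \<le> K * (1 / sqrt (real n) + \<bar>e1 n \<sigma>\<bar> + \<bar>e2 n \<sigma>\<bar>)"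
      using charfun_bound[OF p r, of p2 t] psd[of t] unfolding Let_def e1_def e2_def q_def by blast
    define F where "F n \<sigma> = iexp (\<Sum>\<pi>\<in>perms r. t \<pi> * ((real (pattern_count n r \<pi> \<sigma>) - real (n choose r) * mu r p1 \<pi>)
                  / real n powr (real r - 1 / 2)))" for n \<sigma>
    have char_eq: "(\<integral>x. iexp (\<Sum>\<pi>\<in>perms r. t \<pi> * x \<pi>) \<partial>distr (M n) (PiM (perms r) (\<lambda>_. borel)) (Y n)) = (\<integral>\<omega>. F n (\<tau> n \<omega>) \<partial>M n)"
      if "n \<ge> 1" for n
      using Ym[OF that] by (subst integral_distr) (auto simp: Y_def F_def)
    \<comment> \<open>Off \<open>A1\<close> and \<open>A2\<close> both cycle count errors are at
      most \<open>\<epsilon>\<close>; on them, two numbers of modulus at most \<open>1\<close>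
      differ by at most \<open>2\<close>.\<close>
    have bound: "cmod ((\<integral>\<omega>. F n (\<tau> n \<omega>) \<partial>M n) - q)
      \<le> K * (1 / sqrt (real n) + 2 * \<epsilon>) + 2 * measure (M n) (A1 \<epsilon> n) + 2 * measure (M n) (A2 \<epsilon> n)"
      if n: "n \<ge> 1" and \<epsilon>: "\<epsilon> > 0" for n \<epsilon>
    proof -
      interpret prob_space "M n" by (rule M[OF n])
      define P where "P = PiM {1..n} (\<lambda>_. unif)"
      have smp: "sample n \<sigma>" if "\<sigma> \<in> perms n" for \<sigma> using that n by (simp add: sample_def perms_def)
      interpret P: prob_space P unfolding P_def by (intro prob_space_PiM prob_space_unif)
      have stm: "stat n r p1 t \<sigma> \<in> borel_measurable P" if "\<sigma> \<in> perms n" for \<sigma>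
        using sample.stat_measurable[OF smp[OF that]] sample.P_def[OF smp[OF that]] by (simp add: P_def)
      have Fst: "iexp (stat n r p1 t \<sigma> U) = F n (rank n U \<circ> \<sigma> \<circ> inv (rank n U))"
        if \<sigma>: "\<sigma> \<in> perms n" and U: "inj_on U {1..n}" for \<sigma> U
      proof -
        have "real (pattern_count n r \<pi> (rank n U \<circ> \<sigma> \<circ> inv (rank n U)))
            = (\<Sum>k\<in>{1..r} \<rightarrow>\<^sub>E {1..n}. perm_ind r \<pi> (\<lambda>j\<in>{1..r}. pt \<sigma> U (k j))) / fact r" if "\<pi> \<in> perms r" for \<pi>
          unfolding pattern_count_rank[OF U _ that, of \<sigma>, OF \<sigma>[unfolded perms_def mem_Collect_eq]]
            sum_perm_ind[OF finite_atLeastAtMost] by simp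
        then show ?thesis unfolding F_def stat_def by simp
      qed
      \<comment> \<open>\<open>conjugation_average\<close> writes the characteristic function as a
        weighted sum of the values \<open>\<Phi> \<sigma>\<close>, and
        \<open>perms_expectation\<close> read backwards makes it the mean of \<open>\<Phi>\<close>
        at the random permutation.\<close>
      define \<Phi> where "\<Phi> \<sigma> = (\<integral>U. iexp (stat n r p1 t \<sigma> U) \<partial>P)" for \<sigma>
      have "(\<integral>\<omega>. F n (\<tau> n \<omega>) \<partial>M n) = (\<Sum>\<sigma>\<in>perms n. measure (M n) {\<omega> \<in> space (M n). \<tau> n \<omega> = \<sigma>} *\<^sub>R \<Phi> \<sigma>)"
        unfolding \<Phi>_def P_def
      proof (rule conjugation_average[OF n assms(1)[OF n] assms(2)[OF n]])
        show "(\<lambda>U. iexp (stat n r p1 t \<sigma> U)) \<in> borel_measurable (PiM {1..n} (\<lambda>_. unif))" if "\<sigma> \<in> perms n" for \<sigma>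
          using stm[OF that] unfolding P_def by measurable
      qed (rule Fst | simp)+
      also have "\<dots> = (\<integral>\<omega>. \<Phi> (\<tau> n \<omega>) \<partial>M n)" by (rule perms_expectation[OF M[OF n] \<tau>[OF n], symmetric])
      finally have E: "(\<integral>\<omega>. F n (\<tau> n \<omega>) \<partial>M n) = (\<integral>\<omega>. \<Phi> (\<tau> n \<omega>) \<partial>M n)" .
      have fm: "(\<lambda>\<omega>. f (\<tau> n \<omega>)) \<in> borel_measurable (M n)" for f :: "_ \<Rightarrow> complex"
        by (rule measurable_compose[OF \<tau>[OF n]]) simp
      have \<Phi>1: "cmod (\<Phi> \<sigma>) \<le> 1" if "\<sigma> \<in> perms n" for \<sigma>
        unfolding \<Phi>_def using stm[OF that] by (intro P.norm_expectation_le) auto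
      have i\<Phi>: "integrable (M n) (\<lambda>\<omega>. \<Phi> (\<tau> n \<omega>))"
        using \<Phi>1 \<tau>_in[OF n] by (intro bounded_integrable[OF fm, of _ 1]) auto
      define c where "c = K * (1 / sqrt (real n) + 2 * \<epsilon>)"
      have c0: "c \<ge> 0" using K(1) \<epsilon> by (simp add: c_def)
      have "(\<integral>\<omega>. F n (\<tau> n \<omega>) \<partial>M n) - q = (\<integral>\<omega>. \<Phi> (\<tau> n \<omega>) - q \<partial>M n)"
        unfolding E using i\<Phi> by (simp add: prob_space)
      also have "cmod \<dots> \<le> (\<integral>\<omega>. cmod (\<Phi> (\<tau> n \<omega>) - q) \<partial>M n)" by (rule integral_norm_bound)
      also have "\<dots> \<le> (\<integral>\<omega>. c + 2 * indicator (A1 \<epsilon> n) \<omega> + 2 * indicator (A2 \<epsilon> n) \<omega> \<partial>M n)"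
      proof (rule integral_mono)
        show "integrable (M n) (\<lambda>\<omega>. c + 2 * indicator (A1 \<epsilon> n) \<omega> + 2 * indicator (A2 \<epsilon> n) \<omega> :: real)"
          using Am[OF n] by (intro Bochner_Integration.integrable_add integrable_mult_right integrable_real_indicator) (auto simp: less_top[symmetric])
        show "cmod (\<Phi> (\<tau> n \<omega>) - q) \<le> c + 2 * indicator (A1 \<epsilon> n) \<omega> + 2 * indicator (A2 \<epsilon> n) \<omega>"
          if \<omega>: "\<omega> \<in> space (M n)" for \<omega>
        proof (cases "\<omega> \<in> A1 \<epsilon> n \<or> \<omega> \<in> A2 \<epsilon> n")
          case True
          have "cmod (\<Phi> (\<tau> n \<omega>) - q) \<le> 2"
            using norm_triangle_ineq4[of "\<Phi> (\<tau> n \<omega>)" q] \<Phi>1[OF \<tau>_in[OF n \<omega>]] nq by linarith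
          then show ?thesis using True c0 by (auto simp: indicator_def)
        next
          case False
          then have "\<bar>e1 n (\<tau> n \<omega>)\<bar> \<le> \<epsilon>" "\<bar>e2 n (\<tau> n \<omega>)\<bar> \<le> \<epsilon>" using \<omega> by (auto simp: A1_def A2_def)
          then have "K * (1 / sqrt (real n) + \<bar>e1 n (\<tau> n \<omega>)\<bar> + \<bar>e2 n (\<tau> n \<omega>)\<bar>) \<le> c"
            unfolding c_def using K(1) by (intro mult_left_mono) auto
          moreover have "cmod (\<Phi> (\<tau> n \<omega>) - q) \<le> K * (1 / sqrt (real n) + \<bar>e1 n (\<tau> n \<omega>)\<bar> + \<bar>e2 n (\<tau> n \<omega>)\<bar>)"
            unfolding \<Phi>_def P_def by (rule K(2)[OF n \<tau>_in[OF n \<omega>]])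
          ultimately show ?thesis using False by simp
        qed
      qed (use i\<Phi> in auto)
      also have "\<dots> = c + 2 * measure (M n) (A1 \<epsilon> n) + 2 * measure (M n) (A2 \<epsilon> n)"
      proof -
        have i: "integrable (M n) (\<lambda>\<omega>. indicator (A1 \<epsilon> n) \<omega> :: real)" "integrable (M n) (\<lambda>\<omega>. indicator (A2 \<epsilon> n) \<omega> :: real)"
          using Am[OF n] by (auto intro!: integrable_real_indicator simp: less_top[symmetric])
        then show ?thesis using Am[OF n] by (simp add: prob_space)
      qed
      finally show ?thesis by (simp add: c_def)
    qed
    have "(\<lambda>n. \<integral>\<omega>. F n (\<tau> n \<omega>) \<partial>M n) \<longlonglongrightarrow> q"
    proof (rule tendstoI)
      fix e :: real assume e: "e > 0"
      \<comment> \<open>Chosen so that the limit \<open>2 * K * \<epsilon>\<close> of the bound is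
        at most \<open>e / 4\<close>.\<close>
      define \<epsilon> where "\<epsilon> = e / (8 * (K + 1))"
      have \<epsilon>: "\<epsilon> > 0" using e K(1) by (simp add: \<epsilon>_def)
      have "(\<lambda>n. K * (1 / sqrt (real n) + 2 * \<epsilon>) + 2 * measure (M n) (A1 \<epsilon> n) + 2 * measure (M n) (A2 \<epsilon> n))
        \<longlonglongrightarrow> K * (0 + 2 * \<epsilon>) + 2 * 0 + 2 * 0"
        by (intro tendsto_intros sqrt_lim A \<epsilon>)
      moreover have "K * (0 + 2 * \<epsilon>) + 2 * 0 + 2 * 0 < e"
      proof -
        have "K * (2 * \<epsilon>) \<le> (K + 1) * (2 * \<epsilon>)" using \<epsilon> by (intro mult_right_mono) auto
        also have "\<dots> = e / 4" using K(1) by (simp add: \<epsilon>_def field_simps)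
        finally show ?thesis using e by simp
      qed
      ultimately have "\<forall>\<^sub>F n in sequentially. K * (1 / sqrt (real n) + 2 * \<epsilon>) + 2 * measure (M n) (A1 \<epsilon> n) + 2 * measure (M n) (A2 \<epsilon> n) < e"
        by (rule order_tendstoD(2))
      then show "\<forall>\<^sub>F n in sequentially. dist (\<integral>\<omega>. F n (\<tau> n \<omega>) \<partial>M n) q < e"
        using eventually_ge_at_top[of 1]
        by eventually_elim (use bound[OF _ \<epsilon>] in \<open>fastforce simp: dist_norm\<close>)
    qed
    then have "(\<lambda>n. \<integral>\<omega>. F (Suc n) (\<tau> (Suc n) \<omega>) \<partial>M (Suc n)) \<longlonglongrightarrow> q" by (rule LIMSEQ_Suc)
    then show ?thesis unfolding Lc q_def using char_eq by simp
  qed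
  have "converges_in_distribution (perms r) M Y L"
    unfolding converges_in_distribution_def
  proof (intro allI impI, elim conjE)
    fix f :: "((nat \<Rightarrow> nat) \<Rightarrow> real) \<Rightarrow> real"
    assume f: "continuous_map (product_topology (\<lambda>_. euclideanreal) (perms r)) euclideanreal f" "bounded (f ` (perms r \<rightarrow>\<^sub>E UNIV))"
    have "(\<lambda>n. \<integral>x. f x \<partial>distr (M (Suc n)) (PiM (perms r) (\<lambda>_. borel)) (Y (Suc n))) \<longlonglongrightarrow> (\<integral>x. f x \<partial>L)"
    proof (rule multivariate_levy_continuity[OF finite_perms _ _ _ _ char f])
      show "prob_space (distr (M (Suc n)) (PiM (perms r) (\<lambda>_. borel)) (Y (Suc n)))" for n
        by (intro prob_space.prob_space_distr M Ym) auto
      show "prob_space L" "sets L = sets (PiM (perms r) (\<lambda>_. borel))"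
        using L by (auto simp: centered_gaussian_def)
    qed simp
    then show "(\<lambda>n. \<integral>x. f x \<partial>distr (M n) (PiM (perms r) (\<lambda>_. borel)) (Y n)) \<longlonglongrightarrow> (\<integral>x. f x \<partial>L)"
      by (rule LIMSEQ_imp_Suc)
  qed
  with L show ?thesis unfolding Y_def[abs_def] by blast
qed

end
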